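(* Over $\mathsf{ACA}_0^{\omega}+\mathsf{QF\text{-}AC}^{0,1}$, the principle $\mathsf{NIN}_{[0,1]}$ (there is no injection from $[0,1]$ to $\mathbb{N}$) follows from each of the following closure properties. (a) For any set $X\subset\mathbb{R}$ that is $\mathbf{F}_\sigma$, the closure $\overline{X}$ exists. (b) For any set $X\subset\mathbb{R}$ that is $\mathbf{G}_\delta$, the interior $\mathrm{int}(X)$ exists.
   Context: $\mathsf{RCA}_0^{\omega}$ is Kohlenbach's base theory of higher-order Reverse Mathematics: classical logic in the language of all finite types, primitive recursive arithmetic in all finite types (combinators, recursor for type $0$, quantifier-free induction, axiom of extensionality) plus $\mathsf{QF\text{-}AC}^{1,0}$, i.e. for quantifier-free $\varphi$: $(\forall f\in\mathbb{N}^{\mathbb{N}})(\exists n\in\mathbb{N})\varphi(f,n)\to(\exists\Phi:\mathbb{N}^{\mathbb{N}}\to\mathbb{N})(\forall f)\varphi(f,\Phi(f))$. $\mathsf{ACA}_0^{\omega}$ is $\mathsf{RCA}_0^{\omega}+(\exists^2)$, where $(\exists^2)$ is: $(\exists E:\mathbb{N}^{\mathbb{N}}\to\{0,1\})(\forall f\in\mathbb{N}^{\mathbb{N}})\big(E(f)=0\leftrightarrow(\exists n\in\mathbb{N})(f(n)=0)\big)$. $\mathsf{QF\text{-}AC}^{0,1}$: for quantifier-free $\varphi$ (parameters of any type allowed), if $(\forall n\in\mathbb{N})(\exists f\in\mathbb{N}^{\mathbb{N}})\varphi(f,n)$ then there is a sequence $(f_n)_{n\in\mathbb{N}}$ in $\mathbb{N}^{\mathbb{N}}$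 with $(\forall n)\varphi(f_n,n)$. Reals are fast-converging Cauchy sequences of rationals; functions on $\mathbb{R}$ (or $[0,1]$) are functionals on Baire space respecting $=_{\mathbb{R}}$. A set $A\subset\mathbb{R}$ is given by a representation function $F_A:\mathbb{R}\to\mathbb{R}^{+}\cup\{0\}$ with $x\in A\leftrightarrow F_A(x)>0$ (over $\mathsf{ACA}_0^\omega$ equivalently by a characteristic function); a set exists if such a function exists. $O$ is open if $x\in O$ implies $B(x,2^{-k})\subseteq O$ for some $k\in\mathbb{N}$, where $B(x,r)$ is the open ball; closed sets are complements of open sets. A set is $\mathbf{F}_\sigma$ if it is the union of a sequence $(F_n)_{n\in\mathbb{N}}$ of closed sets, and $\mathbf{G}_\delta$ if it is the intersection of a sequence of open sets; no second-order codes are assumed. $x$ is a limit point of $E$ if $(\forall k)(\exists y\in B(x,2^{-k}))(y\neq x\wedge y\in E)$; $\overline{E}$ is $E$ together with all its limit points; $\mathrm{int}(E)=\{x\in E:(\exists N)(B(x,2^{-N})\subset E)\}$. An injection from $[0,1]$ to $\mathbb{N}$ is a function $Y:[0,1]\to\mathbb{N}$ with $Y(x)=Y(y)\to x=_{\mathbb{R}}y$ for all $x,y\in[0,1]$. *)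

theory Defs
  imports Main
begin

section \<open>The language of all finite types\<close>

datatype ty = Base | Fn ty ty (infixr \<open>\<rightarrow>\<close> 70)

abbreviation "ty1 \<equiv> Base \<rightarrow> Base"
abbreviation "ty2 \<equiv> ty1 \<rightarrow> Base"

primrec cod :: "ty \<Rightarrow> ty" where
  "cod Base = Base"
| "cod (\<sigma> \<rightarrow> \<tau>) = \<tau>"

text \<open>A variable is a pair of an index and a type.  \<open>Kc\<close> and \<open>Sc\<close> are the typed combinators
  (written Pi and Sigma by Kohlenbach), \<open>Rc\<close> is the recursor of type 0.\<close>

datatype tm =
    Var nat ty
  | Zero
  | Succ
  | Kc ty ty
  | Sc ty ty ty
  | Rc
  | App tm tm (infixl \<open>\<cdot>\<close> 90)

primrec ty_of :: "tm \<Rightarrow> ty" where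
  "ty_of (Var n \<sigma>) = \<sigma>"
| "ty_of Zero = Base"
| "ty_of Succ = ty1"
| "ty_of (Kc \<rho> \<sigma>) = \<rho> \<rightarrow> \<sigma> \<rightarrow> \<rho>"
| "ty_of (Sc \<rho> \<sigma> \<tau>) = (\<rho> \<rightarrow> \<sigma> \<rightarrow> \<tau>) \<rightarrow> (\<rho> \<rightarrow> \<sigma>) \<rightarrow> \<rho> \<rightarrow> \<tau>"
| "ty_of Rc = Base \<rightarrow> Base \<rightarrow> (Base \<rightarrow> Base \<rightarrow> Base) \<rightarrow> Base"
| "ty_of (s \<cdot> t) = cod (ty_of s)"

primrec wt :: "tm \<Rightarrow> bool" where
  "wt (Var n \<sigma>) = True"
| "wt Zero = True"
| "wt Succ = True"
| "wt (Kc \<rho> \<sigma>) = True"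
| "wt (Sc \<rho> \<sigma> \<tau>) = True"
| "wt Rc = True"
| "wt (s \<cdot> t) = (wt s \<and> wt t \<and> ty_of s = ty_of t \<rightarrow> cod (ty_of s))"

primrec fv_tm :: "tm \<Rightarrow> (nat \<times> ty) set" where
  "fv_tm (Var n \<sigma>) = {(n, \<sigma>)}"
| "fv_tm Zero = {}"
| "fv_tm Succ = {}"
| "fv_tm (Kc \<rho> \<sigma>) = {}"
| "fv_tm (Sc \<rho> \<sigma> \<tau>) = {}"
| "fv_tm Rc = {}"
| "fv_tm (s \<cdot> t) = fv_tm s \<union> fv_tm t"

primrec subst_tm :: "nat \<times> ty \<Rightarrow> tm \<Rightarrow> tm \<Rightarrow> tm" where
  "subst_tm x u (Var n \<sigma>) = (if (n, \<sigma>) = x then u else Var n \<sigma>)"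
| "subst_tm x u Zero = Zero"
| "subst_tm x u Succ = Succ"
| "subst_tm x u (Kc \<rho> \<sigma>) = Kc \<rho> \<sigma>"
| "subst_tm x u (Sc \<rho> \<sigma> \<tau>) = Sc \<rho> \<sigma> \<tau>"
| "subst_tm x u Rc = Rc"
| "subst_tm x u (s \<cdot> t) = subst_tm x u s \<cdot> subst_tm x u t"

text \<open>The only prime formulas are equations between terms of type 0; equality at higher types is
  an abbreviation, see \<open>eq\<close> below.\<close>

datatype fm =
    EqN tm tm
  | Falsum
  | Imp fm fm
  | Forall nat ty fm

definition Neg :: "fm \<Rightarrow> fm" where "Neg \<phi> = Imp \<phi> Falsum"
definition Conj :: "fm \<Rightarrow> fm \<Rightarrow> fm" where "Conj \<phi> \<psi> = Neg (Imp \<phi> (Neg \<psi>))"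
definition Disj :: "fm \<Rightarrow> fm \<Rightarrow> fm" where "Disj \<phi> \<psi> = Imp (Neg \<phi>) \<psi>"
definition Exists :: "nat \<Rightarrow> ty \<Rightarrow> fm \<Rightarrow> fm" where "Exists n \<sigma> \<phi> = Neg (Forall n \<sigma> (Neg \<phi>))"

primrec wff :: "fm \<Rightarrow> bool" where
  "wff (EqN s t) = (wt s \<and> wt t \<and> ty_of s = Base \<and> ty_of t = Base)"
| "wff Falsum = True"
| "wff (Imp \<phi> \<psi>) = (wff \<phi> \<and> wff \<psi>)"
| "wff (Forall n \<sigma> \<phi>) = wff \<phi>"

primrec fv :: "fm \<Rightarrow> (nat \<times> ty) set" where
  "fv (EqN s t) = fv_tm s \<union> fv_tm t"
| "fv Falsum = {}"
| "fv (Imp \<phi> \<psi>) = fv \<phi> \<union> fv \<psi>"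
| "fv (Forall n \<sigma> \<phi>) = fv \<phi> - {(n, \<sigma>)}"

primrec qfree :: "fm \<Rightarrow> bool" where
  "qfree (EqN s t) = True"
| "qfree Falsum = True"
| "qfree (Imp \<phi> \<psi>) = (qfree \<phi> \<and> qfree \<psi>)"
| "qfree (Forall n \<sigma> \<phi>) = False"

text \<open>Naive substitution; it is only used together with \<open>free_for\<close> or on
  quantifier-free formulas.\<close>

primrec subst :: "nat \<times> ty \<Rightarrow> tm \<Rightarrow> fm \<Rightarrow> fm" where
  "subst x u (EqN s t) = EqN (subst_tm x u s) (subst_tm x u t)"
| "subst x u Falsum = Falsum"
| "subst x u (Imp \<phi> \<psi>) = Imp (subst x u \<phi>) (subst x u \<psi>)"
| "subst x u (Forall n \<sigma> \<phi>) = Forall n \<sigma> (if (n, \<sigma>) = x then \<phi> else subst x u \<phi>)"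

primrec free_for :: "tm \<Rightarrow> nat \<times> ty \<Rightarrow> fm \<Rightarrow> bool" where
  "free_for u x (EqN s t) = True"
| "free_for u x Falsum = True"
| "free_for u x (Imp \<phi> \<psi>) = (free_for u x \<phi> \<and> free_for u x \<psi>)"
| "free_for u x (Forall n \<sigma> \<phi>) =
     (x \<notin> fv (Forall n \<sigma> \<phi>) \<or> (n, \<sigma>) \<notin> fv_tm u \<and> free_for u x \<phi>)"


section \<open>Classical many-sorted predicate logic\<close>

text \<open>A Hilbert calculus in the style of Mendelson.  As generalization is unrestricted, the free
  variables of the axioms in \<open>T\<close> are implicitly universally quantified.\<close>

inductive provable :: "fm set \<Rightarrow> fm \<Rightarrow> bool" (infix \<open>\<turnstile>\<close> 20) for T :: "fm set" where
  Ax: "\<phi> \<in> T \<Longrightarrow> wff \<phi> \<Longrightarrow> T \<turnstile> \<phi>"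
| Weak: "wff \<phi> \<Longrightarrow> wff \<psi> \<Longrightarrow> T \<turnstile> Imp \<phi> (Imp \<psi> \<phi>)"
| Dist: "wff \<phi> \<Longrightarrow> wff \<psi> \<Longrightarrow> wff \<chi> \<Longrightarrow>
    T \<turnstile> Imp (Imp \<phi> (Imp \<psi> \<chi>)) (Imp (Imp \<phi> \<psi>) (Imp \<phi> \<chi>))"
| DNeg: "wff \<phi> \<Longrightarrow> T \<turnstile> Imp (Neg (Neg \<phi>)) \<phi>"
| Inst: "wff \<phi> \<Longrightarrow> wt u \<Longrightarrow> ty_of u = \<sigma> \<Longrightarrow> free_for u (n, \<sigma>) \<phi> \<Longrightarrow>
    T \<turnstile> Imp (Forall n \<sigma> \<phi>) (subst (n, \<sigma>) u \<phi>)"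
| ForallImp: "wff \<phi> \<Longrightarrow> wff \<psi> \<Longrightarrow> (n, \<sigma>) \<notin> fv \<phi> \<Longrightarrow>
    T \<turnstile> Imp (Forall n \<sigma> (Imp \<phi> \<psi>)) (Imp \<phi> (Forall n \<sigma> \<psi>))"
| MP: "T \<turnstile> Imp \<phi> \<psi> \<Longrightarrow> T \<turnstile> \<phi> \<Longrightarrow> T \<turnstile> \<psi>"
| Gen: "T \<turnstile> \<phi> \<Longrightarrow> T \<turnstile> Forall n \<sigma> \<phi>"


section \<open>Writing formulas\<close>

text \<open>Concrete formulas are written in higher-order abstract syntax.  An element \<open>A\<close> of \<open>form\<close> takes
  a number \<open>d\<close> such that no variable with index \<open>\<ge> d\<close> occurs in the terms \<open>A\<close> was built from, and
  yields a formula whose bound variables have indices \<open>\<ge> d\<close>: a quantifier binds the variable with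
  index \<open>d\<close> and passes \<open>Suc d\<close> to its body.  Hence no variable is captured, and \<open>A 0\<close> is the intended
  formula if \<open>A\<close> is built from closed terms.\<close>

type_synonym form = "nat \<Rightarrow> fm"

definition eq0 :: "tm \<Rightarrow> tm \<Rightarrow> form" (infix \<open>\<^bold>=\<close> 50) where "(s \<^bold>= t) = (\<lambda>d. EqN s t)"
definition fnot :: "form \<Rightarrow> form" (\<open>\<^bold>\<not> _\<close> [40] 40) where "(\<^bold>\<not> A) = (\<lambda>d. Neg (A d))"
definition fand :: "form \<Rightarrow> form \<Rightarrow> form" (infixr \<open>\<^bold>\<and>\<close> 35) where "(A \<^bold>\<and> B) = (\<lambda>d. Conj (A d) (B d))"
definition fdisj :: "form \<Rightarrow> form \<Rightarrow> form" (infixr \<open>\<^bold>\<or>\<close> 30) where "(A \<^bold>\<or> B) = (\<lambda>d. Disj (A d) (B d))"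
definition fimp :: "form \<Rightarrow> form \<Rightarrow> form" (infixr \<open>\<^bold>\<longrightarrow>\<close> 25) where "(A \<^bold>\<longrightarrow> B) = (\<lambda>d. Imp (A d) (B d))"
definition fiff :: "form \<Rightarrow> form \<Rightarrow> form" (infixr \<open>\<^bold>\<longleftrightarrow>\<close> 25) where
  "(A \<^bold>\<longleftrightarrow> B) = ((A \<^bold>\<longrightarrow> B) \<^bold>\<and> (B \<^bold>\<longrightarrow> A))"

definition all :: "ty \<Rightarrow> (tm \<Rightarrow> form) \<Rightarrow> form" where
  "all \<sigma> A = (\<lambda>d. Forall d \<sigma> (A (Var d \<sigma>) (Suc d)))"
definition ex :: "ty \<Rightarrow> (tm \<Rightarrow> form) \<Rightarrow> form" where
  "ex \<sigma> A = (\<lambda>d. Exists d \<sigma> (A (Var d \<sigma>) (Suc d)))"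

abbreviation all0 :: "(tm \<Rightarrow> form) \<Rightarrow> form" (binder \<open>\<forall>\<^sub>0\<close> 10) where "all0 A \<equiv> all Base A"
abbreviation ex0 :: "(tm \<Rightarrow> form) \<Rightarrow> form" (binder \<open>\<exists>\<^sub>0\<close> 10) where "ex0 A \<equiv> ex Base A"
abbreviation all1 :: "(tm \<Rightarrow> form) \<Rightarrow> form" (binder \<open>\<forall>\<^sub>1\<close> 10) where "all1 A \<equiv> all ty1 A"
abbreviation ex1 :: "(tm \<Rightarrow> form) \<Rightarrow> form" (binder \<open>\<exists>\<^sub>1\<close> 10) where "ex1 A \<equiv> ex ty1 A"

primrec eq :: "ty \<Rightarrow> tm \<Rightarrow> tm \<Rightarrow> form" where
  "eq Base s t = (s \<^bold>= t)"
| "eq (\<sigma> \<rightarrow> \<tau>) s t = all \<sigma> (\<lambda>y. eq \<tau> (s \<cdot> y) (t \<cdot> y))"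

abbreviation "one \<equiv> Succ \<cdot> Zero"
abbreviation "two \<equiv> Succ \<cdot> one"


section \<open>The theories\<close>

definition eq_axioms :: "fm set" where
  "eq_axioms =
    {(\<forall>\<^sub>0 x. x \<^bold>= x) 0,
     (\<forall>\<^sub>0 x y z. x \<^bold>= y \<^bold>\<longrightarrow> x \<^bold>= z \<^bold>\<longrightarrow> y \<^bold>= z) 0}"

definition succ_axioms :: "fm set" where
  "succ_axioms =
    {(\<forall>\<^sub>0 x. \<^bold>\<not> Succ \<cdot> x \<^bold>= Zero) 0,
     (\<forall>\<^sub>0 x y. Succ \<cdot> x \<^bold>= Succ \<cdot> y \<^bold>\<longrightarrow> x \<^bold>= y) 0}"

definition comb_axioms :: "fm set" where
  "comb_axioms =
    {all \<rho> (\<lambda>x. all \<sigma> (\<lambda>y. eq \<rho> (Kc \<rho> \<sigma> \<cdot> x \<cdot> y) x)) 0 | \<rho> \<sigma>. True} \<union>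
    {all (\<rho> \<rightarrow> \<sigma> \<rightarrow> \<tau>) (\<lambda>x. all (\<rho> \<rightarrow> \<sigma>) (\<lambda>y. all \<rho> (\<lambda>z.
       eq \<tau> (Sc \<rho> \<sigma> \<tau> \<cdot> x \<cdot> y \<cdot> z) (x \<cdot> z \<cdot> (y \<cdot> z))))) 0 | \<rho> \<sigma> \<tau>. True}"

definition rec_axioms :: "fm set" where
  "rec_axioms =
    {(\<forall>\<^sub>0 y. all (Base \<rightarrow> Base \<rightarrow> Base) (\<lambda>z. Rc \<cdot> Zero \<cdot> y \<cdot> z \<^bold>= y)) 0,
     (\<forall>\<^sub>0 x y. all (Base \<rightarrow> Base \<rightarrow> Base) (\<lambda>z.
        Rc \<cdot> (Succ \<cdot> x) \<cdot> y \<cdot> z \<^bold>= z \<cdot> (Rc \<cdot> x \<cdot> y \<cdot> z) \<cdot> x)) 0}"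

definition ext_axioms :: "fm set" where
  "ext_axioms =
    {all (\<sigma> \<rightarrow> \<tau>) (\<lambda>f. all \<sigma> (\<lambda>x. all \<sigma> (\<lambda>y. eq \<sigma> x y \<^bold>\<longrightarrow> eq \<tau> (f \<cdot> x) (f \<cdot> y)))) 0
     | \<sigma> \<tau>. True}"

definition QF_IND :: "fm set" where
  "QF_IND =
    {Imp (subst (n, Base) Zero \<phi>)
      (Imp (Forall n Base (Imp \<phi> (subst (n, Base) (Succ \<cdot> Var n Base) \<phi>)))
        (Forall n Base \<phi>)) | n \<phi>. qfree \<phi> \<and> wff \<phi>}"

definition E_PRA :: "fm set" where
  "E_PRA = eq_axioms \<union> succ_axioms \<union> comb_axioms \<union> rec_axioms \<union> ext_axioms \<union> QF_IND"

text \<open>Quantifier-free choice from type \<open>\<sigma>\<close> to type \<open>\<tau>\<close>; further free variables of \<open>\<phi>\<close> act as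
  parameters.\<close>

definition QF_AC :: "ty \<Rightarrow> ty \<Rightarrow> fm set" where
  "QF_AC \<sigma> \<tau> =
    {Imp (Forall x \<sigma> (Exists y \<tau> \<phi>))
      (Exists F (\<sigma> \<rightarrow> \<tau>) (Forall x \<sigma> (subst (y, \<tau>) (Var F (\<sigma> \<rightarrow> \<tau>) \<cdot> Var x \<sigma>) \<phi>)))
     | x y F \<phi>. qfree \<phi> \<and> wff \<phi> \<and> (x, \<sigma>) \<noteq> (y, \<tau>) \<and> (F, \<sigma> \<rightarrow> \<tau>) \<notin> fv \<phi>}"

definition RCA0\<omega> :: "fm set" where
  "RCA0\<omega> = E_PRA \<union> QF_AC ty1 Base"

definition Exists2 :: fm where
  "Exists2 = ex ty2 (\<lambda>E. \<forall>\<^sub>1 f.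
     (E \<cdot> f \<^bold>= Zero \<^bold>\<or> E \<cdot> f \<^bold>= one) \<^bold>\<and> (E \<cdot> f \<^bold>= Zero \<^bold>\<longleftrightarrow> (\<exists>\<^sub>0 n. f \<cdot> n \<^bold>= Zero))) 0"

definition ACA0\<omega> :: "fm set" where
  "ACA0\<omega> = RCA0\<omega> \<union> {Exists2}"


section \<open>Primitive recursive arithmetic as closed terms\<close>

text \<open>Bracket abstraction: \<open>lam n \<sigma> t\<close> behaves like the lambda-abstraction of the variable
  \<open>(n, \<sigma>)\<close> in \<open>t\<close>.\<close>

primrec lam :: "nat \<Rightarrow> ty \<Rightarrow> tm \<Rightarrow> tm" where
  "lam n \<sigma> (Var m \<tau>) =
     (if (m, \<tau>) = (n, \<sigma>) then Sc \<sigma> (\<sigma> \<rightarrow> \<sigma>) \<sigma> \<cdot> Kc \<sigma> (\<sigma> \<rightarrow> \<sigma>) \<cdot> Kc \<sigma> \<sigma> else Kc \<tau> \<sigma> \<cdot> Var m \<tau>)"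
| "lam n \<sigma> Zero = Kc Base \<sigma> \<cdot> Zero"
| "lam n \<sigma> Succ = Kc ty1 \<sigma> \<cdot> Succ"
| "lam n \<sigma> (Kc \<alpha> \<beta>) = Kc (ty_of (Kc \<alpha> \<beta>)) \<sigma> \<cdot> Kc \<alpha> \<beta>"
| "lam n \<sigma> (Sc \<alpha> \<beta> \<gamma>) = Kc (ty_of (Sc \<alpha> \<beta> \<gamma>)) \<sigma> \<cdot> Sc \<alpha> \<beta> \<gamma>"
| "lam n \<sigma> Rc = Kc (ty_of Rc) \<sigma> \<cdot> Rc"
| "lam n \<sigma> (s \<cdot> t) = Sc \<sigma> (ty_of t) (cod (ty_of s)) \<cdot> lam n \<sigma> s \<cdot> lam n \<sigma> t"

abbreviation vn :: "nat \<Rightarrow> tm" where "vn n \<equiv> Var n Base"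
abbreviation lam0 :: "nat \<Rightarrow> tm \<Rightarrow> tm" where "lam0 n t \<equiv> lam n Base t"

definition PLUS :: tm where
  "PLUS = lam0 0 (lam0 1 (Rc \<cdot> vn 1 \<cdot> vn 0 \<cdot> lam0 2 (lam0 3 (Succ \<cdot> vn 2))))"
abbreviation plus_tm :: "tm \<Rightarrow> tm \<Rightarrow> tm" (infixl \<open>\<oplus>\<close> 65) where "s \<oplus> t \<equiv> PLUS \<cdot> s \<cdot> t"

definition TIMES :: tm where
  "TIMES = lam0 0 (lam0 1 (Rc \<cdot> vn 1 \<cdot> Zero \<cdot> lam0 2 (lam0 3 (vn 2 \<oplus> vn 0))))"
abbreviation times_tm :: "tm \<Rightarrow> tm \<Rightarrow> tm" (infixl \<open>\<otimes>\<close> 70) where "s \<otimes> t \<equiv> TIMES \<cdot> s \<cdot> t"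

definition PRED :: tm where
  "PRED = lam0 0 (Rc \<cdot> vn 0 \<cdot> Zero \<cdot> lam0 2 (lam0 3 (vn 3)))"

text \<open>Truncated subtraction.\<close>
definition MONUS :: tm where
  "MONUS = lam0 0 (lam0 1 (Rc \<cdot> vn 1 \<cdot> vn 0 \<cdot> lam0 2 (lam0 3 (PRED \<cdot> vn 2))))"
abbreviation monus_tm :: "tm \<Rightarrow> tm \<Rightarrow> tm" (infixl \<open>\<ominus>\<close> 65) where "s \<ominus> t \<equiv> MONUS \<cdot> s \<cdot> t"

definition POW2 :: tm where
  "POW2 = lam0 0 (Rc \<cdot> vn 0 \<cdot> one \<cdot> lam0 2 (lam0 3 (vn 2 \<oplus> vn 2)))"

definition le0 :: "tm \<Rightarrow> tm \<Rightarrow> form" (infix \<open>\<^bold>\<le>\<close> 50) where "(s \<^bold>\<le> t) = (s \<ominus> t \<^bold>= Zero)"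
definition less0 :: "tm \<Rightarrow> tm \<Rightarrow> form" (infix \<open>\<^bold><\<close> 50) where "(s \<^bold>< t) = (Succ \<cdot> s \<^bold>\<le> t)"

text \<open>Cantor pairing \<open>\<langle>s, t\<rangle> = TRI (s + t) + s\<close> with the triangular numbers
  \<open>TRI m = 1 + \<dots> + m\<close>; \<open>ROOT z\<close> is the greatest \<open>m\<close> with \<open>TRI m \<le> z\<close>.\<close>

definition TRI :: tm where
  "TRI = lam0 0 (Rc \<cdot> vn 0 \<cdot> Zero \<cdot> lam0 2 (lam0 3 (vn 2 \<oplus> Succ \<cdot> vn 3)))"
definition ROOT :: tm where
  "ROOT = lam0 0 (Rc \<cdot> vn 0 \<cdot> Zero \<cdot>
     lam0 2 (lam0 3 (vn 2 \<oplus> (one \<ominus> (TRI \<cdot> (Succ \<cdot> vn 2) \<ominus> Succ \<cdot> vn 3)))))"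

definition pair :: "tm \<Rightarrow> tm \<Rightarrow> tm" where "pair s t = TRI \<cdot> (s \<oplus> t) \<oplus> s"
definition pfst :: "tm \<Rightarrow> tm" where "pfst z = z \<ominus> TRI \<cdot> (ROOT \<cdot> z)"
definition psnd :: "tm \<Rightarrow> tm" where "psnd z = ROOT \<cdot> z \<ominus> pfst z"


section \<open>Rational and real numbers\<close>

text \<open>Every number is the code of a rational: \<open>\<langle>\<langle>a, b\<rangle>, c\<rangle>\<close> codes \<open>(a - b) / (c + 1)\<close>.\<close>

definition qcode :: "tm \<Rightarrow> tm \<Rightarrow> tm \<Rightarrow> tm" where "qcode a b c = pair (pair a b) c"
definition qpos :: "tm \<Rightarrow> tm" where "qpos q = pfst (pfst q)"
definition qneg :: "tm \<Rightarrow> tm" where "qneg q = psnd (pfst q)"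
definition qden :: "tm \<Rightarrow> tm" where "qden q = Succ \<cdot> psnd q"

definition qless :: "tm \<Rightarrow> tm \<Rightarrow> form" (infix \<open><\<^sub>Q\<close> 50) where
  "(p <\<^sub>Q q) = (qpos p \<otimes> qden q \<oplus> qneg q \<otimes> qden p \<^bold>< qpos q \<otimes> qden p \<oplus> qneg p \<otimes> qden q)"
definition qle :: "tm \<Rightarrow> tm \<Rightarrow> form" (infix \<open>\<le>\<^sub>Q\<close> 50) where
  "(p \<le>\<^sub>Q q) = (qpos p \<otimes> qden q \<oplus> qneg q \<otimes> qden p \<^bold>\<le> qpos q \<otimes> qden p \<oplus> qneg p \<otimes> qden q)"

definition qplus :: "tm \<Rightarrow> tm \<Rightarrow> tm" (infixl \<open>+\<^sub>Q\<close> 65) where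
  "p +\<^sub>Q q = qcode (qpos p \<otimes> qden q \<oplus> qpos q \<otimes> qden p) (qneg p \<otimes> qden q \<oplus> qneg q \<otimes> qden p)
                  (PRED \<cdot> (qden p \<otimes> qden q))"
definition qminus :: "tm \<Rightarrow> tm \<Rightarrow> tm" (infixl \<open>-\<^sub>Q\<close> 65) where
  "p -\<^sub>Q q = qcode (qpos p \<otimes> qden q \<oplus> qneg q \<otimes> qden p) (qneg p \<otimes> qden q \<oplus> qpos q \<otimes> qden p)
                  (PRED \<cdot> (qden p \<otimes> qden q))"
definition qabs :: "tm \<Rightarrow> tm" (\<open>\<bar>_\<bar>\<^sub>Q\<close>) where
  "\<bar>q\<bar>\<^sub>Q = qcode ((qpos q \<ominus> qneg q) \<oplus> (qneg q \<ominus> qpos q)) Zero (psnd q)"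

text \<open>\<open>m / 2 ^ k\<close>\<close>
definition dyad :: "tm \<Rightarrow> tm \<Rightarrow> tm" where
  "dyad m k = qcode m Zero (PRED \<cdot> (POW2 \<cdot> k))"

text \<open>A real is a sequence of rationals \<open>q\<close> with \<open>\<bar>q n - q (n + i)\<bar> < 2 ^ -n\<close> for all \<open>n\<close> and \<open>i\<close>; so
  \<open>q n\<close> has distance at most \<open>2 ^ -n\<close> from the real that is represented.\<close>

definition is_real :: "tm \<Rightarrow> form" where
  "is_real x = (\<forall>\<^sub>0 n i. \<bar>x \<cdot> n -\<^sub>Q x \<cdot> (n \<oplus> i)\<bar>\<^sub>Q <\<^sub>Q dyad one n)"

definition allR :: "(tm \<Rightarrow> form) \<Rightarrow> form" (binder \<open>\<forall>\<^sub>R\<close> 10) where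
  "allR A = (\<forall>\<^sub>1 x. is_real x \<^bold>\<longrightarrow> A x)"
definition exR :: "(tm \<Rightarrow> form) \<Rightarrow> form" (binder \<open>\<exists>\<^sub>R\<close> 10) where
  "exR A = (\<exists>\<^sub>1 x. is_real x \<^bold>\<and> A x)"

definition eqR :: "tm \<Rightarrow> tm \<Rightarrow> form" (infix \<open>=\<^sub>R\<close> 50) where
  "(x =\<^sub>R y) = (\<forall>\<^sub>0 n. \<bar>x \<cdot> n -\<^sub>Q y \<cdot> n\<bar>\<^sub>Q \<le>\<^sub>Q dyad two n)"
definition lessR :: "tm \<Rightarrow> tm \<Rightarrow> form" (infix \<open><\<^sub>R\<close> 50) where
  "(x <\<^sub>R y) = (\<exists>\<^sub>0 n. x \<cdot> n +\<^sub>Q dyad two n <\<^sub>Q y \<cdot> n)"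
definition leR :: "tm \<Rightarrow> tm \<Rightarrow> form" (infix \<open>\<le>\<^sub>R\<close> 50) where
  "(x \<le>\<^sub>R y) = (\<^bold>\<not> y <\<^sub>R x)"

text \<open>\<open>ratR q\<close> is the constant sequence \<open>q\<close>.  The index shift in \<open>DIFF\<close> makes the difference of two
  reals converge fast enough.\<close>

definition ratR :: "tm \<Rightarrow> tm" where "ratR q = Kc Base Base \<cdot> q"
definition DIFF :: tm where
  "DIFF = lam 0 ty1 (lam 1 ty1 (lam0 2
     (Var 0 ty1 \<cdot> (Succ \<cdot> vn 2) -\<^sub>Q Var 1 ty1 \<cdot> (Succ \<cdot> vn 2))))"
definition ABS :: tm where
  "ABS = lam 0 ty1 (lam0 1 \<bar>Var 0 ty1 \<cdot> vn 1\<bar>\<^sub>Q)"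

abbreviation "zeroR \<equiv> ratR (dyad Zero Zero)"
abbreviation "oneR \<equiv> ratR (dyad one Zero)"

text \<open>\<open>y \<in> B(x, 2 ^ -k)\<close>\<close>
definition in_ball :: "tm \<Rightarrow> tm \<Rightarrow> tm \<Rightarrow> form" where
  "in_ball x k y = (ABS \<cdot> (DIFF \<cdot> x \<cdot> y) <\<^sub>R ratR (dyad one k))"


section \<open>Sets of reals\<close>

text \<open>A set is given by a representation function \<open>A\<close> of type \<open>1 \<rightarrow> 1\<close>.\<close>

definition is_set :: "tm \<Rightarrow> form" where
  "is_set A = ((\<forall>\<^sub>R x. is_real (A \<cdot> x) \<^bold>\<and> zeroR \<le>\<^sub>R A \<cdot> x) \<^bold>\<and>
               (\<forall>\<^sub>R x. \<forall>\<^sub>R y. x =\<^sub>R y \<^bold>\<longrightarrow> A \<cdot> x =\<^sub>R A \<cdot> y))"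

definition mem :: "tm \<Rightarrow> tm \<Rightarrow> form" (infix \<open>\<in>\<^sub>R\<close> 50) where
  "(x \<in>\<^sub>R A) = (zeroR <\<^sub>R A \<cdot> x)"

definition is_open :: "tm \<Rightarrow> form" where
  "is_open A = (is_set A \<^bold>\<and>
     (\<forall>\<^sub>R x. x \<in>\<^sub>R A \<^bold>\<longrightarrow> (\<exists>\<^sub>0 k. \<forall>\<^sub>R y. in_ball x k y \<^bold>\<longrightarrow> y \<in>\<^sub>R A)))"

definition is_closed :: "tm \<Rightarrow> form" where
  "is_closed A = (is_set A \<^bold>\<and>
     ex (ty1 \<rightarrow> ty1) (\<lambda>U. is_open U \<^bold>\<and> (\<forall>\<^sub>R x. x \<in>\<^sub>R A \<^bold>\<longleftrightarrow> \<^bold>\<not> x \<in>\<^sub>R U)))"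

definition is_Fsigma :: "tm \<Rightarrow> form" where
  "is_Fsigma A = (is_set A \<^bold>\<and>
     ex (Base \<rightarrow> ty1 \<rightarrow> ty1) (\<lambda>F. (\<forall>\<^sub>0 n. is_closed (F \<cdot> n)) \<^bold>\<and>
       (\<forall>\<^sub>R x. x \<in>\<^sub>R A \<^bold>\<longleftrightarrow> (\<exists>\<^sub>0 n. x \<in>\<^sub>R F \<cdot> n))))"

definition is_Gdelta :: "tm \<Rightarrow> form" where
  "is_Gdelta A = (is_set A \<^bold>\<and>
     ex (Base \<rightarrow> ty1 \<rightarrow> ty1) (\<lambda>U. (\<forall>\<^sub>0 n. is_open (U \<cdot> n)) \<^bold>\<and>
       (\<forall>\<^sub>R x. x \<in>\<^sub>R A \<^bold>\<longleftrightarrow> (\<forall>\<^sub>0 n. x \<in>\<^sub>R U \<cdot> n))))"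

definition limit_point :: "tm \<Rightarrow> tm \<Rightarrow> form" where
  "limit_point A x = (\<forall>\<^sub>0 k. \<exists>\<^sub>R y. in_ball x k y \<^bold>\<and> (\<^bold>\<not> y =\<^sub>R x) \<^bold>\<and> y \<in>\<^sub>R A)"

definition is_closure :: "tm \<Rightarrow> tm \<Rightarrow> form" where
  "is_closure A C = (is_set C \<^bold>\<and> (\<forall>\<^sub>R x. x \<in>\<^sub>R C \<^bold>\<longleftrightarrow> x \<in>\<^sub>R A \<^bold>\<or> limit_point A x))"

definition is_interior :: "tm \<Rightarrow> tm \<Rightarrow> form" where
  "is_interior A C = (is_set C \<^bold>\<and>
     (\<forall>\<^sub>R x. x \<in>\<^sub>R C \<^bold>\<longleftrightarrow> x \<in>\<^sub>R A \<^bold>\<and> (\<exists>\<^sub>0 k. \<forall>\<^sub>R y. in_ball x k y \<^bold>\<longrightarrow> y \<in>\<^sub>R A)))"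

definition Fsigma_closure :: fm where
  "Fsigma_closure = all (ty1 \<rightarrow> ty1) (\<lambda>X. is_Fsigma X \<^bold>\<longrightarrow> ex (ty1 \<rightarrow> ty1) (\<lambda>C. is_closure X C)) 0"

definition Gdelta_interior :: fm where
  "Gdelta_interior = all (ty1 \<rightarrow> ty1) (\<lambda>X. is_Gdelta X \<^bold>\<longrightarrow> ex (ty1 \<rightarrow> ty1) (\<lambda>C. is_interior X C)) 0"


section \<open>No injection from the unit interval to the natural numbers\<close>

definition in_unit :: "tm \<Rightarrow> form" where
  "in_unit x = (zeroR \<le>\<^sub>R x \<^bold>\<and> x \<le>\<^sub>R oneR)"

text \<open>The first conjunct of \<open>is_injection\<close> says that \<open>Y\<close> is a function on \<open>[0,1]\<close>, i.e. respects
  equality of reals.\<close>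

definition is_injection :: "tm \<Rightarrow> form" where
  "is_injection Y =
    ((\<forall>\<^sub>R x. \<forall>\<^sub>R y. in_unit x \<^bold>\<and> in_unit y \<^bold>\<longrightarrow> x =\<^sub>R y \<^bold>\<longrightarrow> Y \<cdot> x \<^bold>= Y \<cdot> y) \<^bold>\<and>
     (\<forall>\<^sub>R x. \<forall>\<^sub>R y. in_unit x \<^bold>\<and> in_unit y \<^bold>\<longrightarrow> Y \<cdot> x \<^bold>= Y \<cdot> y \<^bold>\<longrightarrow> x =\<^sub>R y))"

definition NIN :: fm where
  "NIN = (\<^bold>\<not> ex ty2 is_injection) 0"

end

(* Derivability is reduced to truth in models. A completeness proof for the calculus yields, if one
   of the implications were not derivable, a countermodel, which may be taken extensional. Its
   numbers form a possibly nonstandard discretely ordered semiring; comprehension for arithmetical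
   formulas with parameters of all types holds by the functional of Exists2.

   In such a model suppose that Y is an injection from [0,1] to the numbers. For every n attach to
   the point n the shrinking copies n + 2^-(k+2) * (x + 1) of the at most one x in [0,1] with
   Y x = n. The union X of these copies is F-sigma, because every copy is a closed set with at most
   one element, and n lies in the closure of X iff n is in the range of Y. Hence the closure of X,
   or the interior of the complement of X, decides the range of Y. Now QF-AC(0,1) enumerates [0,1],
   contradicting Cantor's diagonal argument. *)
theory Submission
  imports Defs "HOL-Library.Countable" "HOL-Computational_Algebra.Fraction_Field"
begin


text \<open>The obstacle is that being a value of Y is expressed by a quantifier over reals, which
  the functional of Exists2 cannot decide. The construction hides this quantifier in a set: a real y
  is tested for lying in a copy by scaling y back and applying Y, so X itself is defined with number
  quantifiers only, and it is the request for its closure or interior that leads beyond arithmetic.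
  The copies must shrink because the preimage of n is at most one point, and one point cannot make n
  a limit point; the summand 1 keeps the copies off n even when x is 0.

  The reals of the model live over the ordered field generated by its numbers. That field comes from
  type constructors demanding a type class, whereas a model is a set fixed in a local context. Hence
  one countermodel is chosen globally, its numbers are turned into a type, and the whole argument is
  run in this model by contradiction.\<close>

instance ty :: countable by countable_datatype
instance tm :: countable by countable_datatype
instance fm :: countable by countable_datatype

section \<open>Bound variables, free variables and typing of substitutions\<close>

primrec bv :: "fm \<Rightarrow> (nat \<times> ty) set" where
  "bv (EqN s t) = {}"
| "bv Falsum = {}"
| "bv (Imp \<phi> \<psi>) = bv \<phi> \<union> bv \<psi>"
| "bv (Forall n \<sigma> \<phi>) = insert (n, \<sigma>) (bv \<phi>)"

definition vars :: "fm \<Rightarrow> (nat \<times> ty) set" where "vars \<phi> = fv \<phi> \<union> bv \<phi>"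

lemma vars_simps [simp]:
  "vars (EqN s t) = fv_tm s \<union> fv_tm t" "vars Falsum = {}" "vars (Imp \<phi> \<psi>) = vars \<phi> \<union> vars \<psi>"
  "vars (Forall n \<sigma> \<phi>) = insert (n, \<sigma>) (vars \<phi>)"
  by (auto simp: vars_def)

lemma finite_fv_tm [simp]: "finite (fv_tm t)"
  by (induction t) auto

lemma finite_vars [simp]: "finite (vars \<phi>)"
  by (induction \<phi>) auto

lemma fv_subset_vars: "fv \<phi> \<subseteq> vars \<phi>"
  by (simp add: vars_def)

lemma wff_Neg [simp]: "wff (Neg \<phi>) = wff \<phi>"
  by (simp add: Neg_def)

lemma fv_Neg [simp]: "fv (Neg \<phi>) = fv \<phi>"
  by (simp add: Neg_def)

lemma subst_tm_typed:
  assumes "ty_of u = snd x"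
  shows "ty_of (subst_tm x u t) = ty_of t" and "wt u \<Longrightarrow> wt t \<Longrightarrow> wt (subst_tm x u t)"
proof -
  show ty: "ty_of (subst_tm x u t) = ty_of t" for t
    using assms by (induction t) auto
  show "wt u \<Longrightarrow> wt t \<Longrightarrow> wt (subst_tm x u t)"
    by (induction t) (auto simp: ty)
qed

lemma wff_subst: "wff \<phi> \<Longrightarrow> wt u \<Longrightarrow> ty_of u = snd x \<Longrightarrow> wff (subst x u \<phi>)"
  by (induction \<phi>) (auto simp: subst_tm_typed)

lemma wff_provable: "T \<turnstile> \<phi> \<Longrightarrow> wff \<phi>"
  by (induction rule: provable.induct) (auto intro: wff_subst)

subsection \<open>Renaming of variables\<close>

primrec ren_tm :: "(nat \<Rightarrow> nat) \<Rightarrow> tm \<Rightarrow> tm" where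
  "ren_tm f (Var n \<sigma>) = Var (f n) \<sigma>"
| "ren_tm f Zero = Zero"
| "ren_tm f Succ = Succ"
| "ren_tm f (Kc \<rho> \<sigma>) = Kc \<rho> \<sigma>"
| "ren_tm f (Sc \<rho> \<sigma> \<tau>) = Sc \<rho> \<sigma> \<tau>"
| "ren_tm f Rc = Rc"
| "ren_tm f (s \<cdot> t) = ren_tm f s \<cdot> ren_tm f t"

primrec ren :: "(nat \<Rightarrow> nat) \<Rightarrow> fm \<Rightarrow> fm" where
  "ren f (EqN s t) = EqN (ren_tm f s) (ren_tm f t)"
| "ren f Falsum = Falsum"
| "ren f (Imp \<phi> \<psi>) = Imp (ren f \<phi>) (ren f \<psi>)"
| "ren f (Forall n \<sigma> \<phi>) = Forall (f n) \<sigma> (ren f \<phi>)"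

lemma ren_tm_typed [simp]: "ty_of (ren_tm f t) = ty_of t" "wt (ren_tm f t) = wt t"
proof -
  show ty: "ty_of (ren_tm f t) = ty_of t" for t by (induction t) auto
  show "wt (ren_tm f t) = wt t" by (induction t) (auto simp: ty)
qed

lemma wff_ren [simp]: "wff (ren f \<phi>) = wff \<phi>"
  by (induction \<phi>) auto

lemma ren_Neg [simp]: "ren f (Neg \<phi>) = Neg (ren f \<phi>)"
  by (simp add: Neg_def)

lemma fv_ren_tm [simp]: "fv_tm (ren_tm f t) = apfst f ` fv_tm t"
  by (induction t) auto

lemma vars_ren [simp]: "vars (ren f \<phi>) = apfst f ` vars \<phi>"
  by (induction \<phi>) auto

lemma fv_ren: "inj f \<Longrightarrow> fv (ren f \<phi>) = apfst f ` fv \<phi>"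
  by (induction \<phi>) (auto simp: inj_eq)

lemma ren_subst_tm:
  "inj f \<Longrightarrow> ren_tm f (subst_tm x u t) = subst_tm (apfst f x) (ren_tm f u) (ren_tm f t)"
  by (cases x, induction t) (auto simp: inj_eq)

lemma ren_subst: "inj f \<Longrightarrow> ren f (subst x u \<phi>) = subst (apfst f x) (ren_tm f u) (ren f \<phi>)"
  by (cases x, induction \<phi>) (auto simp: ren_subst_tm inj_eq)

lemma free_for_ren:
  "inj f \<Longrightarrow> free_for (ren_tm f u) (apfst f x) (ren f \<phi>) = free_for u x \<phi>"
proof (induction \<phi>)
  case (Forall n \<sigma> \<phi>)
  have "inj (apfst f :: nat \<times> ty \<Rightarrow> _)" using Forall.prems by (auto simp: inj_def)
  then have "apfst f x \<notin> fv (ren f (Forall n \<sigma> \<phi>)) \<longleftrightarrow> x \<notin> fv (Forall n \<sigma> \<phi>)"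
    using Forall.prems by (simp only: fv_ren inj_image_mem_iff)
  moreover have "(f n, \<sigma>) \<notin> fv_tm (ren_tm f u) \<longleftrightarrow> (n, \<sigma>) \<notin> fv_tm u"
    using Forall.prems by (force simp: inj_eq)
  ultimately show ?case using Forall by simp
qed auto

lemma ren_ren: "ren f (ren g \<phi>) = ren (f \<circ> g) \<phi>"
proof -
  have "ren_tm f (ren_tm g t) = ren_tm (f \<circ> g) t" for t by (induction t) auto
  then show ?thesis by (induction \<phi>) auto
qed

lemma ren_id_on: "\<forall>x \<in> vars \<phi>. f (fst x) = fst x \<Longrightarrow> ren f \<phi> = \<phi>"
proof -
  have "\<forall>x \<in> fv_tm t. f (fst x) = fst x \<Longrightarrow> ren_tm f t = t" for t
    by (induction t) auto
  then show "\<forall>x \<in> vars \<phi>. f (fst x) = fst x \<Longrightarrow> ren f \<phi> = \<phi>"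
    by (induction \<phi>) auto
qed

lemma provable_ren: "T \<turnstile> \<phi> \<Longrightarrow> inj f \<Longrightarrow> ren f ` T \<turnstile> ren f \<phi>"
proof (induction rule: provable.induct)
  case (Inst \<phi> u \<sigma> n)
  then show ?case
    using provable.Inst[of "ren f \<phi>" "ren_tm f u" \<sigma> "f n" "ren f ` T"]
      free_for_ren[of f u "(n, \<sigma>)" \<phi>] ren_subst[of f "(n, \<sigma>)" u \<phi>] by simp
next
  case (ForallImp \<phi> \<psi> n \<sigma>)
  then have "(f n, \<sigma>) \<notin> fv (ren f \<phi>)" by (auto simp: fv_ren inj_eq)
  with ForallImp show ?case by (simp add: provable.ForallImp)
qed (auto intro: provable.intros)

lemma provable_mono: "T \<turnstile> \<phi> \<Longrightarrow> T \<subseteq> T' \<Longrightarrow> T' \<turnstile> \<phi>"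
  by (induction rule: provable.induct) (auto intro: provable.intros)

lemma provable_finite: "T \<turnstile> \<phi> \<Longrightarrow> \<exists>T0. finite T0 \<and> T0 \<subseteq> T \<and> (T0 \<turnstile> \<phi>)"
proof (induction rule: provable.induct)
  case (Ax \<phi>)
  then have "{\<phi>} \<turnstile> \<phi>" by (auto intro: provable.Ax)
  with Ax show ?case by (intro exI[of _ "{\<phi>}"]) auto
next
  case (MP \<phi> \<psi>)
  then obtain A B where "finite A" "A \<subseteq> T" "A \<turnstile> Imp \<phi> \<psi>" "finite B" "B \<subseteq> T" "B \<turnstile> \<phi>" by blast
  then have "A \<union> B \<turnstile> Imp \<phi> \<psi>" "A \<union> B \<turnstile> \<phi>" by (meson provable_mono sup_ge1 sup_ge2)+
  then have "A \<union> B \<turnstile> \<psi>" by (rule provable.MP)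
  with \<open>finite A\<close> \<open>finite B\<close> \<open>A \<subseteq> T\<close> \<open>B \<subseteq> T\<close> show ?case by (intro exI[of _ "A \<union> B"]) simp
qed (blast intro: provable.intros)+

text \<open>A derivation uses finitely many axioms, so an injective renaming can halve all variables
  of these while moving the odd variables out of the way.\<close>
lemma provable_double:
  assumes "ren ((*) 2) ` T \<turnstile> ren ((*) 2) \<phi>"
  shows "T \<turnstile> \<phi>"
proof -
  obtain S where S: "finite S" "S \<subseteq> ren ((*) 2) ` T" "S \<turnstile> ren ((*) 2) \<phi>"
    using provable_finite[OF assms] by blast
  then obtain T0 where T0: "finite T0" "T0 \<subseteq> T" "S = ren ((*) 2) ` T0"
    by (meson finite_subset_image)
  define V where "V = fst ` (vars \<phi> \<union> \<Union> (vars ` T0))"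
  have "finite V" using T0 by (simp add: V_def)
  then obtain B where B: "\<And>n. n \<in> V \<Longrightarrow> n < B"
    by (auto simp: finite_nat_set_iff_bounded)
  define g :: "nat \<Rightarrow> nat" where "g m = (if even m \<and> m < 2 * B then m div 2 else m + B)" for m
  have "inj g"
  proof (rule injI)
    fix m m' assume "g m = g m'"
    then show "m = m'"
      unfolding g_def by (simp split: if_splits; presburger)
  qed
  have half: "ren g (ren ((*) 2) \<psi>) = \<psi>" if "fst ` vars \<psi> \<subseteq> V" for \<psi>
  proof -
    have "fst x < B" if "x \<in> vars \<psi>" for x
      using that B \<open>fst ` vars \<psi> \<subseteq> V\<close> by auto
    then show ?thesis by (auto simp: ren_ren g_def intro!: ren_id_on)
  qed
  have "ren g ` S \<turnstile> \<phi>"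
    using provable_ren[OF S(3) \<open>inj g\<close>] half[of \<phi>] by (simp add: V_def image_Un)
  moreover have "ren g ` S = T0"
    unfolding T0(3) image_image by (subst image_cong[OF refl half]) (auto simp: V_def)
  ultimately show ?thesis using T0 provable_mono by auto
qed

subsection \<open>Derivability from hypotheses\<close>

text \<open>Generalization is applied to theorems of \<open>S\<close> only, so \<open>\<Gamma>\<close> may mention parameters.\<close>
inductive der :: "fm set \<Rightarrow> fm set \<Rightarrow> fm \<Rightarrow> bool" for S \<Gamma> where
  logic: "S \<turnstile> \<phi> \<Longrightarrow> der S \<Gamma> \<phi>"
| hyp: "\<phi> \<in> \<Gamma> \<Longrightarrow> wff \<phi> \<Longrightarrow> der S \<Gamma> \<phi>"
| mp: "der S \<Gamma> (Imp \<phi> \<psi>) \<Longrightarrow> der S \<Gamma> \<phi> \<Longrightarrow> der S \<Gamma> \<psi>"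

lemma wff_der: "der S \<Gamma> \<phi> \<Longrightarrow> wff \<phi>"
  by (induction rule: der.induct) (auto dest: wff_provable)

lemma der_mono: "der S \<Gamma> \<phi> \<Longrightarrow> \<Gamma> \<subseteq> \<Delta> \<Longrightarrow> der S \<Delta> \<phi>"
  by (induction rule: der.induct) (blast intro: der.intros)+

lemma der_finite: "der S \<Gamma> \<phi> \<Longrightarrow> \<exists>\<Delta>. finite \<Delta> \<and> \<Delta> \<subseteq> \<Gamma> \<and> der S \<Delta> \<phi>"
proof (induction rule: der.induct)
  case (hyp \<phi>)
  then have "der S {\<phi>} \<phi>" by (auto intro: der.hyp)
  with hyp show ?case by (intro exI[of _ "{\<phi>}"]) auto
next
  case (mp \<phi> \<psi>)
  then obtain A B where
    "finite A" "A \<subseteq> \<Gamma>" "der S A (Imp \<phi> \<psi>)" "finite B" "B \<subseteq> \<Gamma>" "der S B \<phi>" by blast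
  then have "der S (A \<union> B) (Imp \<phi> \<psi>)" "der S (A \<union> B) \<phi>" by (meson der_mono sup_ge1 sup_ge2)+
  then have "der S (A \<union> B) \<psi>" by (rule der.mp)
  with \<open>finite A\<close> \<open>finite B\<close> \<open>A \<subseteq> \<Gamma>\<close> \<open>B \<subseteq> \<Gamma>\<close> show ?case by (intro exI[of _ "A \<union> B"]) simp
qed (blast intro: der.intros)

lemma imp_refl: "wff \<phi> \<Longrightarrow> T \<turnstile> Imp \<phi> \<phi>"
  using provable.MP[OF provable.MP[OF provable.Dist[of \<phi> "Imp \<phi> \<phi>" \<phi> T]
      provable.Weak[of \<phi> "Imp \<phi> \<phi>" T]] provable.Weak[of \<phi> \<phi> T]] by simp

lemma deduction: "der S (insert \<phi> \<Gamma>) \<psi> \<Longrightarrow> wff \<phi> \<Longrightarrow> der S \<Gamma> (Imp \<phi> \<psi>)"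
proof (induction rule: der.induct)
  case (logic \<psi>)
  then show ?case by (meson der.mp der.logic provable.Weak wff_provable)
next
  case (hyp \<psi>)
  then show ?case by (metis der.hyp der.mp der.logic imp_refl insertE provable.Weak)
next
  case (mp \<psi> \<chi>)
  then have "wff \<psi>" "wff \<chi>" using wff_der by fastforce+
  with mp show ?case by (meson der.mp der.logic provable.Dist)
qed

lemma der_DNeg: "der S \<Gamma> (Neg (Neg \<phi>)) \<Longrightarrow> der S \<Gamma> \<phi>"
  using wff_der der.mp der.logic provable.DNeg by (metis wff_Neg)

lemma subst_tm_same: "subst_tm (n, \<sigma>) (Var n \<sigma>) t = t"
  by (induction t) auto

lemma subst_same: "subst (n, \<sigma>) (Var n \<sigma>) \<phi> = \<phi>"
  by (induction \<phi>) (auto simp: subst_tm_same)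

lemma free_for_same: "free_for (Var n \<sigma>) (n, \<sigma>) \<phi>"
  by (induction \<phi>) auto

text \<open>The hard case is modus ponens, where two quantified hypotheses A and B have to be
  combined. The deduction theorem moves both of them into a theorem of \<open>S\<close>, where
  generalization is allowed; as neither has the variable free, \<open>ForallImp\<close> then passes
  the quantifier inward twice.\<close>

lemma der_gen: "der S \<Gamma> \<phi> \<Longrightarrow> (n, \<sigma>) \<notin> \<Union> (fv ` \<Gamma>) \<Longrightarrow> der S \<Gamma> (Forall n \<sigma> \<phi>)"
proof (induction rule: der.induct)
  case (logic \<phi>)
  then show ?case by (meson der.logic provable.Gen)
next
  case (hyp \<phi>)
  then have "S \<turnstile> Imp \<phi> (Forall n \<sigma> \<phi>)"
    by (auto intro!: provable.MP[OF provable.ForallImp] provable.Gen imp_refl)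
  with hyp show ?case by (meson der.hyp der.mp der.logic)
next
  case (mp \<phi> \<psi>)
  have wff: "wff \<phi>" "wff \<psi>" using wff_der[OF mp.hyps(1)] by auto
  define A where "A = Forall n \<sigma> (Imp \<phi> \<psi>)"
  define B where "B = Forall n \<sigma> \<phi>"
  have "S \<turnstile> Imp A (Imp \<phi> \<psi>)" "S \<turnstile> Imp B \<phi>"
    using provable.Inst[of _ "Var n \<sigma>" \<sigma> n] wff by (auto simp: subst_same free_for_same A_def B_def)
  moreover have "der S {B, A} A" "der S {B, A} B"
    using wff by (auto simp: A_def B_def intro: der.hyp)
  ultimately have "der S {B, A} \<psi>" by (meson der.mp der.logic)
  then have "der S {} (Imp A (Imp B \<psi>))"
    using wff by (intro deduction) (auto simp: A_def B_def)
  moreover have provable_of_der: "S \<turnstile> \<chi>" if "der S {} \<chi>" for \<chi>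
    using that by (induction rule: der.induct) (auto intro: provable.MP)
  ultimately have "S \<turnstile> Imp A (Imp B \<psi>)" by blast
  then have "S \<turnstile> Imp A (Forall n \<sigma> (Imp B \<psi>))"
    using wff by (auto intro!: provable.MP[OF provable.ForallImp] provable.Gen simp: A_def B_def)
  moreover have "der S {A} A"
    using wff by (auto simp: A_def intro: der.hyp)
  ultimately have "der S {A} (Forall n \<sigma> (Imp B \<psi>))" by (meson der.mp der.logic)
  moreover have "S \<turnstile> Imp (Forall n \<sigma> (Imp B \<psi>)) (Imp B (Forall n \<sigma> \<psi>))"
    using wff by (intro provable.ForallImp) (auto simp: B_def)
  ultimately have "der S {A} (Imp B (Forall n \<sigma> \<psi>))" by (meson der.mp der.logic)
  then have "S \<turnstile> Imp A (Imp B (Forall n \<sigma> \<psi>))"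
    using wff by (intro provable_of_der[OF deduction]) (simp_all add: A_def)
  then show ?case using mp by (metis A_def B_def der.mp der.logic)
qed

lemma subst_tm_fresh: "x \<notin> fv_tm t \<Longrightarrow> subst_tm x u t = t"
  by (induction t) auto

lemma subst_fresh: "x \<notin> fv \<phi> \<Longrightarrow> subst x u \<phi> = \<phi>"
  by (induction \<phi>) (auto simp: subst_tm_fresh)

lemma subst_tm_back: "(m, \<sigma>) \<notin> fv_tm t \<Longrightarrow> subst_tm (m, \<sigma>) (Var n \<sigma>) (subst_tm (n, \<sigma>) (Var m \<sigma>) t) = t"
  by (induction t) auto

lemma subst_back: "(m, \<sigma>) \<notin> vars \<phi> \<Longrightarrow> subst (m, \<sigma>) (Var n \<sigma>) (subst (n, \<sigma>) (Var m \<sigma>) \<phi>) = \<phi>"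
  using fv_subset_vars by (induction \<phi>) (auto simp: subst_tm_back intro: subst_fresh)

lemma fv_tm_subst_tm: "fv_tm (subst_tm x u t) \<subseteq> (fv_tm t - {x}) \<union> fv_tm u"
  by (induction t) auto

lemma fv_subst: "fv (subst x u \<phi>) \<subseteq> (fv \<phi> - {x}) \<union> fv_tm u"
proof (induction \<phi>)
  case (EqN s t)
  then show ?case using fv_tm_subst_tm[of x u s] fv_tm_subst_tm[of x u t] by auto
qed auto

lemma free_for_back:
  "(m, \<sigma>) \<notin> vars \<phi> \<Longrightarrow> free_for (Var n \<sigma>) (m, \<sigma>) (subst (n, \<sigma>) (Var m \<sigma>) \<phi>)"
  using fv_subset_vars by (induction \<phi>) auto

lemma free_for_disjoint: "fv_tm u \<inter> bv \<phi> = {} \<Longrightarrow> free_for u x \<phi>"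
  by (induction \<phi>) auto

text \<open>For the Henkin witnesses: what is proved of a fresh variable m has to yield the
  quantification over the original n. Instantiating m by n undoes the substitution, since m is
  neither free nor bound in \<phi>.\<close>

lemma forall_rename:
  assumes "wff \<phi>" "(m, \<sigma>) \<notin> vars \<phi>" "m \<noteq> n"
  shows "S \<turnstile> Imp (Forall m \<sigma> (subst (n, \<sigma>) (Var m \<sigma>) \<phi>)) (Forall n \<sigma> \<phi>)"
proof -
  have "S \<turnstile> Imp (Forall m \<sigma> (subst (n, \<sigma>) (Var m \<sigma>) \<phi>)) \<phi>"
    using provable.Inst[of "subst (n, \<sigma>) (Var m \<sigma>) \<phi>" "Var n \<sigma>" \<sigma> m S] assms
    by (simp add: wff_subst free_for_back subst_back)
  then show ?thesis
    using assms fv_subst[of "(n, \<sigma>)" "Var m \<sigma>" \<phi>]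
    by (intro provable.MP[OF provable.ForallImp] provable.Gen) (auto simp: wff_subst)
qed


section \<open>Henkin models\<close>

definition consistent :: "fm set \<Rightarrow> fm set \<Rightarrow> bool" where
  "consistent S \<Gamma> \<longleftrightarrow> \<not> der S \<Gamma> Falsum"

text \<open>Odd indices play the role of Henkin constants. In the completeness proof the given
  axioms and the given formula are first moved to even indices, so that no quantifier in them binds
  an odd variable.\<close>

definition fresh :: "fm set \<Rightarrow> ty \<Rightarrow> nat" where
  "fresh \<Gamma> \<sigma> = (SOME y. odd y \<and> (y, \<sigma>) \<notin> \<Union> (vars ` \<Gamma>))"

text \<open>The pattern is the unfolding of \<open>Neg (Forall n \<sigma> \<phi>)\<close>: a
  counterexample is named as soon as such a formula enters the set. Its name must avoid the formula
  itself as well.\<close>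

fun witness :: "fm set \<Rightarrow> fm \<Rightarrow> fm set" where
  "witness \<Gamma> (Imp (Forall n \<sigma> \<phi>) Falsum) =
     {Neg (subst (n, \<sigma>) (Var (fresh (insert (Forall n \<sigma> \<phi>) \<Gamma>) \<sigma>) \<sigma>) \<phi>)}"
| "witness \<Gamma> \<psi> = {}"

lemma witness_cases:
  "witness \<Gamma> \<psi> = {} \<or> (\<exists>n \<sigma> \<phi>. \<psi> = Neg (Forall n \<sigma> \<phi>) \<and>
     witness \<Gamma> \<psi> = {Neg (subst (n, \<sigma>) (Var (fresh (insert (Forall n \<sigma> \<phi>) \<Gamma>) \<sigma>) \<sigma>) \<phi>)})"
  by (cases "(\<Gamma>, \<psi>)" rule: witness.cases) (simp_all add: Neg_def)

lemma fresh:
  assumes "finite \<Gamma>"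
  shows "odd (fresh \<Gamma> \<sigma>)" "(fresh \<Gamma> \<sigma>, \<sigma>) \<notin> \<Union> (vars ` \<Gamma>)"
proof -
  have "finite (fst ` \<Union> (vars ` \<Gamma>))" using assms by simp
  then obtain B where B: "\<forall>n \<in> fst ` \<Union> (vars ` \<Gamma>). n < B"
    by (meson finite_nat_set_iff_bounded)
  have "(2 * B + 1, \<sigma>) \<notin> \<Union> (vars ` \<Gamma>)"
  proof
    assume "(2 * B + 1, \<sigma>) \<in> \<Union> (vars ` \<Gamma>)"
    then have "2 * B + 1 \<in> fst ` \<Union> (vars ` \<Gamma>)" by (metis fst_conv imageI)
    with B show False by fastforce
  qed
  then have "\<exists>y. odd y \<and> (y, \<sigma>) \<notin> \<Union> (vars ` \<Gamma>)" by (intro exI[of _ "2 * B + 1"]) simp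
  from someI_ex[OF this]
  show "odd (fresh \<Gamma> \<sigma>)" "(fresh \<Gamma> \<sigma>, \<sigma>) \<notin> \<Union> (vars ` \<Gamma>)" by (auto simp: fresh_def)
qed

text \<open>If naming the counterexample were inconsistent, the instance at the fresh variable would
  be derivable from formulas that do not mention this variable. Generalizing and renaming back would
  give the quantified formula, whose negation is \<psi>.\<close>

lemma consistent_witness:
  assumes fin: "finite \<Gamma>" and wff: "wff \<psi>" and con: "consistent S (insert \<psi> \<Gamma>)"
  shows "consistent S (insert \<psi> (witness \<Gamma> \<psi> \<union> \<Gamma>))"
proof -
  consider "witness \<Gamma> \<psi> = {}" | n \<sigma> \<phi> where "\<psi> = Neg (Forall n \<sigma> \<phi>)"
    "witness \<Gamma> \<psi> = {Neg (subst (n, \<sigma>) (Var (fresh (insert (Forall n \<sigma> \<phi>) \<Gamma>) \<sigma>) \<sigma>) \<phi>)}"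
    using witness_cases by blast
  then show ?thesis
  proof cases
    case 2
    define y where "y = fresh (insert (Forall n \<sigma> \<phi>) \<Gamma>) \<sigma>"
    define \<chi> where "\<chi> = subst (n, \<sigma>) (Var y \<sigma>) \<phi>"
    have "(y, \<sigma>) \<notin> \<Union> (vars ` insert (Forall n \<sigma> \<phi>) \<Gamma>)"
      unfolding y_def using fin by (intro fresh) simp
    then have y: "(y, \<sigma>) \<notin> vars \<phi>" "y \<noteq> n" "(y, \<sigma>) \<notin> \<Union> (fv ` insert \<psi> \<Gamma>)"
      using fv_subset_vars 2 by auto
    have wff': "wff \<phi>" "wff \<chi>" using wff 2 by (auto simp: \<chi>_def wff_subst)
    have False if "der S (insert (Neg \<chi>) (insert \<psi> \<Gamma>)) Falsum"
    proof -
      have "der S (insert \<psi> \<Gamma>) (Neg (Neg \<chi>))"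
        using deduction[OF that] wff' by (simp add: Neg_def)
      then have "der S (insert \<psi> \<Gamma>) (Forall y \<sigma> \<chi>)"
        using y by (blast intro: der_gen[OF der_DNeg])
      then have "der S (insert \<psi> \<Gamma>) (Forall n \<sigma> \<phi>)"
        using forall_rename[of \<phi> y \<sigma> n S] y wff' unfolding \<chi>_def by (meson der.logic der.mp)
      moreover have "der S (insert \<psi> \<Gamma>) (Imp (Forall n \<sigma> \<phi>) Falsum)"
        using wff 2 by (auto intro: der.hyp simp: Neg_def)
      ultimately show False using con by (meson consistent_def der.mp)
    qed
    with 2 show ?thesis by (auto simp: consistent_def y_def \<chi>_def insert_commute)
  qed (use con in simp)
qed

text \<open>Lindenbaum's completion and the choice of witnesses are interleaved along the
  enumeration of all formulas. Every stage is finite, which guarantees a fresh variable although the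
  language has no supply of new constants.\<close>

primrec henkin :: "fm set \<Rightarrow> fm \<Rightarrow> nat \<Rightarrow> fm set" where
  "henkin S \<phi> 0 = {\<phi>}"
| "henkin S \<phi> (Suc k) = (let \<Gamma> = henkin S \<phi> k; \<psi> = from_nat k in
     if wff \<psi> \<and> consistent S (insert \<psi> \<Gamma>) then insert \<psi> (witness \<Gamma> \<psi> \<union> \<Gamma>) else \<Gamma>)"

definition Henkin :: "fm set \<Rightarrow> fm \<Rightarrow> fm set" where
  "Henkin S \<phi> = \<Union> (range (henkin S \<phi>))"

lemma finite_henkin: "finite (henkin S \<phi> k)"
proof (induction k)
  case (Suc k)
  have "finite (witness \<Gamma> \<psi>)" for \<Gamma> \<psi> using witness_cases[of \<Gamma> \<psi>] by auto
  with Suc show ?case by (auto simp: Let_def)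
qed simp

locale henkin_set =
  fixes S :: "fm set" and \<phi>0 :: fm
  assumes con0: "consistent S {\<phi>0}" and wff0: "wff \<phi>0"
begin

abbreviation "G \<equiv> henkin S \<phi>0"
abbreviation "H \<equiv> Henkin S \<phi>0"

lemma con_G: "consistent S (G k)"
  by (induction k) (auto simp: con0 Let_def consistent_witness finite_henkin)

lemma wff_G: "\<psi> \<in> G k \<Longrightarrow> wff \<psi>"
proof (induction k arbitrary: \<psi>)
  case (Suc k)
  then show ?case
    using witness_cases[of "G k" "from_nat k"]
    by (auto simp: Let_def wff_subst split: if_splits)
qed (simp add: wff0)

lemma wff_H: "\<psi> \<in> H \<Longrightarrow> wff \<psi>"
  by (auto simp: Henkin_def wff_G)

lemma mono_G: "j \<le> k \<Longrightarrow> G j \<subseteq> G k"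
  by (rule lift_Suc_mono_le[of G]) (auto simp: Let_def)

lemma con_H: "consistent S H"
proof -
  have "\<exists>k. \<Delta> \<subseteq> G k" if "finite \<Delta>" "\<Delta> \<subseteq> H" for \<Delta>
    using that
  proof (induction \<Delta>)
    case (insert \<psi> \<Delta>)
    then obtain j k where "\<psi> \<in> G j" "\<Delta> \<subseteq> G k" by (auto simp: Henkin_def)
    then have "insert \<psi> \<Delta> \<subseteq> G (max j k)"
      using mono_G[of j "max j k"] mono_G[of k "max j k"] by auto
    then show ?case ..
  qed simp
  then show ?thesis
    unfolding consistent_def by (meson con_G consistent_def der_finite der_mono)
qed

lemma G_subset: "G k \<subseteq> H"
  by (auto simp: Henkin_def)

text \<open>Each formula is decided at the stage given by its own code: if it is rejected there, the
  finite set of that stage already refutes it.\<close>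

lemma stage:
  assumes "wff \<psi>"
  shows "\<psi> \<in> H \<and> witness (G (to_nat \<psi>)) \<psi> \<subseteq> H \<or> der S H (Neg \<psi>)"
proof (cases "consistent S (insert \<psi> (G (to_nat \<psi>)))")
  case True
  then have "insert \<psi> (witness (G (to_nat \<psi>)) \<psi>) \<subseteq> G (Suc (to_nat \<psi>))"
    using assms by (auto simp: Let_def)
  then show ?thesis using G_subset by blast
next
  case False
  then have "der S (G (to_nat \<psi>)) (Neg \<psi>)"
    using assms deduction by (auto simp: consistent_def Neg_def)
  then show ?thesis by (blast intro: der_mono[OF _ G_subset])
qed

lemma der_contradiction: "der S H (Neg \<psi>) \<Longrightarrow> der S H \<psi> \<Longrightarrow> False"
  using con_H der.mp by (auto simp: consistent_def Neg_def)

lemma der_iff: "der S H \<psi> \<longleftrightarrow> \<psi> \<in> H"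
  using stage[of \<psi>] der_contradiction wff_der wff_H by (blast intro: der.hyp)

lemma Neg_iff: "wff \<psi> \<Longrightarrow> Neg \<psi> \<in> H \<longleftrightarrow> \<psi> \<notin> H"
  using stage[of \<psi>] der_contradiction by (auto simp: der_iff)

lemma Falsum_iff: "Falsum \<notin> H"
  using con_H by (auto simp: consistent_def der_iff)

lemma Imp_iff:
  assumes "wff \<phi>" "wff \<psi>"
  shows "Imp \<phi> \<psi> \<in> H \<longleftrightarrow> (\<phi> \<in> H \<longrightarrow> \<psi> \<in> H)"
proof
  assume "Imp \<phi> \<psi> \<in> H"
  then show "\<phi> \<in> H \<longrightarrow> \<psi> \<in> H" using der.mp by (auto simp flip: der_iff)
next
  assume *: "\<phi> \<in> H \<longrightarrow> \<psi> \<in> H"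
  show "Imp \<phi> \<psi> \<in> H"
  proof (cases "\<psi> \<in> H")
    case True
    then show ?thesis using der.mp[of S H \<psi>] provable.Weak[of \<psi> \<phi> S] der.logic assms
      by (auto simp flip: der_iff)
  next
    case False
    have *: "Neg \<phi> \<in> H" using False * assms Neg_iff by auto
    have "der S (insert \<phi> H) (Neg \<phi>)" "der S (insert \<phi> H) \<phi>"
      using * assms by (auto intro: der.hyp)
    then have "der S (insert \<phi> H) Falsum" unfolding Neg_def by (rule der.mp)
    then have "der S (insert (Neg \<psi>) (insert \<phi> H)) Falsum" by (rule der_mono) auto
    then have "der S (insert \<phi> H) (Neg (Neg \<psi>))"
      using deduction assms unfolding Neg_def[of "Neg \<psi>"] by simp
    then have "der S H (Imp \<phi> \<psi>)" using assms by (blast intro: deduction[OF der_DNeg])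
    then show ?thesis by (simp add: der_iff)
  qed
qed

text \<open>The formulas considered never bind a variable with odd index, so substituting terms built from
  these is free of capture.\<close>
definition params :: "(nat \<times> ty) set" where "params = {x. odd (fst x)}"

definition tms :: "ty \<Rightarrow> tm set" where
  "tms \<sigma> = {t. wt t \<and> ty_of t = \<sigma> \<and> fv_tm t \<subseteq> params}"

text \<open>From left to right this is instantiation, free of capture because no parameter is bound
  in \<phi>. Conversely, a negated quantification in \<open>H\<close> came with a witness, and that
  witness is an element of \<open>tms \<sigma>\<close>.\<close>

lemma Forall_iff:
  assumes "wff \<phi>" "bv \<phi> \<inter> params = {}"
  shows "Forall n \<sigma> \<phi> \<in> H \<longleftrightarrow> (\<forall>u \<in> tms \<sigma>. subst (n, \<sigma>) u \<phi> \<in> H)"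
proof
  assume "Forall n \<sigma> \<phi> \<in> H"
  then have "der S H (subst (n, \<sigma>) u \<phi>)" if "u \<in> tms \<sigma>" for u
  proof -
    have "S \<turnstile> Imp (Forall n \<sigma> \<phi>) (subst (n, \<sigma>) u \<phi>)"
      using that assms by (intro provable.Inst free_for_disjoint) (auto simp: tms_def)
    with \<open>Forall n \<sigma> \<phi> \<in> H\<close> show ?thesis by (meson der.logic der.mp der_iff)
  qed
  then show "\<forall>u \<in> tms \<sigma>. subst (n, \<sigma>) u \<phi> \<in> H" by (simp add: der_iff)
next
  assume *: "\<forall>u \<in> tms \<sigma>. subst (n, \<sigma>) u \<phi> \<in> H"
  show "Forall n \<sigma> \<phi> \<in> H"
  proof (rule ccontr)
    let ?\<psi> = "Neg (Forall n \<sigma> \<phi>)"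
    assume "Forall n \<sigma> \<phi> \<notin> H"
    then have H: "?\<psi> \<in> H" using assms by (simp add: Neg_iff)
    let ?y = "fresh (insert (Forall n \<sigma> \<phi>) (G (to_nat ?\<psi>))) \<sigma>"
    have "witness (G (to_nat ?\<psi>)) ?\<psi> \<subseteq> H"
      using stage[of ?\<psi>] assms H  der_contradiction by (auto simp: der_iff)
    then have "Neg (subst (n, \<sigma>) (Var ?y \<sigma>) \<phi>) \<in> H"
      by (simp add: Neg_def)
    moreover have "Var ?y \<sigma> \<in> tms \<sigma>"
      using fresh(1) finite_henkin by (auto simp: tms_def params_def)
    ultimately show False using * assms by (simp add: Neg_iff wff_subst)
  qed
qed

end

section \<open>Interpretations, satisfaction and the term model\<close>

record 'u interp =
  Dom :: "ty \<Rightarrow> 'u set"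
  Ap :: "'u \<Rightarrow> 'u \<Rightarrow> 'u"
  Cn :: "tm \<Rightarrow> 'u"
  Eqv :: "'u \<Rightarrow> 'u \<Rightarrow> bool"

primrec val :: "('u, 'm) interp_scheme \<Rightarrow> (nat \<times> ty \<Rightarrow> 'u) \<Rightarrow> tm \<Rightarrow> 'u" where
  "val M \<rho> (Var n \<sigma>) = \<rho> (n, \<sigma>)"
| "val M \<rho> Zero = Cn M Zero"
| "val M \<rho> Succ = Cn M Succ"
| "val M \<rho> (Kc \<sigma> \<tau>) = Cn M (Kc \<sigma> \<tau>)"
| "val M \<rho> (Sc \<sigma> \<tau> \<upsilon>) = Cn M (Sc \<sigma> \<tau> \<upsilon>)"
| "val M \<rho> Rc = Cn M Rc"
| "val M \<rho> (s \<cdot> t) = Ap M (val M \<rho> s) (val M \<rho> t)"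

primrec sat :: "('u, 'm) interp_scheme \<Rightarrow> (nat \<times> ty \<Rightarrow> 'u) \<Rightarrow> fm \<Rightarrow> bool" where
  "sat M \<rho> (EqN s t) = Eqv M (val M \<rho> s) (val M \<rho> t)"
| "sat M \<rho> Falsum = False"
| "sat M \<rho> (Imp \<phi> \<psi>) = (sat M \<rho> \<phi> \<longrightarrow> sat M \<rho> \<psi>)"
| "sat M \<rho> (Forall n \<sigma> \<phi>) = (\<forall>a \<in> Dom M \<sigma>. sat M (\<rho>((n, \<sigma>) := a)) \<phi>)"

definition env :: "('u, 'm) interp_scheme \<Rightarrow> (nat \<times> ty \<Rightarrow> 'u) \<Rightarrow> bool" where
  "env M \<rho> \<longleftrightarrow> (\<forall>n \<sigma>. \<rho> (n, \<sigma>) \<in> Dom M \<sigma>)"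

definition valid :: "('u, 'm) interp_scheme \<Rightarrow> fm \<Rightarrow> bool" where
  "valid M \<phi> \<longleftrightarrow> (\<forall>\<rho>. env M \<rho> \<longrightarrow> sat M \<rho> \<phi>)"

lemma env_upd [simp]: "env M \<rho> \<Longrightarrow> a \<in> Dom M \<sigma> \<Longrightarrow> env M (\<rho>((n, \<sigma>) := a))"
  by (auto simp: env_def)

lemma val_cong: "\<forall>x \<in> fv_tm t. \<rho> x = \<rho>' x \<Longrightarrow> val M \<rho> t = val M \<rho>' t"
  by (induction t) auto

lemma val_upd_fresh: "x \<notin> fv_tm t \<Longrightarrow> val M (\<rho>(x := a)) t = val M \<rho> t"
  by (rule val_cong) auto

lemma val_ren: "val M \<rho> (ren_tm f t) = val M (\<rho> \<circ> apfst f) t"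
  by (induction t) auto

lemma sat_ren: "inj f \<Longrightarrow> sat M \<rho> (ren f \<phi>) = sat M (\<rho> \<circ> apfst f) \<phi>"
proof (induction \<phi> arbitrary: \<rho>)
  case (Forall n \<sigma> \<phi>)
  have "\<rho>((f n, \<sigma>) := a) \<circ> apfst f = (\<rho> \<circ> apfst f)((n, \<sigma>) := a)" for a
    using Forall.prems by (auto simp: inj_eq fun_eq_iff)
  with Forall show ?case by (simp del: fun_upd_apply o_apply)
qed (simp_all add: val_ren)

lemma sat_subst_qfree:
  "qfree \<phi> \<Longrightarrow> sat M \<rho> (subst x u \<phi>) = sat M (\<rho>(x := val M \<rho> u)) \<phi>"
proof (induction \<phi>)
  case (EqN s t)
  have "val M \<rho> (subst_tm x u t) = val M (\<rho>(x := val M \<rho> u)) t" for t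
    by (induction t) auto
  then show ?case by (simp del: fun_upd_apply)
qed auto


text \<open>Simultaneous substitution, seen as evaluation in the interpretation whose application is
  the constructor \<open>App\<close>. Bound variables are kept without renaming; this is sound where
  only parameters are substituted and none of them is bound.\<close>

primrec psubst :: "(nat \<times> ty \<Rightarrow> tm) \<Rightarrow> fm \<Rightarrow> fm" where
  "psubst r (EqN s t) = EqN (val \<lparr>Dom = \<lambda>_. UNIV, Ap = App, Cn = id, Eqv = (=)\<rparr> r s)
     (val \<lparr>Dom = \<lambda>_. UNIV, Ap = App, Cn = id, Eqv = (=)\<rparr> r t)"
| "psubst r Falsum = Falsum"
| "psubst r (Imp \<phi> \<psi>) = Imp (psubst r \<phi>) (psubst r \<psi>)"
| "psubst r (Forall n \<sigma> \<phi>) = Forall n \<sigma> (psubst (r((n, \<sigma>) := Var n \<sigma>)) \<phi>)"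

abbreviation tm_val :: "(nat \<times> ty \<Rightarrow> tm) \<Rightarrow> tm \<Rightarrow> tm" where
  "tm_val \<equiv> val \<lparr>Dom = \<lambda>_. UNIV, Ap = App, Cn = id, Eqv = (=)\<rparr>"

lemma subst_tm_tm_val:
  "\<forall>y. y \<noteq> x \<longrightarrow> x \<notin> fv_tm (r y) \<Longrightarrow>
   subst_tm x u (tm_val (r(x := Var (fst x) (snd x))) t) = tm_val (r(x := u)) t"
  by (induction t) (auto simp: subst_tm_fresh)

text \<open>Serves the quantifier case of \<open>truth\<close>, where one variable is left open and
  filled in afterwards. The hypothesis keeps x out of the other inserted terms, so the later
  substitution hits the intended occurrences alone.\<close>

lemma subst_psubst:
  "\<forall>y. y \<noteq> x \<longrightarrow> x \<notin> fv_tm (r y) \<Longrightarrow>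
   subst x u (psubst (r(x := Var (fst x) (snd x))) \<phi>) = psubst (r(x := u)) \<phi>"
proof (induction \<phi> arbitrary: r)
  case (Forall n \<sigma> \<phi>)
  show ?case
  proof (cases "(n, \<sigma>) = x")
    case True
    then have "x = (n, \<sigma>)" by simp
    then show ?thesis by (simp del: fun_upd_apply)
  next
    case False
    then have "(r(x := a))((n, \<sigma>) := b) = (r((n, \<sigma>) := b))(x := a)" for a b by auto
    with Forall.IH[of "r((n, \<sigma>) := Var n \<sigma>)"] Forall.prems False show ?thesis
      by (simp del: fun_upd_apply) (auto simp: fun_upd_def)
  qed
qed (simp_all del: fun_upd_apply add: subst_tm_tm_val)

lemma psubst_id: "\<forall>x \<in> fv \<phi>. r x = Var (fst x) (snd x) \<Longrightarrow> psubst r \<phi> = \<phi>"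
proof (induction \<phi> arbitrary: r)
  case (EqN s t)
  have "\<forall>x \<in> fv_tm t. r x = Var (fst x) (snd x) \<Longrightarrow> tm_val r t = t" for t
    by (induction t) auto
  with EqN show ?case by simp
qed auto

lemma bv_psubst [simp]: "bv (psubst r \<phi>) = bv \<phi>"
  by (induction \<phi> arbitrary: r) auto

lemma tm_val_typed:
  assumes "\<forall>n \<sigma>. wt (r (n, \<sigma>)) \<and> ty_of (r (n, \<sigma>)) = \<sigma>"
  shows "ty_of (tm_val r t) = ty_of t" "wt t \<Longrightarrow> wt (tm_val r t)"
proof -
  show ty: "ty_of (tm_val r t) = ty_of t" for t using assms by (induction t) auto
  show "wt t \<Longrightarrow> wt (tm_val r t)" using assms by (induction t) (auto simp: ty)
qed

lemma wff_psubst: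
  "\<forall>n \<sigma>. wt (r (n, \<sigma>)) \<and> ty_of (r (n, \<sigma>)) = \<sigma> \<Longrightarrow> wff \<phi> \<Longrightarrow> wff (psubst r \<phi>)"
proof (induction \<phi> arbitrary: r)
  case (Forall n \<sigma> \<phi>)
  then have "wff (psubst (r((n, \<sigma>) := Var n \<sigma>)) \<phi>)" by (intro Forall.IH) auto
  then show ?case by simp
qed (auto simp: tm_val_typed)

lemma provable_foldr_Forall: "T \<turnstile> \<phi> \<Longrightarrow> T \<turnstile> foldr (\<lambda>x. Forall (fst x) (snd x)) xs \<phi>"
  by (induction xs) (auto intro: provable.Gen)

lemma fv_foldr_Forall: "fv (foldr (\<lambda>x. Forall (fst x) (snd x)) xs \<phi>) = fv \<phi> - set xs"
  by (induction xs) auto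

lemma bv_foldr_Forall: "bv (foldr (\<lambda>x. Forall (fst x) (snd x)) xs \<phi>) = bv \<phi> \<union> set xs"
  by (induction xs) auto

lemma sat_foldr_Forall:
  "env M \<rho> \<Longrightarrow> sat M \<rho> (foldr (\<lambda>x. Forall (fst x) (snd x)) xs \<phi>) \<Longrightarrow> sat M \<rho> \<phi>"
proof (induction xs)
  case (Cons x xs)
  have "\<rho> x \<in> Dom M (snd x)" using Cons.prems by (cases x) (auto simp: env_def)
  moreover have "\<forall>a \<in> Dom M (snd x). sat M (\<rho>(x := a)) (foldr (\<lambda>x. Forall (fst x) (snd x)) xs \<phi>)"
    using Cons.prems(2) by (simp del: fun_upd_apply)
  ultimately have "sat M (\<rho>(x := \<rho> x)) (foldr (\<lambda>x. Forall (fst x) (snd x)) xs \<phi>)" by blast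
  then show ?case using Cons.IH Cons.prems(1) by simp
qed simp

context henkin_set
begin

text \<open>Equality at type 0 is membership of the equation in \<open>H\<close>; it becomes
  identity only after passing to a quotient.\<close>

definition Tm :: "tm interp" where
  "Tm = \<lparr>Dom = tms, Ap = App, Cn = id, Eqv = (\<lambda>s t. EqN s t \<in> H)\<rparr>"

lemma val_Tm: "val Tm r t = tm_val r t"
  by (induction t) (auto simp: Tm_def)

text \<open>Henkin's truth lemma. Assignments take values in terms over odd variables while \<phi>
  has even ones only, so moving a value under a quantifier captures nothing.\<close>

lemma truth:
  "env Tm r \<Longrightarrow> wff \<phi> \<Longrightarrow> vars \<phi> \<inter> params = {} \<Longrightarrow> sat Tm r \<phi> \<longleftrightarrow> psubst r \<phi> \<in> H"
proof (induction \<phi> arbitrary: r)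
  case (EqN s t)
  then show ?case by (simp add: val_Tm) (simp add: Tm_def)
next
  case Falsum
  then show ?case by (simp add: Falsum_iff)
next
  case (Imp \<phi> \<psi>)
  then have "\<forall>n \<sigma>. wt (r (n, \<sigma>)) \<and> ty_of (r (n, \<sigma>)) = \<sigma>"
    by (auto simp: env_def Tm_def tms_def)
  with Imp show ?case by (auto simp: Imp_iff wff_psubst)
next
  case (Forall n \<sigma> \<phi>)
  let ?r = "r((n, \<sigma>) := Var n \<sigma>)"
  have r: "r (m, \<tau>) \<in> tms \<tau>" for m \<tau>
    using Forall.prems by (simp add: env_def Tm_def)
  then have r': "\<forall>m \<tau>. wt (?r (m, \<tau>)) \<and> ty_of (?r (m, \<tau>)) = \<tau>"
    by (auto simp: tms_def)
  have "subst (n, \<sigma>) u (psubst ?r \<phi>) = psubst (r((n, \<sigma>) := u)) \<phi>" for u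
  proof -
    have "(n, \<sigma>) \<notin> fv_tm (r y)" for y
      using r[of "fst y" "snd y"] Forall.prems by (auto simp: tms_def)
    then show ?thesis using subst_psubst[of "(n, \<sigma>)" r u \<phi>] by (simp del: fun_upd_apply)
  qed
  moreover have "Forall n \<sigma> (psubst ?r \<phi>) \<in> H \<longleftrightarrow>
      (\<forall>u \<in> tms \<sigma>. subst (n, \<sigma>) u (psubst ?r \<phi>) \<in> H)"
    using Forall.prems wff_psubst[OF r', of \<phi>]
    by (intro Forall_iff) (auto simp: vars_def simp del: fun_upd_apply)
  moreover have "sat Tm (r((n, \<sigma>) := u)) \<phi> \<longleftrightarrow> psubst (r((n, \<sigma>) := u)) \<phi> \<in> H" if "u \<in> tms \<sigma>" for u
    using that Forall.prems by (intro Forall.IH env_upd) (auto simp: Tm_def)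
  moreover have "Dom Tm \<sigma> = tms \<sigma>" by (simp add: Tm_def)
  ultimately show ?case by simp
qed

lemma truth_closed:
  assumes "env Tm r" "\<phi> \<in> H" "vars \<phi> \<inter> params = {}" "fv \<phi> = {}"
  shows "sat Tm r \<phi>"
  using truth[OF assms(1) wff_H[OF assms(2)] assms(3)] psubst_id[of \<phi> r] assms by simp

lemma valid_Tm:
  assumes "S \<turnstile> \<phi>" "vars \<phi> \<inter> params = {}"
  shows "valid Tm \<phi>"
  unfolding valid_def
proof (intro allI impI)
  fix r assume r: "env Tm r"
  obtain xs where xs: "set xs = fv \<phi>"
    using finite_list finite_subset[OF fv_subset_vars finite_vars] by metis
  \<comment> \<open>The universal closure is still derivable, and being closed it is left unchanged
    by \<open>psubst\<close>.\<close>
  let ?\<psi> = "foldr (\<lambda>x. Forall (fst x) (snd x)) xs \<phi>"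
  have "?\<psi> \<in> H" using provable_foldr_Forall[OF assms(1)] by (auto simp flip: der_iff intro: der.logic)
  then have "sat Tm r ?\<psi>"
    using r assms(2) xs by (intro truth_closed) (auto simp: vars_def fv_foldr_Forall bv_foldr_Forall)
  then show "sat Tm r \<phi>" using sat_foldr_Forall r by blast
qed

end

text \<open>The variables are doubled before the Henkin construction, and
  \<open>provable_double\<close> carries underivability over to the doubled theory. The closing
  clauses record that the model consists of terms with application as constructor, which the
  quotient below relies on.\<close>

theorem completeness:
  assumes "\<not> (T \<turnstile> \<phi>)" "wff \<phi>" "fv \<phi> = {}"
  shows "\<exists>M :: tm interp. (\<forall>\<psi> \<in> T. wff \<psi> \<longrightarrow> valid M \<psi>) \<and> (\<forall>\<rho>. env M \<rho> \<longrightarrow> \<not> sat M \<rho> \<phi>) \<and>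
    (\<exists>\<rho>. env M \<rho>) \<and> Cn M = id \<and> Ap M = App \<and>
    (\<forall>\<sigma>. Dom M \<sigma> \<subseteq> {t. wt t \<and> ty_of t = \<sigma>}) \<and>
    (\<forall>t. wt t \<and> fv_tm t = {} \<longrightarrow> t \<in> Dom M (ty_of t)) \<and>
    (\<forall>\<sigma> \<tau>. \<forall>f \<in> Dom M (\<sigma> \<rightarrow> \<tau>). \<forall>a \<in> Dom M \<sigma>. f \<cdot> a \<in> Dom M \<tau>)"
proof -
  define S where "S = ren ((*) 2) ` T"
  define \<phi>0 where "\<phi>0 = Neg (ren ((*) 2) \<phi>)"
  have inj: "inj ((*) (2 :: nat))" by (simp add: inj_def)
  have "\<not> der S {\<phi>0} Falsum"
  proof
    assume "der S {\<phi>0} Falsum"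
    then have "der S {} (Neg (Neg (ren ((*) 2) \<phi>)))"
      using deduction[of S \<phi>0 "{}" Falsum] assms by (simp add: \<phi>0_def Neg_def)
    then have "der S {} (ren ((*) 2) \<phi>)" by (rule der_DNeg)
    moreover have "S \<turnstile> \<psi>" if "der S {} \<psi>" for \<psi>
      using that by (induction rule: der.induct) (auto intro: provable.MP)
    ultimately show False using provable_double[of T \<phi>] assms(1) by (simp add: S_def)
  qed
  then interpret henkin_set S \<phi>0
    using assms by unfold_locales (auto simp: consistent_def \<phi>0_def)
  have even: "vars (ren ((*) 2) \<psi>) \<inter> params = {}" for \<psi>
    by (auto simp: params_def)
  have "Var 1 \<sigma> \<in> tms \<sigma>" for \<sigma>
    by (simp add: tms_def params_def)
  then have "env Tm (\<lambda>(n, \<sigma>). Var 1 \<sigma>)" by (simp add: env_def Tm_def)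
  \<comment> \<open>Every assignment arises by reading some other assignment at the doubled indices,
    so validity of the doubled axioms gives validity of the original ones.\<close>
  moreover have comp: "(\<exists>r'. env Tm r' \<and> r = r' \<circ> apfst ((*) 2))" if "env Tm r" for r
    using that by (intro exI[of _ "r \<circ> apfst (\<lambda>n. n div 2)"]) (auto simp: env_def fun_eq_iff)
  moreover have "sat Tm r \<psi>" if "\<psi> \<in> T" "wff \<psi>" "env Tm r" for \<psi> r
  proof -
    obtain r' where r': "env Tm r'" "r = r' \<circ> apfst ((*) 2)" using comp[OF \<open>env Tm r\<close>] by blast
    have "valid Tm (ren ((*) 2) \<psi>)"
      using that by (intro valid_Tm even provable.Ax) (auto simp: S_def)
    then show ?thesis using r' inj by (simp add: valid_def flip: sat_ren)
  qed
  moreover have "\<not> sat Tm r \<phi>" if "env Tm r" for r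
  proof -
    obtain r' where r': "env Tm r'" "r = r' \<circ> apfst ((*) 2)" using comp[OF \<open>env Tm r\<close>] by blast
    have "\<phi>0 \<in> H" by (auto simp: Henkin_def intro: exI[of _ 0])
    moreover have "vars \<phi>0 \<inter> params = {}" using even by (simp add: \<phi>0_def Neg_def)
    moreover have "fv \<phi>0 = {}" using assms by (simp add: \<phi>0_def fv_ren[OF inj])
    ultimately have "sat Tm r' \<phi>0" using r' truth_closed by blast
    then show ?thesis using r' inj by (simp add: \<phi>0_def Neg_def flip: sat_ren)
  qed
  ultimately show ?thesis
    by (intro exI[of _ Tm]) (auto simp: valid_def Tm_def tms_def)
qed


section \<open>Extensional models\<close>

text \<open>The side condition of the higher-order syntax. A quantifier at level d binds index d, so
  assigning to that index leaves the value of a term below d unchanged.\<close>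

definition below :: "nat \<Rightarrow> tm \<Rightarrow> bool" where
  "below d t \<longleftrightarrow> (\<forall>x \<in> fv_tm t. fst x < d)"

lemma below_simps [simp]:
  "below d (Var n \<sigma>) \<longleftrightarrow> n < d" "below d Zero" "below d Succ" "below d (Kc \<sigma> \<tau>)"
  "below d (Sc \<sigma> \<tau> \<upsilon>)" "below d Rc" "below d (s \<cdot> t) \<longleftrightarrow> below d s \<and> below d t"
  by (auto simp: below_def)

lemma below_Suc [simp]: "below d t \<Longrightarrow> below (Suc d) t"
  by (auto simp: below_def)

lemma val_upd_below [simp]: "below d t \<Longrightarrow> val M (\<rho>((d, \<sigma>) := a)) t = val M \<rho> t"
  by (rule val_upd_fresh) (auto simp: below_def)

lemma sat_connectives [simp]:
  "sat M \<rho> (Neg \<phi>) \<longleftrightarrow> \<not> sat M \<rho> \<phi>"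
  "sat M \<rho> (Conj \<phi> \<psi>) \<longleftrightarrow> sat M \<rho> \<phi> \<and> sat M \<rho> \<psi>"
  "sat M \<rho> (Disj \<phi> \<psi>) \<longleftrightarrow> sat M \<rho> \<phi> \<or> sat M \<rho> \<psi>"
  "sat M \<rho> (Exists n \<sigma> \<phi>) \<longleftrightarrow> (\<exists>a \<in> Dom M \<sigma>. sat M (\<rho>((n, \<sigma>) := a)) \<phi>)"
  by (auto simp: Neg_def Conj_def Disj_def Exists_def)

lemma sat_form [simp]:
  "sat M \<rho> ((s \<^bold>= t) d) \<longleftrightarrow> Eqv M (val M \<rho> s) (val M \<rho> t)"
  "sat M \<rho> ((\<^bold>\<not> A) d) \<longleftrightarrow> \<not> sat M \<rho> (A d)"
  "sat M \<rho> ((A \<^bold>\<and> B) d) \<longleftrightarrow> sat M \<rho> (A d) \<and> sat M \<rho> (B d)"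
  "sat M \<rho> ((A \<^bold>\<or> B) d) \<longleftrightarrow> sat M \<rho> (A d) \<or> sat M \<rho> (B d)"
  "sat M \<rho> ((A \<^bold>\<longrightarrow> B) d) \<longleftrightarrow> (sat M \<rho> (A d) \<longrightarrow> sat M \<rho> (B d))"
  "sat M \<rho> ((A \<^bold>\<longleftrightarrow> B) d) \<longleftrightarrow> (sat M \<rho> (A d) \<longleftrightarrow> sat M \<rho> (B d))"
  "sat M \<rho> (all \<sigma> P d) \<longleftrightarrow> (\<forall>a \<in> Dom M \<sigma>. sat M (\<rho>((d, \<sigma>) := a)) (P (Var d \<sigma>) (Suc d)))"
  "sat M \<rho> (ex \<sigma> P d) \<longleftrightarrow> (\<exists>a \<in> Dom M \<sigma>. sat M (\<rho>((d, \<sigma>) := a)) (P (Var d \<sigma>) (Suc d)))"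
  by (auto simp: eq0_def fnot_def fand_def fdisj_def fimp_def fiff_def all_def ex_def)

lemma wff_form [simp]:
  "wff (Conj \<phi> \<psi>) \<longleftrightarrow> wff \<phi> \<and> wff \<psi>" "wff (Disj \<phi> \<psi>) \<longleftrightarrow> wff \<phi> \<and> wff \<psi>" "wff (Exists n \<sigma> \<phi>) \<longleftrightarrow> wff \<phi>"
  "wff ((s \<^bold>= t) d) \<longleftrightarrow> wt s \<and> wt t \<and> ty_of s = Base \<and> ty_of t = Base"
  "wff ((\<^bold>\<not> A) d) \<longleftrightarrow> wff (A d)"
  "wff ((A \<^bold>\<and> B) d) \<longleftrightarrow> wff (A d) \<and> wff (B d)"
  "wff ((A \<^bold>\<or> B) d) \<longleftrightarrow> wff (A d) \<and> wff (B d)"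
  "wff ((A \<^bold>\<longrightarrow> B) d) \<longleftrightarrow> wff (A d) \<and> wff (B d)"
  "wff ((A \<^bold>\<longleftrightarrow> B) d) \<longleftrightarrow> wff (A d) \<and> wff (B d)"
  "wff (all \<sigma> P d) \<longleftrightarrow> wff (P (Var d \<sigma>) (Suc d))"
  "wff (ex \<sigma> P d) \<longleftrightarrow> wff (P (Var d \<sigma>) (Suc d))"
  by (auto simp: eq0_def fnot_def fand_def fdisj_def fimp_def fiff_def all_def ex_def
      Conj_def Disj_def Exists_def)

lemma wff_eq [simp]:
  "wt s \<Longrightarrow> wt t \<Longrightarrow> ty_of s = \<sigma> \<Longrightarrow> ty_of t = \<sigma> \<Longrightarrow> wff (eq \<sigma> s t d)"
  by (induction \<sigma> arbitrary: s t d) auto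

primrec leq :: "('u, 'm) interp_scheme \<Rightarrow> ty \<Rightarrow> 'u \<Rightarrow> 'u \<Rightarrow> bool" where
  "leq M Base a b = Eqv M a b"
| "leq M (\<sigma> \<rightarrow> \<tau>) f g = (\<forall>a \<in> Dom M \<sigma>. leq M \<tau> (Ap M f a) (Ap M g a))"

lemma sat_eq [simp]:
  "below d s \<Longrightarrow> below d t \<Longrightarrow> sat M \<rho> (eq \<sigma> s t d) \<longleftrightarrow> leq M \<sigma> (val M \<rho> s) (val M \<rho> t)"
  by (induction \<sigma> arbitrary: s t d \<rho>) (auto simp del: fun_upd_apply simp: fun_upd_same)

locale term_model =
  fixes M :: "tm interp"
  assumes Cn_eq [simp]: "Cn M = id" and Ap_eq [simp]: "Ap M = App"
    and Dom_typed: "a \<in> Dom M \<sigma> \<Longrightarrow> wt a \<and> ty_of a = \<sigma>"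
    and Dom_closed: "wt t \<Longrightarrow> fv_tm t = {} \<Longrightarrow> t \<in> Dom M (ty_of t)"
    and Dom_Ap: "f \<in> Dom M (\<sigma> \<rightarrow> \<tau>) \<Longrightarrow> a \<in> Dom M \<sigma> \<Longrightarrow> f \<cdot> a \<in> Dom M \<tau>"
    and env_ex: "\<exists>\<rho>. env M \<rho>"
    and axioms: "\<phi> \<in> eq_axioms \<union> ext_axioms \<Longrightarrow> valid M \<phi>"
begin

lemma sat_axioms: "\<exists>\<rho>. \<forall>\<phi> \<in> eq_axioms \<union> ext_axioms. sat M \<rho> \<phi>"
  using env_ex axioms by (meson valid_def)

lemma Base_refl: "a \<in> Dom M Base \<Longrightarrow> Eqv M a a"
  using sat_axioms by (auto simp: eq_axioms_def)

lemma Base_eucl: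
  assumes "a \<in> Dom M Base" "b \<in> Dom M Base" "c \<in> Dom M Base" "Eqv M a b" "Eqv M a c"
  shows "Eqv M b c"
proof -
  obtain \<rho> where \<rho>: "\<forall>\<phi> \<in> eq_axioms \<union> ext_axioms. sat M \<rho> \<phi>" using sat_axioms by blast
  have "sat M \<rho> ((\<forall>\<^sub>0 x y z. x \<^bold>= y \<^bold>\<longrightarrow> x \<^bold>= z \<^bold>\<longrightarrow> y \<^bold>= z) 0)"
    by (rule \<rho>[THEN bspec]) (simp add: eq_axioms_def)
  moreover have "sat M \<rho> ((\<forall>\<^sub>0 x y z. x \<^bold>= y \<^bold>\<longrightarrow> x \<^bold>= z \<^bold>\<longrightarrow> y \<^bold>= z) 0) \<longleftrightarrow>
      (\<forall>a \<in> Dom M Base. \<forall>b \<in> Dom M Base. \<forall>c \<in> Dom M Base. Eqv M a b \<longrightarrow> Eqv M a c \<longrightarrow> Eqv M b c)"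
    by simp
  ultimately show ?thesis using assms by blast
qed

lemma leq_refl: "a \<in> Dom M \<sigma> \<Longrightarrow> leq M \<sigma> a a"
  by (induction \<sigma> arbitrary: a) (auto simp: Base_refl Dom_Ap)

lemma leq_eucl:
  "a \<in> Dom M \<sigma> \<Longrightarrow> b \<in> Dom M \<sigma> \<Longrightarrow> c \<in> Dom M \<sigma> \<Longrightarrow> leq M \<sigma> a b \<Longrightarrow> leq M \<sigma> a c \<Longrightarrow> leq M \<sigma> b c"
proof (induction \<sigma> arbitrary: a b c)
  case Base
  then show ?case using Base_eucl[of a b c] by simp
next
  case (Fn \<sigma> \<tau>)
  show ?case unfolding leq.simps
  proof
    fix x assume "x \<in> Dom M \<sigma>"
    then show "leq M \<tau> (Ap M b x) (Ap M c x)"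
      using Fn.prems Fn.IH(2)[of "a \<cdot> x" "b \<cdot> x" "c \<cdot> x"] Dom_Ap by auto
  qed
qed

lemma leq_ext:
  assumes "f \<in> Dom M (\<sigma> \<rightarrow> \<tau>)" "a \<in> Dom M \<sigma>" "b \<in> Dom M \<sigma>" "leq M \<sigma> a b"
  shows "leq M \<tau> (f \<cdot> a) (f \<cdot> b)"
proof -
  obtain \<rho> where \<rho>: "\<forall>\<phi> \<in> eq_axioms \<union> ext_axioms. sat M \<rho> \<phi>" using sat_axioms by blast
  have "sat M \<rho> (all (\<sigma> \<rightarrow> \<tau>) (\<lambda>f. all \<sigma> (\<lambda>x. all \<sigma> (\<lambda>y. eq \<sigma> x y \<^bold>\<longrightarrow> eq \<tau> (f \<cdot> x) (f \<cdot> y)))) 0)"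
    by (rule \<rho>[THEN bspec]) (auto simp: ext_axioms_def)
  then show ?thesis using assms by simp
qed

definition cls :: "tm \<Rightarrow> tm set" where
  "cls a = {b \<in> Dom M (ty_of a). leq M (ty_of a) a b}"

lemma cls_eq_iff: "a \<in> Dom M \<sigma> \<Longrightarrow> b \<in> Dom M \<sigma> \<Longrightarrow> cls a = cls b \<longleftrightarrow> leq M \<sigma> a b"
proof -
  assume ab: "a \<in> Dom M \<sigma>" "b \<in> Dom M \<sigma>"
  then have cls: "cls a = {c \<in> Dom M \<sigma>. leq M \<sigma> a c}" "cls b = {c \<in> Dom M \<sigma>. leq M \<sigma> b c}"
    using Dom_typed by (auto simp: cls_def)
  show "cls a = cls b \<longleftrightarrow> leq M \<sigma> a b"
  proof
    assume "cls a = cls b"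
    moreover have "b \<in> cls b" using ab leq_refl by (simp add: cls)
    ultimately show "leq M \<sigma> a b" using cls by blast
  next
    assume "leq M \<sigma> a b"
    moreover from this have "leq M \<sigma> b a" using ab leq_eucl leq_refl by meson
    ultimately show "cls a = cls b" unfolding cls using ab leq_eucl by (blast intro: leq_eucl)
  qed
qed

text \<open>The quotient by extensional equality. Application acts on classes through chosen
  representatives; that the choice does not matter is what the extensionality axioms provide, see
  \<open>Ap_Q\<close>.\<close>

definition Q :: "tm set interp" where
  "Q = \<lparr>Dom = \<lambda>\<sigma>. cls ` Dom M \<sigma>, Ap = \<lambda>F A. cls ((SOME f. f \<in> F) \<cdot> (SOME a. a \<in> A)), Cn = cls, Eqv = (=)\<rparr>"

lemma some_cls:
  assumes "a \<in> Dom M \<sigma>"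
  shows "(SOME b. b \<in> cls a) \<in> Dom M \<sigma>" "leq M \<sigma> a (SOME b. b \<in> cls a)"
proof -
  have "a \<in> cls a" using assms Dom_typed leq_refl by (auto simp: cls_def)
  then have "(SOME b. b \<in> cls a) \<in> cls a" by (rule someI)
  then show "(SOME b. b \<in> cls a) \<in> Dom M \<sigma>" "leq M \<sigma> a (SOME b. b \<in> cls a)"
    using Dom_typed assms by (auto simp: cls_def)
qed

lemma Ap_Q:
  assumes "f \<in> Dom M (\<sigma> \<rightarrow> \<tau>)" "a \<in> Dom M \<sigma>"
  shows "Ap Q (cls f) (cls a) = cls (f \<cdot> a)"
proof -
  define g where "g = (SOME f'. f' \<in> cls f)"
  define b where "b = (SOME a'. a' \<in> cls a)"
  have g: "g \<in> Dom M (\<sigma> \<rightarrow> \<tau>)" "leq M (\<sigma> \<rightarrow> \<tau>) f g" and b: "b \<in> Dom M \<sigma>" "leq M \<sigma> a b"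
    using some_cls assms unfolding g_def b_def by blast+
  have "leq M \<tau> (f \<cdot> a) (f \<cdot> b)" "leq M \<tau> (f \<cdot> b) (g \<cdot> b)"
    using leq_ext assms b g by auto
  then have "cls (f \<cdot> a) = cls (g \<cdot> b)"
    using assms g b Dom_Ap cls_eq_iff by metis
  then show ?thesis by (simp add: Q_def g_def b_def)
qed

lemma val_M_typed: "env M \<rho> \<Longrightarrow> wt t \<Longrightarrow> val M \<rho> t \<in> Dom M (ty_of t)"
proof (induction t)
  case (App s t)
  then show ?case using Dom_Ap by (metis Ap_eq ty_of.simps(7) val.simps(7) wt.simps(7))
next
  case (Var n \<sigma>)
  then show ?case by (simp add: env_def)
qed (use Dom_closed[of Zero] Dom_closed[of Succ] Dom_closed[of Rc] Dom_closed[of "Kc _ _"]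
    Dom_closed[of "Sc _ _ _"] in simp_all)

lemma val_Q: "env M \<rho> \<Longrightarrow> wt t \<Longrightarrow> val Q (\<lambda>x. cls (\<rho> x)) t = cls (val M \<rho> t)"
proof (induction t)
  case (App s t)
  then have "val M \<rho> s \<in> Dom M (ty_of t \<rightarrow> cod (ty_of s))" "val M \<rho> t \<in> Dom M (ty_of t)"
    using val_M_typed[of \<rho> s] val_M_typed[of \<rho> t] by auto
  then have "Ap Q (cls (val M \<rho> s)) (cls (val M \<rho> t)) = cls (val M \<rho> s \<cdot> val M \<rho> t)" by (rule Ap_Q)
  with App show ?case by simp
qed (simp_all add: Q_def)

lemma sat_Q: "env M \<rho> \<Longrightarrow> wff \<phi> \<Longrightarrow> sat Q (\<lambda>x. cls (\<rho> x)) \<phi> \<longleftrightarrow> sat M \<rho> \<phi>"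
proof (induction \<phi> arbitrary: \<rho>)
  case (EqN s t)
  then have "val M \<rho> s \<in> Dom M Base" "val M \<rho> t \<in> Dom M Base"
    using val_M_typed[of \<rho> s] val_M_typed[of \<rho> t] by auto
  then have "cls (val M \<rho> s) = cls (val M \<rho> t) \<longleftrightarrow> Eqv M (val M \<rho> s) (val M \<rho> t)"
    by (simp add: cls_eq_iff)
  moreover have "Eqv Q = (=)" by (simp add: Q_def)
  ultimately show ?case using EqN by (simp add: val_Q)
next
  case (Forall n \<sigma> \<phi>)
  have "sat Q ((\<lambda>x. cls (\<rho> x))((n, \<sigma>) := cls a)) \<phi> \<longleftrightarrow> sat M (\<rho>((n, \<sigma>) := a)) \<phi>" if "a \<in> Dom M \<sigma>" for a
    using Forall.IH[of "\<rho>((n, \<sigma>) := a)"] env_upd[OF Forall.prems(1) that] Forall.prems(2)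
    by (simp add: fun_upd_def if_distrib[of cls])
  moreover have "Dom Q \<sigma> = cls ` Dom M \<sigma>" by (simp add: Q_def)
  ultimately show ?case by simp
qed auto

lemma env_Q:
  assumes "env Q \<rho>"
  shows "\<exists>\<rho>'. env M \<rho>' \<and> \<rho> = (\<lambda>x. cls (\<rho>' x))"
proof -
  have "\<forall>x. \<exists>a. a \<in> Dom M (snd x) \<and> \<rho> x = cls a"
    using assms by (fastforce simp: env_def Q_def)
  then obtain \<rho>' where "\<forall>x. \<rho>' x \<in> Dom M (snd x) \<and> \<rho> x = cls (\<rho>' x)" by metis
  then show ?thesis by (intro exI[of _ \<rho>']) (auto simp: env_def)
qed

end

locale ext_model =
  fixes M :: "'u interp"
  assumes Eqv_eq [simp]: "Eqv M = (=)"
    and Ap_typed [simp]: "f \<in> Dom M (\<sigma> \<rightarrow> \<tau>) \<Longrightarrow> a \<in> Dom M \<sigma> \<Longrightarrow> Ap M f a \<in> Dom M \<tau>"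
    and Cn_typed: "wt t \<Longrightarrow> fv_tm t = {} \<Longrightarrow> Cn M t \<in> Dom M (ty_of t)"
    and env_ex: "\<exists>\<rho>. env M \<rho>"
    and ext: "f \<in> Dom M (\<sigma> \<rightarrow> \<tau>) \<Longrightarrow> g \<in> Dom M (\<sigma> \<rightarrow> \<tau>) \<Longrightarrow>
      (\<And>a. a \<in> Dom M \<sigma> \<Longrightarrow> Ap M f a = Ap M g a) \<Longrightarrow> f = g"

lemma (in term_model) ext_model_Q: "ext_model Q"
proof
  show "Eqv Q = (=)" by (simp add: Q_def)
  show "Ap Q f a \<in> Dom Q \<tau>" if "f \<in> Dom Q (\<sigma> \<rightarrow> \<tau>)" "a \<in> Dom Q \<sigma>" for f \<sigma> \<tau> a
  proof -
    have "f \<in> cls ` Dom M (\<sigma> \<rightarrow> \<tau>)" "a \<in> cls ` Dom M \<sigma>" using that by (auto simp: Q_def)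
    then obtain f' a' where "f = cls f'" "a = cls a'" "f' \<in> Dom M (\<sigma> \<rightarrow> \<tau>)" "a' \<in> Dom M \<sigma>"
      by blast
    then show "Ap Q f a \<in> Dom Q \<tau>" using Ap_Q Dom_Ap by (auto simp: Q_def)
  qed
  show "Cn Q t \<in> Dom Q (ty_of t)" if "wt t" "fv_tm t = {}" for t
    using Dom_closed[OF that] by (simp add: Q_def)
  show "\<exists>\<rho>. env Q \<rho>"
  proof -
    obtain \<rho> where "env M \<rho>" using env_ex by blast
    then have "env Q (\<lambda>x. cls (\<rho> x))" by (auto simp: env_def Q_def)
    then show "\<exists>\<rho>. env Q \<rho>" by (intro exI[of _ "\<lambda>x. cls (\<rho> x)"])
  qed
  show "f = g" if "f \<in> Dom Q (\<sigma> \<rightarrow> \<tau>)" "g \<in> Dom Q (\<sigma> \<rightarrow> \<tau>)" and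
    eq: "\<And>a. a \<in> Dom Q \<sigma> \<Longrightarrow> Ap Q f a = Ap Q g a" for f g \<sigma> \<tau>
  proof -
    have "f \<in> cls ` Dom M (\<sigma> \<rightarrow> \<tau>)" "g \<in> cls ` Dom M (\<sigma> \<rightarrow> \<tau>)" using that by (auto simp: Q_def)
    then obtain f' g' where f: "f = cls f'" "f' \<in> Dom M (\<sigma> \<rightarrow> \<tau>)" and g: "g = cls g'" "g' \<in> Dom M (\<sigma> \<rightarrow> \<tau>)"
      by blast
    have "leq M \<tau> (f' \<cdot> a) (g' \<cdot> a)" if "a \<in> Dom M \<sigma>" for a
    proof -
      have "cls (f' \<cdot> a) = cls (g' \<cdot> a)"
        using eq[of "cls a"] that f g Ap_Q by (simp add: Q_def)
      then show ?thesis using that f g cls_eq_iff Dom_Ap by blast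
    qed
    then show "f = g" using f g by (simp add: cls_eq_iff)
  qed
qed

lemma wff_eq_ext_axioms: "\<phi> \<in> eq_axioms \<union> ext_axioms \<Longrightarrow> wff \<phi>"
  by (auto simp: eq_axioms_def ext_axioms_def)

theorem ext_completeness:
  assumes "\<not> (T \<turnstile> \<phi>)" "wff \<phi>" "fv \<phi> = {}" "eq_axioms \<union> ext_axioms \<subseteq> T"
  obtains M :: "tm set interp" where "ext_model M" "\<And>\<psi>. \<psi> \<in> T \<Longrightarrow> wff \<psi> \<Longrightarrow> valid M \<psi>"
    "\<And>\<rho>. env M \<rho> \<Longrightarrow> \<not> sat M \<rho> \<phi>"
proof -
  obtain M :: "tm interp" where M: "\<forall>\<psi> \<in> T. wff \<psi> \<longrightarrow> valid M \<psi>" "\<forall>\<rho>. env M \<rho> \<longrightarrow> \<not> sat M \<rho> \<phi>"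
    "\<exists>\<rho>. env M \<rho>" "Cn M = id" "Ap M = App" "\<forall>\<sigma>. Dom M \<sigma> \<subseteq> {t. wt t \<and> ty_of t = \<sigma>}"
    "\<forall>t. wt t \<and> fv_tm t = {} \<longrightarrow> t \<in> Dom M (ty_of t)"
    "\<forall>\<sigma> \<tau>. \<forall>f \<in> Dom M (\<sigma> \<rightarrow> \<tau>). \<forall>a \<in> Dom M \<sigma>. f \<cdot> a \<in> Dom M \<tau>"
    using completeness[OF assms(1-3)] by blast
  interpret term_model M
    using M assms(4) wff_eq_ext_axioms by unfold_locales (simp_all, blast+)
  show ?thesis
  proof (rule that[OF ext_model_Q])
    show "valid Q \<psi>" if "\<psi> \<in> T" "wff \<psi>" for \<psi>
      using M(1) that env_Q sat_Q by (fastforce simp: valid_def)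
    show "\<not> sat Q \<rho> \<phi>" if "env Q \<rho>" for \<rho>
      using M(2) that env_Q sat_Q assms(2) by fastforce
  qed
qed


section \<open>Bracket abstraction and the evaluation of closed terms\<close>

declare lam.simps [simp del]

lemma lam_typed [simp]: "wt t \<Longrightarrow> wt (lam n \<sigma> t)" "ty_of (lam n \<sigma> t) = \<sigma> \<rightarrow> ty_of t"
proof -
  show ty: "ty_of (lam n \<sigma> t) = \<sigma> \<rightarrow> ty_of t" for t
    by (induction t) (auto simp: lam.simps)
  show "wt t \<Longrightarrow> wt (lam n \<sigma> t)"
    by (induction t) (auto simp: lam.simps ty)
qed

lemma fv_lam [simp]: "fv_tm (lam n \<sigma> t) = fv_tm t - {(n, \<sigma>)}"
  by (induction t) (auto simp: lam.simps)

lemma PLUS_typed [simp]: "wt PLUS" "ty_of PLUS = Base \<rightarrow> ty1" "fv_tm PLUS = {}"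
  by (auto simp: PLUS_def)
lemma TIMES_typed [simp]: "wt TIMES" "ty_of TIMES = Base \<rightarrow> ty1" "fv_tm TIMES = {}"
  by (auto simp: TIMES_def)
lemma PRED_typed [simp]: "wt PRED" "ty_of PRED = ty1" "fv_tm PRED = {}"
  by (auto simp: PRED_def)
lemma MONUS_typed [simp]: "wt MONUS" "ty_of MONUS = Base \<rightarrow> ty1" "fv_tm MONUS = {}"
  by (auto simp: MONUS_def)
lemma POW2_typed [simp]: "wt POW2" "ty_of POW2 = ty1" "fv_tm POW2 = {}"
  by (auto simp: POW2_def)
lemma TRI_typed [simp]: "wt TRI" "ty_of TRI = ty1" "fv_tm TRI = {}"
  by (auto simp: TRI_def)
lemma ROOT_typed [simp]: "wt ROOT" "ty_of ROOT = ty1" "fv_tm ROOT = {}"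
  by (auto simp: ROOT_def)

lemma below_closed: "fv_tm t = {} \<Longrightarrow> below d t"
  by (simp add: below_def)

lemma below_consts [simp]:
  "below d PLUS" "below d TIMES" "below d PRED" "below d MONUS" "below d POW2" "below d TRI" "below d ROOT"
  by (simp_all add: below_closed)

context ext_model
begin

abbreviation N :: "'u set" where "N \<equiv> Dom M Base"
abbreviation ap :: "'u \<Rightarrow> 'u \<Rightarrow> 'u" (infixl \<open>\<bullet>\<close> 90) where "f \<bullet> a \<equiv> Ap M f a"

lemma val_typed: "env M \<rho> \<Longrightarrow> wt t \<Longrightarrow> val M \<rho> t \<in> Dom M (ty_of t)"
proof (induction t)
  case (App s t)
  then have "val M \<rho> s \<in> Dom M (ty_of t \<rightarrow> cod (ty_of s))" "val M \<rho> t \<in> Dom M (ty_of t)" by auto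
  then show ?case by simp
next
  case (Var n \<sigma>)
  then show ?case by (simp add: env_def)
qed (use Cn_typed[of Zero] Cn_typed[of Succ] Cn_typed[of Rc] Cn_typed[of "Kc _ _"]
    Cn_typed[of "Sc _ _ _"] in simp_all)

lemma val_typed' [simp]: "env M \<rho> \<Longrightarrow> wt t \<Longrightarrow> ty_of t = \<sigma> \<Longrightarrow> val M \<rho> t \<in> Dom M \<sigma>"
  using val_typed by blast

lemma leq_iff: "a \<in> Dom M \<sigma> \<Longrightarrow> b \<in> Dom M \<sigma> \<Longrightarrow> leq M \<sigma> a b \<longleftrightarrow> a = b"
proof (induction \<sigma> arbitrary: a b)
  case (Fn \<sigma> \<tau>)
  then have "leq M (\<sigma> \<rightarrow> \<tau>) a b \<longleftrightarrow> (\<forall>x \<in> Dom M \<sigma>. a \<bullet> x = b \<bullet> x)" by simp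
  then show ?case using ext Fn.prems by blast
qed simp

text \<open>An arbitrary assignment, fixed to give closed terms a value; \<open>val_cl\<close> shows
  that this value is independent of it.\<close>

definition \<rho>0 :: "nat \<times> ty \<Rightarrow> 'u" where "\<rho>0 = (SOME \<rho>. env M \<rho>)"

lemma env_\<rho>0 [simp]: "env M \<rho>0"
  unfolding \<rho>0_def by (rule someI_ex[OF env_ex])

definition cl :: "tm \<Rightarrow> 'u" where "cl t = val M \<rho>0 t"

lemma val_cl: "fv_tm t = {} \<Longrightarrow> val M \<rho> t = cl t"
  unfolding cl_def by (rule val_cong) simp

lemma cl_typed [simp]: "wt t \<Longrightarrow> ty_of t = \<sigma> \<Longrightarrow> cl t \<in> Dom M \<sigma>"
  by (simp add: cl_def)

lemma val_consts [simp]: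
  "val M \<rho> PLUS = cl PLUS" "val M \<rho> TIMES = cl TIMES" "val M \<rho> PRED = cl PRED"
  "val M \<rho> MONUS = cl MONUS" "val M \<rho> POW2 = cl POW2" "val M \<rho> TRI = cl TRI" "val M \<rho> ROOT = cl ROOT"
  by (simp_all add: val_cl)

end

section \<open>Primitive recursive arithmetic inside a model\<close>

locale pra_model = ext_model M for M :: "'u interp" +
  assumes E_PRA: "\<phi> \<in> E_PRA \<Longrightarrow> wff \<phi> \<Longrightarrow> valid M \<phi>"
begin

lemma sat_\<rho>0: "\<phi> \<in> E_PRA \<Longrightarrow> wff \<phi> \<Longrightarrow> sat M \<rho>0 \<phi>"
  using E_PRA by (simp add: valid_def)

abbreviation Z :: 'u where "Z \<equiv> Cn M Zero"
definition S :: "'u \<Rightarrow> 'u" where "S a = Cn M Succ \<bullet> a"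

lemma S_Cn [simp]: "Cn M Succ \<bullet> a = S a"
  by (simp add: S_def)

lemma Z_typed [simp]: "Z \<in> N"
  using Cn_typed[of Zero] by simp

lemma S_typed [simp]: "a \<in> N \<Longrightarrow> S a \<in> N"
  unfolding S_def by (rule Ap_typed[of _ Base]) (use Cn_typed[of Succ] in simp_all)

lemma S_neq_Z [simp]: "a \<in> N \<Longrightarrow> S a \<noteq> Z"
  using sat_\<rho>0[of "(\<forall>\<^sub>0 x. \<^bold>\<not> Succ \<cdot> x \<^bold>= Zero) 0"] by (simp add: E_PRA_def succ_axioms_def)

lemma Z_neq_S [simp]: "a \<in> N \<Longrightarrow> Z \<noteq> S a"
  by (metis S_neq_Z)

lemma S_inject [simp]: "a \<in> N \<Longrightarrow> b \<in> N \<Longrightarrow> S a = S b \<longleftrightarrow> a = b"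
  using sat_\<rho>0[of "(\<forall>\<^sub>0 x y. Succ \<cdot> x \<^bold>= Succ \<cdot> y \<^bold>\<longrightarrow> x \<^bold>= y) 0"]
  by (auto simp add: E_PRA_def succ_axioms_def)

lemma K_eq [simp]:
  assumes "a \<in> Dom M \<rho>" "b \<in> Dom M \<sigma>"
  shows "Cn M (Kc \<rho> \<sigma>) \<bullet> a \<bullet> b = a"
proof -
  let ?\<phi> = "all \<rho> (\<lambda>x. all \<sigma> (\<lambda>y. eq \<rho> (Kc \<rho> \<sigma> \<cdot> x \<cdot> y) x)) 0"
  have "?\<phi> \<in> comb_axioms" unfolding comb_axioms_def by blast
  then have "?\<phi> \<in> E_PRA" by (simp add: E_PRA_def)
  then have "sat M \<rho>0 ?\<phi>" by (rule sat_\<rho>0) simp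
  moreover have "Cn M (Kc \<rho> \<sigma>) \<bullet> a \<bullet> b \<in> Dom M \<rho>"
    using Cn_typed[of "Kc \<rho> \<sigma>"] assms by (metis Ap_typed fv_tm.simps(4) ty_of.simps(4) wt.simps(4))
  moreover from calculation(1) have "leq M \<rho> (Cn M (Kc \<rho> \<sigma>) \<bullet> a \<bullet> b) a" using assms by simp
  ultimately show ?thesis using assms leq_iff by blast
qed

lemma S_eq [simp]:
  assumes "f \<in> Dom M (\<rho> \<rightarrow> \<sigma> \<rightarrow> \<tau>)" "g \<in> Dom M (\<rho> \<rightarrow> \<sigma>)" "a \<in> Dom M \<rho>"
  shows "Cn M (Sc \<rho> \<sigma> \<tau>) \<bullet> f \<bullet> g \<bullet> a = f \<bullet> a \<bullet> (g \<bullet> a)"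
proof -
  let ?\<phi> = "all (\<rho> \<rightarrow> \<sigma> \<rightarrow> \<tau>) (\<lambda>x. all (\<rho> \<rightarrow> \<sigma>) (\<lambda>y. all \<rho> (\<lambda>z.
       eq \<tau> (Sc \<rho> \<sigma> \<tau> \<cdot> x \<cdot> y \<cdot> z) (x \<cdot> z \<cdot> (y \<cdot> z))))) 0"
  have "?\<phi> \<in> comb_axioms" unfolding comb_axioms_def by blast
  then have "?\<phi> \<in> E_PRA" by (simp add: E_PRA_def)
  then have "sat M \<rho>0 ?\<phi>" by (rule sat_\<rho>0) simp
  moreover have "Cn M (Sc \<rho> \<sigma> \<tau>) \<bullet> f \<bullet> g \<bullet> a \<in> Dom M \<tau>" "f \<bullet> a \<bullet> (g \<bullet> a) \<in> Dom M \<tau>"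
    using Cn_typed[of "Sc \<rho> \<sigma> \<tau>"] assms
    by (metis Ap_typed fv_tm.simps(5) ty_of.simps(5) wt.simps(5), metis Ap_typed)
  moreover from calculation(1) have "leq M \<tau> (Cn M (Sc \<rho> \<sigma> \<tau>) \<bullet> f \<bullet> g \<bullet> a) (f \<bullet> a \<bullet> (g \<bullet> a))"
    using assms by simp
  ultimately show ?thesis using leq_iff by blast
qed

lemma rec_Z [simp]:
  assumes "a \<in> N" "f \<in> Dom M (Base \<rightarrow> ty1)"
  shows "Cn M Rc \<bullet> Z \<bullet> a \<bullet> f = a"
proof -
  let ?\<phi> = "(\<forall>\<^sub>0 y. all (Base \<rightarrow> ty1) (\<lambda>z. Rc \<cdot> Zero \<cdot> y \<cdot> z \<^bold>= y)) 0"
  have "?\<phi> \<in> E_PRA" unfolding E_PRA_def rec_axioms_def by blast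
  then have "sat M \<rho>0 ?\<phi>" by (rule sat_\<rho>0) simp
  then show ?thesis using assms by simp
qed

lemma rec_S [simp]:
  assumes "n \<in> N" "a \<in> N" "f \<in> Dom M (Base \<rightarrow> ty1)"
  shows "Cn M Rc \<bullet> S n \<bullet> a \<bullet> f = f \<bullet> (Cn M Rc \<bullet> n \<bullet> a \<bullet> f) \<bullet> n"
proof -
  let ?\<phi> = "(\<forall>\<^sub>0 x y. all (Base \<rightarrow> ty1) (\<lambda>z.
        Rc \<cdot> (Succ \<cdot> x) \<cdot> y \<cdot> z \<^bold>= z \<cdot> (Rc \<cdot> x \<cdot> y \<cdot> z) \<cdot> x)) 0"
  have "?\<phi> \<in> E_PRA" unfolding E_PRA_def rec_axioms_def by blast
  then have "sat M \<rho>0 ?\<phi>" by (rule sat_\<rho>0) simp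
  then show ?thesis using assms by simp
qed

lemma rec_typed [simp]:
  "n \<in> N \<Longrightarrow> a \<in> N \<Longrightarrow> f \<in> Dom M (Base \<rightarrow> ty1) \<Longrightarrow> Cn M Rc \<bullet> n \<bullet> a \<bullet> f \<in> N"
  using Cn_typed[of Rc] by (metis Ap_typed fv_tm.simps(6) ty_of.simps(6) wt.simps(6))

text \<open>The beta law. At the abstracted variable it is the identity S K K, at an application the
  equation of S, and everywhere else the equation of K.\<close>

lemma val_lam [simp]:
  "env M \<rho> \<Longrightarrow> wt t \<Longrightarrow> a \<in> Dom M \<sigma> \<Longrightarrow> val M \<rho> (lam n \<sigma> t) \<bullet> a = val M (\<rho>((n, \<sigma>) := a)) t"
proof (induction t)
  case (Var m \<tau>)
  have "val M \<rho> (Kc \<sigma> \<sigma>) \<in> Dom M (\<sigma> \<rightarrow> \<sigma> \<rightarrow> \<sigma>)" "val M \<rho> (Kc \<sigma> (\<sigma> \<rightarrow> \<sigma>)) \<in> Dom M (\<sigma> \<rightarrow> (\<sigma> \<rightarrow> \<sigma>) \<rightarrow> \<sigma>)"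
    "\<rho> (m, \<tau>) \<in> Dom M \<tau>" "Cn M (Kc \<sigma> \<sigma>) \<bullet> a \<in> Dom M (\<sigma> \<rightarrow> \<sigma>)"
    using Var Cn_typed[of "Kc \<sigma> \<sigma>"] Cn_typed[of "Kc \<sigma> (\<sigma> \<rightarrow> \<sigma>)"] by (simp_all add: env_def)
  then show ?case using Var by (auto simp: lam.simps)
next
  case (App s t)
  then have "val M \<rho> (lam n \<sigma> s) \<in> Dom M (\<sigma> \<rightarrow> ty_of t \<rightarrow> cod (ty_of s))"
    "val M \<rho> (lam n \<sigma> t) \<in> Dom M (\<sigma> \<rightarrow> ty_of t)" by auto
  with App show ?case by (simp add: lam.simps)
qed (use Cn_typed[of Zero] Cn_typed[of Succ] Cn_typed[of Rc] Cn_typed[of "Kc _ _"]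
    Cn_typed[of "Sc _ _ _"] in \<open>simp_all add: lam.simps\<close>)

lemma val_lam_fresh [simp]:
  "x \<notin> fv_tm (lam n \<sigma> t) \<Longrightarrow> val M (\<rho>(x := a)) (lam n \<sigma> t) = val M \<rho> (lam n \<sigma> t)"
  "fv_tm (lam n \<sigma> t) = {} \<Longrightarrow> val M \<rho> (lam n \<sigma> t) = cl (lam n \<sigma> t)"
  by (simp_all add: val_upd_fresh val_cl)

lemma cl_lam [simp]: "wt t \<Longrightarrow> a \<in> Dom M \<sigma> \<Longrightarrow> cl (lam n \<sigma> t) \<bullet> a = val M (\<rho>0((n, \<sigma>) := a)) t"
  using val_lam[of \<rho>0 t a \<sigma> n] by (simp add: cl_def del: val_lam)

text \<open>Model induction covers only those properties that a quantifier-free formula defines.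
  This is why the arithmetic proofs below, where they use induction, name the terms or the formula
  expressing their claim.\<close>

lemma qf_induct:
  assumes "env M \<rho>" "qfree \<phi>" "wff \<phi>" "\<And>a. a \<in> N \<Longrightarrow> sat M (\<rho>((n, Base) := a)) \<phi> \<longleftrightarrow> P a"
    and "P Z" "\<And>a. a \<in> N \<Longrightarrow> P a \<Longrightarrow> P (S a)" "a \<in> N"
  shows "P a"
proof -
  let ?\<phi> = "Imp (subst (n, Base) Zero \<phi>)
      (Imp (Forall n Base (Imp \<phi> (subst (n, Base) (Succ \<cdot> Var n Base) \<phi>))) (Forall n Base \<phi>))"
  have "?\<phi> \<in> E_PRA" using assms by (auto simp: E_PRA_def QF_IND_def)
  then have "valid M ?\<phi>" using assms by (intro E_PRA) (simp_all add: wff_subst)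
  then have "sat M \<rho> ?\<phi>" using assms(1) unfolding valid_def by blast
  moreover have "sat M \<rho> (subst (n, Base) Zero \<phi>)"
    using assms by (subst sat_subst_qfree) simp_all
  moreover have "sat M (\<rho>((n, Base) := a)) (subst (n, Base) (Succ \<cdot> Var n Base) \<phi>) \<longleftrightarrow> P (S a)"
    if "a \<in> N" for a
    using assms that by (subst sat_subst_qfree) simp_all
  ultimately show ?thesis using assms by simp
qed

text \<open>Variables 1 and 2 are parameters. The induction variable 0 is updated last, which is the
  shape of environment that \<open>qf_induct\<close> produces.\<close>

definition env3 :: "'u \<Rightarrow> 'u \<Rightarrow> 'u \<Rightarrow> nat \<times> ty \<Rightarrow> 'u" where
  "env3 a b c = \<rho>0((1, Base) := b, (2, Base) := c, (0, Base) := a)"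

lemma env3 [simp]:
  "a \<in> N \<Longrightarrow> b \<in> N \<Longrightarrow> c \<in> N \<Longrightarrow> env M (env3 a b c)"
  "env3 a b c (0, Base) = a" "env3 a b c (Suc 0, Base) = b" "env3 a b c (1, Base) = b" "env3 a b c (2, Base) = c"
  by (simp_all add: env3_def)

lemma eq_induct:
  assumes "b \<in> N" "c \<in> N" "wt s" "wt t" "ty_of s = Base" "ty_of t = Base"
    "\<And>a. a \<in> N \<Longrightarrow> val M (env3 a b c) s = f a" "\<And>a. a \<in> N \<Longrightarrow> val M (env3 a b c) t = g a"
    and "f Z = g Z" "\<And>a. a \<in> N \<Longrightarrow> f a = g a \<Longrightarrow> f (S a) = g (S a)" "a \<in> N"
  shows "f a = g a"
  by (rule qf_induct[where \<rho> = "\<rho>0((1, Base) := b, (2, Base) := c)" and \<phi> = "EqN s t" and n = 0])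
    (use assms in \<open>simp_all add: env3_def\<close>)

definition pl :: "'u \<Rightarrow> 'u \<Rightarrow> 'u" where "pl a b = cl PLUS \<bullet> a \<bullet> b"
definition ti :: "'u \<Rightarrow> 'u \<Rightarrow> 'u" where "ti a b = cl TIMES \<bullet> a \<bullet> b"
definition pr :: "'u \<Rightarrow> 'u" where "pr a = cl PRED \<bullet> a"
definition mo :: "'u \<Rightarrow> 'u \<Rightarrow> 'u" where "mo a b = cl MONUS \<bullet> a \<bullet> b"

lemma ap_cl [simp]:
  "cl PLUS \<bullet> a \<bullet> b = pl a b" "cl TIMES \<bullet> a \<bullet> b = ti a b" "cl PRED \<bullet> a = pr a" "cl MONUS \<bullet> a \<bullet> b = mo a b"
  by (simp_all add: pl_def ti_def pr_def mo_def)

lemma cl_fun_typed: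
  "wt t \<Longrightarrow> ty_of t = ty1 \<Longrightarrow> a \<in> N \<Longrightarrow> cl t \<bullet> a \<in> N"
  "wt t \<Longrightarrow> ty_of t = Base \<rightarrow> ty1 \<Longrightarrow> a \<in> N \<Longrightarrow> b \<in> N \<Longrightarrow> cl t \<bullet> a \<bullet> b \<in> N"
  using Ap_typed cl_typed by blast+

lemma arith_typed [simp]:
  "a \<in> N \<Longrightarrow> b \<in> N \<Longrightarrow> pl a b \<in> N" "a \<in> N \<Longrightarrow> b \<in> N \<Longrightarrow> ti a b \<in> N"
  "a \<in> N \<Longrightarrow> pr a \<in> N" "a \<in> N \<Longrightarrow> b \<in> N \<Longrightarrow> mo a b \<in> N"
  unfolding pl_def ti_def pr_def mo_def by (simp_all add: cl_fun_typed del: ap_cl)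

lemma pl_rec [simp]: "a \<in> N \<Longrightarrow> pl a Z = a" "a \<in> N \<Longrightarrow> b \<in> N \<Longrightarrow> pl a (S b) = S (pl a b)"
  by (simp_all add: pl_def PLUS_def del: ap_cl)

lemma ti_rec [simp]: "a \<in> N \<Longrightarrow> ti a Z = Z" "a \<in> N \<Longrightarrow> b \<in> N \<Longrightarrow> ti a (S b) = pl (ti a b) a"
  by (simp_all add: ti_def TIMES_def del: ap_cl(2))

lemma pr_rec [simp]: "pr Z = Z" "a \<in> N \<Longrightarrow> pr (S a) = a"
  by (simp_all add: pr_def PRED_def del: ap_cl(3))

lemma mo_rec [simp]: "a \<in> N \<Longrightarrow> mo a Z = a" "a \<in> N \<Longrightarrow> b \<in> N \<Longrightarrow> mo a (S b) = pr (mo a b)"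
  by (simp_all add: mo_def MONUS_def del: ap_cl(4))

lemma pl_Z_left [simp]: "a \<in> N \<Longrightarrow> pl Z a = a"
  by (rule eq_induct[where s = "Zero \<oplus> vn 0" and t = "vn 0" and b = Z and c = Z]) simp_all

lemma pl_S_left [simp]: "a \<in> N \<Longrightarrow> b \<in> N \<Longrightarrow> pl (S b) a = S (pl b a)"
  by (rule eq_induct[where s = "Succ \<cdot> vn 1 \<oplus> vn 0" and t = "Succ \<cdot> (vn 1 \<oplus> vn 0)" and b = b and c = Z]) simp_all

lemma pl_commute: "a \<in> N \<Longrightarrow> b \<in> N \<Longrightarrow> pl a b = pl b a"
  by (rule eq_induct[where s = "vn 0 \<oplus> vn 1" and t = "vn 1 \<oplus> vn 0" and b = b and c = Z]) simp_all

lemma pl_assoc: "a \<in> N \<Longrightarrow> b \<in> N \<Longrightarrow> c \<in> N \<Longrightarrow> pl (pl b c) a = pl b (pl c a)"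
  by (rule eq_induct[where s = "(vn 1 \<oplus> vn 2) \<oplus> vn 0" and t = "vn 1 \<oplus> (vn 2 \<oplus> vn 0)" and b = b and c = c]) simp_all

lemma pl_left_commute: "a \<in> N \<Longrightarrow> b \<in> N \<Longrightarrow> c \<in> N \<Longrightarrow> pl a (pl b c) = pl b (pl a c)"
  by (metis pl_assoc pl_commute)

lemmas pl_ac = pl_assoc pl_commute pl_left_commute

lemma ti_Z_left [simp]: "a \<in> N \<Longrightarrow> ti Z a = Z"
  by (rule eq_induct[where s = "Zero \<otimes> vn 0" and t = "Zero" and b = Z and c = Z]) simp_all

lemma ti_S_left [simp]: "a \<in> N \<Longrightarrow> b \<in> N \<Longrightarrow> ti (S b) a = pl (ti b a) a"
  by (rule eq_induct[where s = "Succ \<cdot> vn 1 \<otimes> vn 0" and t = "vn 1 \<otimes> vn 0 \<oplus> vn 0" and b = b and c = Z])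
    (simp_all add: pl_ac)

lemma ti_commute: "a \<in> N \<Longrightarrow> b \<in> N \<Longrightarrow> ti a b = ti b a"
  by (rule eq_induct[where s = "vn 0 \<otimes> vn 1" and t = "vn 1 \<otimes> vn 0" and b = b and c = Z]) simp_all

lemma ti_distrib: "a \<in> N \<Longrightarrow> b \<in> N \<Longrightarrow> c \<in> N \<Longrightarrow> ti (pl b c) a = pl (ti b a) (ti c a)"
  by (rule eq_induct[where s = "(vn 1 \<oplus> vn 2) \<otimes> vn 0" and t = "vn 1 \<otimes> vn 0 \<oplus> vn 2 \<otimes> vn 0" and b = b and c = c])
    (simp_all add: pl_ac)

lemma ti_assoc:
  assumes "a \<in> N" "b \<in> N" "c \<in> N"
  shows "ti (ti b c) a = ti b (ti c a)"
proof (rule eq_induct[where s = "(vn 1 \<otimes> vn 2) \<otimes> vn 0" and t = "vn 1 \<otimes> (vn 2 \<otimes> vn 0)" and b = b and c = c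
      and f = "\<lambda>a. ti (ti b c) a" and g = "\<lambda>a. ti b (ti c a)"])
  fix a assume "a \<in> N" "ti (ti b c) a = ti b (ti c a)"
  moreover from this have "ti b (pl (ti c a) c) = pl (ti b (ti c a)) (ti b c)"
    using assms by (metis arith_typed(1,2) ti_commute ti_distrib)
  ultimately show "ti (ti b c) (S a) = ti b (ti c (S a))" using assms by simp
qed (use assms in simp_all)

lemma N_cases: "a \<in> N \<Longrightarrow> a = Z \<or> (\<exists>b \<in> N. a = S b)"
proof -
  assume "a \<in> N"
  then have "a = Z \<or> a = S (pr a)"
    by (rule qf_induct[where \<rho> = \<rho>0 and n = 0 and \<phi> = "Disj (EqN (vn 0) Zero) (EqN (vn 0) (Succ \<cdot> (PRED \<cdot> vn 0)))", rotated -1])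
      (auto simp: Disj_def Neg_def)
  then show ?thesis using \<open>a \<in> N\<close> arith_typed(3) by blast
qed

lemma mo_S_S [simp]: "a \<in> N \<Longrightarrow> b \<in> N \<Longrightarrow> mo (S b) (S a) = mo b a"
  by (rule eq_induct[where s = "Succ \<cdot> vn 1 \<ominus> Succ \<cdot> vn 0" and t = "vn 1 \<ominus> vn 0" and b = b and c = Z]) simp_all

lemma mo_Z_left [simp]: "a \<in> N \<Longrightarrow> mo Z a = Z"
  by (rule eq_induct[where s = "Zero \<ominus> vn 0" and t = "Zero" and b = Z and c = Z]) simp_all

lemma mo_self [simp]: "a \<in> N \<Longrightarrow> mo a a = Z"
  by (rule eq_induct[where s = "vn 0 \<ominus> vn 0" and t = "Zero" and b = Z and c = Z]) (simp_all del: mo_rec(2))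

lemma mo_pl: "a \<in> N \<Longrightarrow> b \<in> N \<Longrightarrow> c \<in> N \<Longrightarrow> mo b (pl c a) = mo (mo b c) a"
  by (rule eq_induct[where s = "vn 1 \<ominus> (vn 2 \<oplus> vn 0)" and t = "vn 1 \<ominus> vn 2 \<ominus> vn 0" and b = b and c = c]) simp_all

lemma mo_pl_cancel [simp]: "a \<in> N \<Longrightarrow> b \<in> N \<Longrightarrow> mo (pl a b) a = b"
  by (rule eq_induct[where s = "vn 0 \<oplus> vn 1 \<ominus> vn 0" and t = "vn 1" and b = b and c = Z])
    (simp_all del: mo_rec(2))

lemma mo_dichotomy:
  assumes "a \<in> N" "b \<in> N"
  shows "mo b a = Z \<or> b = pl a (mo b a)"
proof (rule qf_induct[where \<rho> = "\<rho>0((1, Base) := b)" and n = 0 and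
      \<phi> = "Disj (EqN (vn 1 \<ominus> vn 0) Zero) (EqN (vn 1) (vn 0 \<oplus> (vn 1 \<ominus> vn 0)))" and
      P = "\<lambda>a. mo b a = Z \<or> b = pl a (mo b a)"])
  fix a assume *: "a \<in> N" "mo b a = Z \<or> b = pl a (mo b a)"
  then show "mo b (S a) = Z \<or> b = pl (S a) (mo b (S a))"
    using N_cases[of "mo b a"] assms by auto
qed (use assms in \<open>auto simp: Disj_def Neg_def\<close>)

lemma mo_eq_Z: "a \<in> N \<Longrightarrow> b \<in> N \<Longrightarrow> mo b a = Z \<Longrightarrow> a = pl b (mo a b)"
proof -
  assume *: "a \<in> N" "b \<in> N" "mo b a = Z"
  have "mo b a = Z \<longrightarrow> a = pl b (mo a b)"
  proof (rule qf_induct[where \<rho> = "\<rho>0((1, Base) := b)" and n = 0 and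
      \<phi> = "Imp (EqN (vn 1 \<ominus> vn 0) Zero) (EqN (vn 0) (vn 1 \<oplus> (vn 0 \<ominus> vn 1)))" and
      P = "\<lambda>a. mo b a = Z \<longrightarrow> a = pl b (mo a b)"])
    show "mo b Z = Z \<longrightarrow> Z = pl b (mo Z b)" using * by simp
    fix a assume IH: "a \<in> N" "mo b a = Z \<longrightarrow> a = pl b (mo a b)"
    show "mo b (S a) = Z \<longrightarrow> S a = pl b (mo (S a) b)"
    proof
      assume "mo b (S a) = Z"
      then have "pr (mo b a) = Z" using IH * by simp
      \<comment> \<open>The predecessor of b - a vanishes, so b - a is 0 or 1. The first value is
        covered by the induction hypothesis, the second means that b is the successor of a.\<close>
      then consider "mo b a = Z" | "mo b a = S Z" using N_cases[of "mo b a"] IH * by auto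
      then show "S a = pl b (mo (S a) b)"
      proof cases
        case 1
        then have a: "a = pl b (mo a b)" using IH by simp
        then have "S a = pl b (S (mo a b))" using IH * by simp
        then show ?thesis using IH * by (metis S_typed arith_typed(4) mo_pl_cancel)
      next
        case 2
        then have "b = pl a (S Z)" using mo_dichotomy[of a b] IH * by auto
        then have "b = S a" using IH by simp
        then show ?thesis using * by simp
      qed
    qed
  qed (use * in auto)
  with * show ?thesis by simp
qed

lemma le_iff_pl: "a \<in> N \<Longrightarrow> b \<in> N \<Longrightarrow> mo a b = Z \<longleftrightarrow> (\<exists>c \<in> N. b = pl a c)"
  using mo_eq_Z[of b a] by (auto simp: mo_pl)

end


section \<open>The ordered field of a semiring\<close>

text \<open>Fractions require an integral domain, so formal differences come first: the pair (a, b)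
  stands for a - b. Cancellation in the semiring makes the relation transitive without the extra
  summand of the general Grothendieck construction.\<close>

definition diffrel :: "'a::linordered_semidom \<times> 'a \<Rightarrow> 'a \<times> 'a \<Rightarrow> bool" where
  "diffrel p q \<longleftrightarrow> fst p + snd q = fst q + snd p"

lemma equivp_diffrel: "equivp (diffrel :: 'a::linordered_semidom \<times> 'a \<Rightarrow> _)"
proof (rule equivpI)
  show "transp (diffrel :: 'a \<times> 'a \<Rightarrow> _)"
  proof (rule transpI)
    fix x y z :: "'a \<times> 'a"
    assume "diffrel x y" "diffrel y z"
    then have "(fst x + snd y) + (fst y + snd z) = (fst y + snd x) + (fst z + snd y)"
      by (simp add: diffrel_def)
    then have "(fst x + snd z) + (snd y + fst y) = (fst z + snd x) + (snd y + fst y)"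
      by (simp add: add_ac)
    then show "diffrel x z" by (simp add: diffrel_def)
  qed
qed (auto simp: reflp_def symp_def diffrel_def)

quotient_type (overloaded) 'a difference = "'a::linordered_semidom \<times> 'a" / diffrel
  morphisms Rep_difference Abs_difference
  by (rule equivp_diffrel)

text \<open>Handles a change of representative in one factor. Commutativity gives the other factor,
  and the two changes are chained by transitivity.\<close>

lemma diff_mult_respects_right:
  fixes a b c d c' d' :: "'a::linordered_semidom"
  assumes "c + d' = c' + d"
  shows "(a * c + b * d) + (a * d' + b * c') = (a * c' + b * d') + (a * d + b * c)"
proof -
  have "(a * c + b * d) + (a * d' + b * c') = a * (c + d') + b * (c' + d)" by (simp add: algebra_simps)
  also have "\<dots> = a * (c' + d) + b * (c + d')" by (simp add: assms)
  finally show ?thesis by (simp add: algebra_simps)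
qed

instantiation difference :: (linordered_semidom) linordered_idom
begin

lift_definition zero_difference :: "'a difference" is "(0, 0)" .
lift_definition one_difference :: "'a difference" is "(1, 0)" .
lift_definition plus_difference :: "'a difference \<Rightarrow> 'a difference \<Rightarrow> 'a difference" is "\<lambda>p q. (fst p + fst q, snd p + snd q)"
proof -
  fix p p' q q' :: "'a \<times> 'a"
  assume "diffrel p p'" "diffrel q q'"
  then have "(fst p + snd p') + (fst q + snd q') = (fst p' + snd p) + (fst q' + snd q)"
    by (simp add: diffrel_def)
  then show "diffrel (fst p + fst q, snd p + snd q) (fst p' + fst q', snd p' + snd q')"
    by (simp add: diffrel_def add_ac)
qed
lift_definition uminus_difference :: "'a difference \<Rightarrow> 'a difference" is "\<lambda>p. (snd p, fst p)"
  unfolding diffrel_def by (simp add: add_ac)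
lift_definition times_difference :: "'a difference \<Rightarrow> 'a difference \<Rightarrow> 'a difference" is
  "\<lambda>p q. (fst p * fst q + snd p * snd q, fst p * snd q + snd p * fst q)"
proof -
  fix p p' q q' :: "'a \<times> 'a"
  assume "diffrel p p'" and q: "diffrel q q'"
  then have "diffrel (fst p * fst q + snd p * snd q, fst p * snd q + snd p * fst q)
      (fst p * fst q' + snd p * snd q', fst p * snd q' + snd p * fst q')"
    using diff_mult_respects_right[of "fst q" "snd q'" "fst q'" "snd q" "fst p" "snd p"]
    by (simp add: diffrel_def)
  moreover have "diffrel (fst p * fst q' + snd p * snd q', fst p * snd q' + snd p * fst q')
      (fst p' * fst q' + snd p' * snd q', fst p' * snd q' + snd p' * fst q')"
    using diff_mult_respects_right[of "fst p" "snd p'" "fst p'" "snd p" "fst q'" "snd q'"] \<open>diffrel p p'\<close>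
    by (simp add: diffrel_def mult.commute add_ac)
  ultimately show "diffrel (fst p * fst q + snd p * snd q, fst p * snd q + snd p * fst q)
      (fst p' * fst q' + snd p' * snd q', fst p' * snd q' + snd p' * fst q')"
    using equivp_diffrel by (blast elim: equivpE dest: transpD)
qed
definition minus_difference :: "'a difference \<Rightarrow> 'a difference \<Rightarrow> 'a difference" where "minus_difference p q = p + - q"
lift_definition less_eq_difference :: "'a difference \<Rightarrow> 'a difference \<Rightarrow> bool" is "\<lambda>p q. fst p + snd q \<le> fst q + snd p"
proof -
  fix p p' q q' :: "'a \<times> 'a"
  assume "diffrel p p'" "diffrel q q'"
  then have p: "fst p + snd p' = fst p' + snd p" and q: "fst q + snd q' = fst q' + snd q"
    by (simp_all add: diffrel_def)
  have "fst p + snd q \<le> fst q + snd p \<longleftrightarrow> (fst p + snd p') + (snd q + snd q') \<le> (fst q + snd q') + (snd p + snd p')"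
    using add_le_cancel_right[of "fst p + snd q" "snd p' + snd q'" "fst q + snd p"] by (simp add: add_ac)
  also have "\<dots> \<longleftrightarrow> (fst p' + snd p) + (snd q + snd q') \<le> (fst q' + snd q) + (snd p + snd p')"
    by (simp only: p q)
  also have "\<dots> \<longleftrightarrow> fst p' + snd q' \<le> fst q' + snd p'"
    using add_le_cancel_right[of "fst p' + snd q'" "snd p + snd q" "fst q' + snd p'"] by (simp add: add_ac)
  finally show "fst p + snd q \<le> fst q + snd p \<longleftrightarrow> fst p' + snd q' \<le> fst q' + snd p'" .
qed
definition less_difference :: "'a difference \<Rightarrow> 'a difference \<Rightarrow> bool" where "less_difference p q \<longleftrightarrow> p \<le> q \<and> \<not> q \<le> p"
definition abs_difference :: "'a difference \<Rightarrow> 'a difference" where "abs_difference p = (if p < 0 then - p else p)"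
definition sgn_difference :: "'a difference \<Rightarrow> 'a difference" where "sgn_difference p = (if p = 0 then 0 else if 0 < p then 1 else - 1)"

instance
proof
  fix a b c :: "'a difference"
  show "a + b + c = a + (b + c)" by transfer (simp add: diffrel_def add_ac)
  show "a + b = b + a" by transfer (simp add: diffrel_def add_ac)
  show "0 + a = a" by transfer (simp add: diffrel_def)
  show "- a + a = 0" by transfer (simp add: diffrel_def add_ac)
  show "a - b = a + - b" by (simp add: minus_difference_def)
  show "a + b - a = b" unfolding minus_difference_def by transfer (simp add: diffrel_def add_ac)
  show "a - b - c = a - (b + c)" unfolding minus_difference_def by transfer (simp add: diffrel_def add_ac)
  show "0 * a = 0" "a * 0 = 0" by (transfer; simp add: diffrel_def)+
  show "a * b * c = a * (b * c)" by transfer (simp add: diffrel_def algebra_simps)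
  show "a * b = b * a" by transfer (simp add: diffrel_def algebra_simps)
  show "1 * a = a" by transfer (simp add: diffrel_def)
  show "(a + b) * c = a * c + b * c" by transfer (simp add: diffrel_def algebra_simps)
  show "(0 :: 'a difference) \<noteq> 1" by transfer (simp add: diffrel_def)
  show "a < b \<longleftrightarrow> a \<le> b \<and> \<not> b \<le> a" by (simp add: less_difference_def)
  show "a \<le> a" by transfer simp
  show "a \<le> c" if "a \<le> b" "b \<le> c"
    using that
  proof transfer
    fix a b c :: "'a \<times> 'a"
    assume "fst a + snd b \<le> fst b + snd a" "fst b + snd c \<le> fst c + snd b"
    then have "(fst a + snd b) + (fst b + snd c) \<le> (fst b + snd a) + (fst c + snd b)" by (rule add_mono)
    then have "(fst a + snd c) + (fst b + snd b) \<le> (fst c + snd a) + (fst b + snd b)"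
      by (simp add: add_ac)
    then show "fst a + snd c \<le> fst c + snd a" by simp
  qed
  show "a = b" if "a \<le> b" "b \<le> a"
    using that by transfer (simp add: diffrel_def)
  show "a \<le> b \<or> b \<le> a" by transfer (rule linear)
  show "c + a \<le> c + b" if "a \<le> b"
    using that
  proof transfer
    fix a b c :: "'a \<times> 'a"
    assume "fst a + snd b \<le> fst b + snd a"
    then have "(fst c + snd c) + (fst a + snd b) \<le> (fst c + snd c) + (fst b + snd a)" by simp
    then show "fst (fst c + fst a, snd c + snd a) + snd (fst c + fst b, snd c + snd b)
        \<le> fst (fst c + fst b, snd c + snd b) + snd (fst c + fst a, snd c + snd a)"
      by (simp add: add_ac)
  qed
  show "\<bar>a\<bar> = (if a < 0 then - a else a)" by (simp add: abs_difference_def)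
  show "sgn a = (if a = 0 then 0 else if 0 < a then 1 else - 1)" by (simp add: sgn_difference_def)
  show "c * a < c * b" if "a < b" "0 < c"
    using that unfolding less_difference_def
  proof transfer
    fix a b c :: "'a \<times> 'a"
    assume ab: "fst a + snd b \<le> fst b + snd a \<and> \<not> fst b + snd a \<le> fst a + snd b"
      and "fst (0, 0) + snd c \<le> fst c + snd (0, 0) \<and> \<not> fst c + snd (0, 0) \<le> fst (0, 0) + snd c"
    then have "snd c < fst c" by (simp add: not_le)
    \<comment> \<open>A positive difference is represented by this x. Multiplying the inequality by
      x and adding the common part, scaled by \<open>snd c\<close>, to both sides gives the
      claim.\<close>
    then obtain x where x: "fst c = snd c + x" "0 < x"
      by (metis add.commute add_0 add_less_cancel_right le_add_diff_inverse2 less_imp_le)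
    have "x * (fst a + snd b) < x * (fst b + snd a)" using ab x by (simp add: mult_strict_left_mono not_le)
    then have "x * (fst a + snd b) + snd c * (fst a + snd a + fst b + snd b)
        < x * (fst b + snd a) + snd c * (fst a + snd a + fst b + snd b)" by simp
    then have "fst c * fst a + snd c * snd a + (fst c * snd b + snd c * fst b)
        < fst c * fst b + snd c * snd b + (fst c * snd a + snd c * fst a)"
      by (simp add: x algebra_simps)
    then show "fst (fst c * fst a + snd c * snd a, fst c * snd a + snd c * fst a) +
           snd (fst c * fst b + snd c * snd b, fst c * snd b + snd c * fst b)
           \<le> fst (fst c * fst b + snd c * snd b, fst c * snd b + snd c * fst b) +
              snd (fst c * fst a + snd c * snd a, fst c * snd a + snd c * fst a) \<and>
           \<not> fst (fst c * fst b + snd c * snd b, fst c * snd b + snd c * fst b) +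
              snd (fst c * fst a + snd c * snd a, fst c * snd a + snd c * fst a)
              \<le> fst (fst c * fst a + snd c * snd a, fst c * snd a + snd c * fst a) +
                 snd (fst c * fst b + snd c * snd b, fst c * snd b + snd c * fst b)"
      by (simp add: not_le)
  qed
qed

end

lift_definition dif :: "'a::linordered_semidom \<Rightarrow> 'a difference" is "\<lambda>a. (a, 0)" .

definition emb :: "'a::linordered_semidom \<Rightarrow> 'a difference fract" where "emb a = Fract (dif a) 1"

lemma dif_hom: "dif 0 = 0" "dif 1 = 1" "dif (a + b) = dif a + dif b" "dif (a * b) = dif a * dif b"
  "dif a \<le> dif b \<longleftrightarrow> a \<le> b"
  by (transfer; simp add: diffrel_def)+

lemma emb_hom [simp]: "emb 0 = 0" "emb 1 = 1" "emb (a + b) = emb a + emb b" "emb (a * b) = emb a * emb b"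
  by (simp_all add: emb_def dif_hom Zero_fract_def One_fract_def)

lemma emb_le [simp]: "emb a \<le> emb b \<longleftrightarrow> a \<le> b"
  by (simp add: emb_def dif_hom)

lemma emb_less [simp]: "emb a < emb b \<longleftrightarrow> a < b"
  by (simp add: less_le_not_le)

section \<open>The numbers of a countermodel as a type\<close>

text \<open>The laws behind the class \<open>linordered_semidom\<close>, relativized to a set, so
  that they can be checked both for the numbers of a model and for the default carrier.\<close>

locale semidom_set =
  fixes C :: "'u set" and z :: 'u and s :: "'u \<Rightarrow> 'u" and p t m :: "'u \<Rightarrow> 'u \<Rightarrow> 'u"
  assumes closed [simp]: "z \<in> C" "a \<in> C \<Longrightarrow> s a \<in> C" "a \<in> C \<Longrightarrow> b \<in> C \<Longrightarrow> p a b \<in> C"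
      "a \<in> C \<Longrightarrow> b \<in> C \<Longrightarrow> t a b \<in> C" "a \<in> C \<Longrightarrow> b \<in> C \<Longrightarrow> m a b \<in> C"
    and p_commute: "a \<in> C \<Longrightarrow> b \<in> C \<Longrightarrow> p a b = p b a"
    and p_assoc: "a \<in> C \<Longrightarrow> b \<in> C \<Longrightarrow> c \<in> C \<Longrightarrow> p (p a b) c = p a (p b c)"
    and p_z: "a \<in> C \<Longrightarrow> p z a = a"
    and p_s: "a \<in> C \<Longrightarrow> b \<in> C \<Longrightarrow> p (s a) b = s (p a b)"
    and t_commute: "a \<in> C \<Longrightarrow> b \<in> C \<Longrightarrow> t a b = t b a"
    and t_assoc: "a \<in> C \<Longrightarrow> b \<in> C \<Longrightarrow> c \<in> C \<Longrightarrow> t (t a b) c = t a (t b c)"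
    and t_distrib: "a \<in> C \<Longrightarrow> b \<in> C \<Longrightarrow> c \<in> C \<Longrightarrow> t (p a b) c = p (t a c) (t b c)"
    and t_z: "a \<in> C \<Longrightarrow> t z a = z"
    and t_s: "a \<in> C \<Longrightarrow> b \<in> C \<Longrightarrow> t (s a) b = p (t a b) b"
    and s_neq_z: "a \<in> C \<Longrightarrow> s a \<noteq> z"
    and z_or_s: "a \<in> C \<Longrightarrow> a = z \<or> (\<exists>b \<in> C. a = s b)"
    and m_p_cancel: "a \<in> C \<Longrightarrow> b \<in> C \<Longrightarrow> m (p a b) a = b"
    and m_p: "a \<in> C \<Longrightarrow> b \<in> C \<Longrightarrow> c \<in> C \<Longrightarrow> m (m a b) c = m a (p b c)"
    and m_z_left: "a \<in> C \<Longrightarrow> m z a = z"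
    and m_linear: "a \<in> C \<Longrightarrow> b \<in> C \<Longrightarrow> m a b = z \<or> m b a = z"
    and m_eq_z: "a \<in> C \<Longrightarrow> b \<in> C \<Longrightarrow> m a b = z \<Longrightarrow> p a (m b a) = b"

context pra_model
begin

lemma semidom_set_N: "semidom_set N Z S pl ti mo"
proof
  show "mo a b = Z \<or> mo b a = Z" if "a \<in> N" "b \<in> N" for a b
    using mo_dichotomy[of b a] that by (metis arith_typed(4) le_iff_pl)
  show "mo (mo a b) c = mo a (pl b c)" if "a \<in> N" "b \<in> N" "c \<in> N" for a b c
    using mo_pl[of c a b] that by simp
  show "pl a (mo b a) = b" if "a \<in> N" "b \<in> N" "mo a b = Z" for a b
    using mo_eq_Z[of b a] that by simp
  show "pl (pl a b) c = pl a (pl b c)" "ti (ti a b) c = ti a (ti b c)"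
    "ti (pl a b) c = pl (ti a c) (ti b c)" if "a \<in> N" "b \<in> N" "c \<in> N" for a b c
    using that pl_assoc ti_assoc ti_distrib by blast+
  show "pl a b = pl b a" "ti a b = ti b a" if "a \<in> N" "b \<in> N" for a b
    using that pl_commute ti_commute by blast+
qed (simp_all add: N_cases)

end

lemma semidom_set_image:
  fixes f :: "nat \<Rightarrow> 'u"
  assumes "inj f"
  shows "semidom_set (range f) (f 0) (\<lambda>a. f (Suc (inv f a))) (\<lambda>a b. f (inv f a + inv f b))
    (\<lambda>a b. f (inv f a * inv f b)) (\<lambda>a b. f (inv f a - inv f b))"
proof
  fix a assume "a \<in> range f"
  then obtain n where "a = f n" by blast
  then show "a = f 0 \<or> (\<exists>b \<in> range f. a = f (Suc (inv f b)))"
    using assms by (cases n) auto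
qed (use assms in \<open>auto simp: inv_f_f inj_eq algebra_simps\<close>)

text \<open>A model refuting either of the two implications counts, so that both are settled by the
  same construction.\<close>

definition countermodel :: "tm set interp \<Rightarrow> bool" where
  "countermodel M \<longleftrightarrow> ext_model M \<and> (\<forall>\<phi> \<in> ACA0\<omega> \<union> QF_AC Base ty1. wff \<phi> \<longrightarrow> valid M \<phi>) \<and>
     (\<forall>\<rho>. env M \<rho> \<longrightarrow> (sat M \<rho> Fsigma_closure \<or> sat M \<rho> Gdelta_interior) \<and> \<not> sat M \<rho> NIN)"

text \<open>A type cannot be defined from a model that is only fixed in a local context. Choosing
  the model globally makes its set of numbers a constant, from which the type \<open>mnum\<close>
  can be cut out.\<close>

definition CM :: "tm set interp" where "CM = (SOME M. countermodel M)"

lemma pra_model_CM: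
  assumes "\<exists>M. countermodel M"
  shows "pra_model CM"
proof -
  have CM: "countermodel CM" unfolding CM_def by (rule someI_ex[OF assms])
  then interpret ext_model CM by (simp add: countermodel_def)
  show ?thesis
    using CM by unfold_locales (auto simp: countermodel_def ACA0\<omega>_def RCA0\<omega>_def)
qed

text \<open>If there is no countermodel, the standard numbers serve as a default.\<close>
definition std :: "nat \<Rightarrow> tm set" where "std n = {Var n Base}"

definition "carr = (if \<exists>M. countermodel M then Dom CM Base else range std)"
definition "carr_z = (if \<exists>M. countermodel M then Cn CM Zero else std 0)"
definition "carr_s = (if \<exists>M. countermodel M then pra_model.S CM else (\<lambda>a. std (Suc (inv std a))))"
definition "carr_p = (if \<exists>M. countermodel M then pra_model.pl CM else (\<lambda>a b. std (inv std a + inv std b)))"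
definition "carr_t = (if \<exists>M. countermodel M then pra_model.ti CM else (\<lambda>a b. std (inv std a * inv std b)))"
definition "carr_m = (if \<exists>M. countermodel M then pra_model.mo CM else (\<lambda>a b. std (inv std a - inv std b)))"

interpretation carr: semidom_set carr carr_z carr_s carr_p carr_t carr_m
  using semidom_set_image[of std] pra_model.semidom_set_N[OF pra_model_CM]
  by (auto simp: carr_def carr_z_def carr_s_def carr_p_def carr_t_def carr_m_def std_def inj_def)

typedef mnum = carr
  by (rule exI[of _ carr_z]) simp

instantiation mnum :: linordered_semidom
begin

definition "0 = Abs_mnum carr_z"
definition "1 = Abs_mnum (carr_s carr_z)"
definition "a + b = Abs_mnum (carr_p (Rep_mnum a) (Rep_mnum b))"
definition "a * b = Abs_mnum (carr_t (Rep_mnum a) (Rep_mnum b))"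
definition "a - b = Abs_mnum (carr_m (Rep_mnum a) (Rep_mnum b))"
definition "a \<le> b \<longleftrightarrow> a - b = (0 :: mnum)"
definition "a < b \<longleftrightarrow> a \<le> b \<and> \<not> b \<le> (a :: mnum)"

lemma Rep_mnum_hom:
  "Rep_mnum 0 = carr_z" "Rep_mnum 1 = carr_s carr_z" "Rep_mnum (a + b) = carr_p (Rep_mnum a) (Rep_mnum b)"
  "Rep_mnum (a * b) = carr_t (Rep_mnum a) (Rep_mnum b)" "Rep_mnum (a - b) = carr_m (Rep_mnum a) (Rep_mnum b)"
  by (simp_all add: zero_mnum_def one_mnum_def plus_mnum_def times_mnum_def minus_mnum_def
      Abs_mnum_inverse Rep_mnum)

instance
proof
  note R = Rep_mnum_hom Rep_mnum Rep_mnum_inject[symmetric]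
  fix a b c :: mnum
  show add_assoc: "a + b + c = a + (b + c)" for a b c :: mnum by (simp add: R carr.p_assoc)
  show add_commute: "a + b = b + a" for a b :: mnum by (simp add: R carr.p_commute)
  show add_0: "0 + a = a" for a :: mnum by (simp add: R carr.p_z)
  show add_diff: "a + b - a = b" for a b :: mnum by (simp add: R carr.m_p_cancel)
  show diff_diff: "a - b - c = a - (b + c)" for a b c :: mnum by (simp add: R carr.m_p)
  show "a * b * c = a * (b * c)" by (simp add: R carr.t_assoc)
  show mult_commute: "a * b = b * a" for a b :: mnum by (simp add: R carr.t_commute)
  show mult_1: "1 * a = a" for a :: mnum by (simp add: R carr.t_s carr.t_z carr.p_z)
  show distrib: "(a + b) * c = a * c + b * c" for a b c :: mnum by (simp add: R carr.t_distrib)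
  show mult_0: "0 * a = 0" for a :: mnum by (simp add: R carr.t_z)
  then show "a * 0 = 0" using mult_commute by metis
  show zero_neq_one: "(0 :: mnum) \<noteq> 1" using carr.s_neq_z[of carr_z] by (simp add: R)
  have zero_diff: "0 - a = 0" for a :: mnum by (simp add: R carr.m_z_left)
  have le_add: "a \<le> a + b" for a b :: mnum
    by (metis add_commute add_diff add_0 diff_diff less_eq_mnum_def zero_diff)
  have le_inverse: "a + (b - a) = b" if "a \<le> b" for a b :: mnum
    using that carr.m_eq_z[of "Rep_mnum a" "Rep_mnum b"] by (simp add: R less_eq_mnum_def)
  have cases: "a = 0 \<or> (\<exists>b. a = b + 1)" for a :: mnum
  proof -
    have "\<exists>b. a = b + 1" if "x \<in> carr" "Rep_mnum a = carr_s x" for x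
    proof
      have "Rep_mnum (Abs_mnum x + 1) = carr_s x"
        using that by (simp add: Rep_mnum_hom Abs_mnum_inverse carr.p_commute[of x] carr.p_s carr.p_z)
      then show "a = Abs_mnum x + 1" using that by (metis Rep_mnum_inject)
    qed
    then show ?thesis using carr.z_or_s[of "Rep_mnum a"] Rep_mnum Rep_mnum_hom(1) by (metis Rep_mnum_inject)
  qed
  have pos: "a + b + 1 \<noteq> 0" for a b :: mnum
  proof -
    have "Rep_mnum (a + b + 1) = carr_s (Rep_mnum (a + b))"
      by (simp add: Rep_mnum_hom carr.p_commute[of _ "carr_s carr_z"] carr.p_s carr.p_z Rep_mnum)
    then show ?thesis using carr.s_neq_z by (metis Rep_mnum Rep_mnum_hom(1))
  qed
  show "a < b \<longleftrightarrow> a \<le> b \<and> \<not> b \<le> a" by (simp add: less_mnum_def)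
  have cancel: "a + b = a + c \<Longrightarrow> b = c" for a b c :: mnum by (metis add_diff)
  show refl: "a \<le> a" for a :: mnum using le_add[of a 0] add_0 add_commute by metis
  show "a \<le> c" if "a \<le> b" "b \<le> c" using that le_inverse le_add add_assoc by metis
  show antisym: "a = b" if "a \<le> b" "b \<le> a" for a b :: mnum
    using that le_inverse[of a b] add_0 add_commute by (metis less_eq_mnum_def)
  show "a \<le> b \<or> b \<le> a"
    using carr.m_linear[of "Rep_mnum a" "Rep_mnum b"] by (simp add: less_eq_mnum_def R)
  show "c + a \<le> c + b" if "a \<le> b" using that le_inverse le_add add_assoc by metis
  show "0 < (1 :: mnum)"
    using le_add[of 0 1] add_0 antisym[of 0 1] zero_neq_one by (auto simp: less_mnum_def)
  \<comment> \<open>Nonzero numbers are successors, and the product of x + 1 and y + 1 is the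
    successor of x (y + 1) + y.\<close>
  have prod: "a * b \<noteq> 0" if ab: "a \<noteq> 0" "b \<noteq> 0" for a b :: mnum
  proof -
    obtain x y where xy: "a = x + 1" "b = y + 1" using ab cases[of a] cases[of b] by blast
    have "a * b = x * b + 1 * b" unfolding xy(1) by (rule distrib)
    then have "a * b = x * b + y + 1" using mult_1[of b] xy(2) add_assoc by simp
    then show ?thesis using pos[of "x * b" y] by simp
  qed
  then show "a \<noteq> 0 \<Longrightarrow> b \<noteq> 0 \<Longrightarrow> a * b \<noteq> 0" .
  show "c * a < c * b" if ab: "a < b" "0 < c"
  proof -
    obtain x where x: "b = a + x" using ab le_inverse[of a b] by (metis less_mnum_def)
    have "x \<noteq> 0" using ab x add_0 add_commute refl by (metis less_mnum_def)
    moreover have "c \<noteq> 0" using ab refl by (auto simp: less_mnum_def)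
    ultimately have "c * x \<noteq> 0" by (simp add: prod)
    moreover have cb: "c * b = c * a + c * x" using x distrib mult_commute by metis
    ultimately have "c * a \<noteq> c * b" using cancel[of "c * a" "c * x" 0] add_0 add_commute by metis
    then show ?thesis using cb le_add antisym by (metis less_mnum_def)
  qed
  show distrib': "a * (b + c) = a * b + a * c" for a b c :: mnum
    using distrib mult_commute by metis
  show "a * (b - c) = a * b - a * c"
  proof (cases "c \<le> b")
    case True
    then have "a * b = a * c + a * (b - c)" using le_inverse[OF True] distrib' by metis
    then show ?thesis by (simp only: add_diff)
  next
    case False
    then have *: "b \<le> c"
      using carr.m_linear[of "Rep_mnum b" "Rep_mnum c"] by (simp add: less_eq_mnum_def R)
    then have "a * b \<le> a * c" using le_inverse[OF *] distrib' le_add by metis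
    with * show ?thesis using mult_0 mult_commute by (metis less_eq_mnum_def)
  qed
  show "a - b + b = a" if "b \<le> a" using le_inverse[OF that] add_commute by metis
qed

end


section \<open>Numbers of the model as an ordered semiring\<close>

lemma q_typed [simp]:
  "ty_of (pair s t) = Base" "wt (pair s t) \<longleftrightarrow> wt s \<and> wt t \<and> ty_of s = Base \<and> ty_of t = Base"
  "fv_tm (pair s t) = fv_tm s \<union> fv_tm t"
  "ty_of (pfst s) = Base" "wt (pfst s) \<longleftrightarrow> wt s \<and> ty_of s = Base" "fv_tm (pfst s) = fv_tm s"
  "ty_of (psnd s) = Base" "wt (psnd s) \<longleftrightarrow> wt s \<and> ty_of s = Base" "fv_tm (psnd s) = fv_tm s"
  by (auto simp: pair_def pfst_def psnd_def)

lemma q_typed2 [simp]: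
  "ty_of (qcode s t u) = Base"
  "wt (qcode s t u) \<longleftrightarrow> wt s \<and> wt t \<and> wt u \<and> ty_of s = Base \<and> ty_of t = Base \<and> ty_of u = Base"
  "fv_tm (qcode s t u) = fv_tm s \<union> fv_tm t \<union> fv_tm u"
  "ty_of (qpos s) = Base" "wt (qpos s) \<longleftrightarrow> wt s \<and> ty_of s = Base" "fv_tm (qpos s) = fv_tm s"
  "ty_of (qneg s) = Base" "wt (qneg s) \<longleftrightarrow> wt s \<and> ty_of s = Base" "fv_tm (qneg s) = fv_tm s"
  "ty_of (qden s) = Base" "wt (qden s) \<longleftrightarrow> wt s \<and> ty_of s = Base" "fv_tm (qden s) = fv_tm s"
  by (auto simp: qcode_def qpos_def qneg_def qden_def)

lemma q_typed3 [simp]: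
  "ty_of (s +\<^sub>Q t) = Base" "wt (s +\<^sub>Q t) \<longleftrightarrow> wt s \<and> wt t \<and> ty_of s = Base \<and> ty_of t = Base"
  "fv_tm (s +\<^sub>Q t) = fv_tm s \<union> fv_tm t"
  "ty_of (s -\<^sub>Q t) = Base" "wt (s -\<^sub>Q t) \<longleftrightarrow> wt s \<and> wt t \<and> ty_of s = Base \<and> ty_of t = Base"
  "fv_tm (s -\<^sub>Q t) = fv_tm s \<union> fv_tm t"
  "ty_of \<bar>s\<bar>\<^sub>Q = Base" "wt \<bar>s\<bar>\<^sub>Q \<longleftrightarrow> wt s \<and> ty_of s = Base" "fv_tm \<bar>s\<bar>\<^sub>Q = fv_tm s"
  "ty_of (dyad s t) = Base" "wt (dyad s t) \<longleftrightarrow> wt s \<and> wt t \<and> ty_of s = Base \<and> ty_of t = Base"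
  "fv_tm (dyad s t) = fv_tm s \<union> fv_tm t"
  by (auto simp: qplus_def qminus_def qabs_def dyad_def)

lemma below_q [simp]:
  "below d (pair s t) \<longleftrightarrow> below d s \<and> below d t" "below d (pfst s) \<longleftrightarrow> below d s"
  "below d (psnd s) \<longleftrightarrow> below d s" "below d (s +\<^sub>Q t) \<longleftrightarrow> below d s \<and> below d t"
  "below d (s -\<^sub>Q t) \<longleftrightarrow> below d s \<and> below d t" "below d \<bar>s\<bar>\<^sub>Q \<longleftrightarrow> below d s"
  "below d (dyad s t) \<longleftrightarrow> below d s \<and> below d t"
  by (auto simp: below_def)

text \<open>The bijection \<open>num\<close> translates between the numbers of the model and a type
  with order and arithmetic, so that simplification and linear arithmetic for ordered structures
  apply to the model.\<close>

locale typed_model = pra_model M for M :: "'u interp" +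
  fixes num :: "'n::linordered_semidom \<Rightarrow> 'u"
  assumes num_range: "range num = N" and inj_num: "inj num"
    and num_Z: "num 0 = Z" and num_1: "num 1 = S Z"
    and num_plus: "num (a + b) = pl (num a) (num b)" and num_times: "num (a * b) = ti (num a) (num b)"
    and num_minus: "num (a - b) = mo (num a) (num b)"
begin

definition nu :: "'u \<Rightarrow> 'n" where "nu = inv num"
abbreviation nv :: "(nat \<times> ty \<Rightarrow> 'u) \<Rightarrow> tm \<Rightarrow> 'n" where "nv \<rho> t \<equiv> nu (val M \<rho> t)"

lemma num_N [simp]: "num a \<in> N"
  using num_range by auto

lemma nu_num [simp]: "nu (num a) = a"
  by (simp add: nu_def inj_num)

lemma num_nu [simp]: "x \<in> N \<Longrightarrow> num (nu x) = x"
  by (simp add: nu_def f_inv_into_f num_range)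

lemma num_inject [simp]: "num a = num b \<longleftrightarrow> a = b"
  using inj_num by (simp add: inj_eq)

lemma nu_inject: "x \<in> N \<Longrightarrow> y \<in> N \<Longrightarrow> nu x = nu y \<longleftrightarrow> x = y"
  by (metis num_nu)

lemma ball_N [simp]: "(\<forall>x \<in> N. P x) \<longleftrightarrow> (\<forall>n. P (num n))"
  unfolding num_range[symmetric] by simp

lemma bex_N [simp]: "(\<exists>x \<in> N. P x) \<longleftrightarrow> (\<exists>n. P (num n))"
  unfolding num_range[symmetric] by simp

lemma S_num: "S (num a) = num (a + 1)"
  by (simp add: num_plus num_1)

lemma nu_arith [simp]:
  "nu Z = 0" "x \<in> N \<Longrightarrow> nu (S x) = nu x + 1" "x \<in> N \<Longrightarrow> y \<in> N \<Longrightarrow> nu (pl x y) = nu x + nu y"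
  "x \<in> N \<Longrightarrow> y \<in> N \<Longrightarrow> nu (ti x y) = nu x * nu y" "x \<in> N \<Longrightarrow> y \<in> N \<Longrightarrow> nu (mo x y) = nu x - nu y"
proof -
  show "nu Z = 0" by (metis nu_num num_Z)
  show "nu (S x) = nu x + 1" if "x \<in> N" using that by (metis S_num nu_num num_nu)
  show "nu (pl x y) = nu x + nu y" if "x \<in> N" "y \<in> N" using that by (metis nu_num num_nu num_plus)
  show "nu (ti x y) = nu x * nu y" if "x \<in> N" "y \<in> N" using that by (metis nu_num num_nu num_times)
  show "nu (mo x y) = nu x - nu y" if "x \<in> N" "y \<in> N" using that by (metis nu_num num_nu num_minus)
qed

lemma n_induct:
  assumes "env M \<rho>" "qfree \<phi>" "wff \<phi>" "\<And>n. sat M (\<rho>((i, Base) := num n)) \<phi> \<longleftrightarrow> P n"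
    and "P 0" "\<And>n. P n \<Longrightarrow> P (n + 1)"
  shows "P n"
proof -
  have "P (nu x)" if "x \<in> N" for x
  proof (rule qf_induct[OF assms(1-3), where n = i and P = "\<lambda>x. P (nu x)"])
    show "sat M (\<rho>((i, Base) := a)) \<phi> \<longleftrightarrow> P (nu a)" if "a \<in> N" for a
      using assms(4)[of "nu a"] that by simp
  qed (use assms that in simp_all)
  then show ?thesis using nu_num num_N by metis
qed

lemma n_cases: "n = 0 \<or> (\<exists>m. n = m + (1 :: 'n))"
proof -
  have "num n = Z \<or> (\<exists>b. num n = S (num b))" using N_cases[of "num n"] by simp
  then show ?thesis by (metis num_Z S_num num_inject)
qed

text \<open>The class \<open>linordered_semidom\<close> admits negative elements. They are excluded
  here because subtraction is that of the model, where 0 - n evaluates to 0.\<close>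

lemma n_ge_0 [simp]: "0 \<le> (n :: 'n)"
proof -
  have "n = 0 \<or> n \<ge> 0"
  proof (cases "n \<ge> 0")
    case False
    have "num (0 - n) = Z" by (simp add: num_minus num_Z)
    then have "0 - n = 0" by (metis num_Z num_inject)
    moreover have "0 - n + n = 0" using False by (intro le_add_diff_inverse2) simp
    ultimately show ?thesis by simp
  qed simp
  then show ?thesis by auto
qed

text \<open>Discreteness is a property of the model and not of the class: a positive difference is
  nonzero, hence a successor.\<close>

lemma n_less_iff: "m < n \<longleftrightarrow> m + 1 \<le> (n :: 'n)"
proof
  assume "m < n"
  then have n: "n = m + (n - m)" "n - m \<noteq> 0"
    by (simp, metis add_0 le_add_diff_inverse2 less_imp_le less_irrefl)
  then obtain c where "n - m = c + 1" using n_cases by metis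
  then show "m + 1 \<le> n" by (metis n(1) add.commute add_left_mono le_add_same_cancel1 n_ge_0 add.left_commute)
next
  assume "m + 1 \<le> n"
  then show "m < n" using less_le_trans[of m "m + 1" n] by simp
qed

lemma n_le_diff [simp]: "m - n = 0 \<longleftrightarrow> m \<le> (n :: 'n)"
proof
  assume *: "m \<le> n"
  then have "mo (num m) (num n) = Z"
    by (metis le_add_diff_inverse num_N le_iff_pl num_plus)
  then show "m - n = 0" by (metis num_Z num_inject num_minus)
next
  assume "m - n = 0"
  then show "m \<le> n" by (metis add_0 le_add_diff_inverse2 linear order_refl)
qed

lemma n_diff_0 [simp]: "m \<le> n \<Longrightarrow> m - n = (0 :: 'n)"
  by simp

lemma nu_pr [simp]: "x \<in> N \<Longrightarrow> nu (pr x) = nu x - 1"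
proof -
  assume "x \<in> N"
  then obtain n where x: "x = num n" using num_range by auto
  consider "n = 0" | m where "n = m + 1" using n_cases by blast
  then show ?thesis
  proof cases
    case 1
    then show ?thesis by (simp add: x num_Z)
  next
    case (2 m)
    then have "x = S (num m)" by (simp add: x S_num)
    then show ?thesis by (simp add: 2)
  qed
qed

section \<open>Powers of two, triangular numbers and Cantor pairing in the model\<close>

definition pw :: "'n \<Rightarrow> 'n" where "pw n = nu (cl POW2 \<bullet> num n)"
definition tr :: "'n \<Rightarrow> 'n" where "tr n = nu (cl TRI \<bullet> num n)"
definition rt :: "'n \<Rightarrow> 'n" where "rt n = nu (cl ROOT \<bullet> num n)"

lemma pw_rec [simp]: "pw 0 = 1" "pw (n + 1) = pw n + pw n"
proof -
  show "pw 0 = 1" by (simp add: pw_def POW2_def num_Z flip: num_1)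
  show "pw (n + 1) = pw n + pw n"
    by (simp add: pw_def POW2_def flip: S_num)
qed

lemma tr_rec [simp]: "tr 0 = 0" "tr (n + 1) = tr n + (n + 1)"
proof -
  show "tr 0 = 0" by (simp add: tr_def TRI_def num_Z)
  show "tr (n + 1) = tr n + (n + 1)"
    by (simp add: tr_def TRI_def add.assoc flip: S_num)
qed

lemma tr_1 [simp]: "tr 1 = 1"
  using tr_rec(2)[of 0] by simp

lemma nu_funs [simp]:
  "x \<in> N \<Longrightarrow> nu (cl POW2 \<bullet> x) = pw (nu x)" "x \<in> N \<Longrightarrow> nu (cl TRI \<bullet> x) = tr (nu x)"
  "x \<in> N \<Longrightarrow> nu (cl ROOT \<bullet> x) = rt (nu x)"
  by (simp_all add: pw_def tr_def rt_def)

lemma rt_rec [simp]: "rt 0 = 0" "rt (n + 1) = rt n + (1 - (tr (rt n + 1) - (n + 1)))"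
proof -
  show "rt 0 = 0" by (simp add: rt_def ROOT_def num_Z del: nu_funs(3))
  show "rt (n + 1) = rt n + (1 - (tr (rt n + 1) - (n + 1)))"
    by (simp add: rt_def ROOT_def cl_fun_typed add.assoc diff_diff_eq flip: S_num del: nu_funs(3))
qed

lemma tr_mono: "m \<le> n \<Longrightarrow> tr m \<le> tr n"
proof -
  have "tr m \<le> tr (m + c)" for c
  proof (rule n_induct[where \<rho> = "\<rho>0((1, Base) := num m)" and i = 0 and
        \<phi> = "EqN (TRI \<cdot> vn 1 \<ominus> TRI \<cdot> (vn 1 \<oplus> vn 0)) Zero" and P = "\<lambda>c. tr m \<le> tr (m + c)"])
    show "tr m \<le> tr (m + (c + 1))" if "tr m \<le> tr (m + c)" for c
      using that by (simp add: add.assoc[symmetric] del: add.assoc) (metis add_increasing2 n_ge_0 add.assoc)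
  qed (simp_all add: nu_inject[symmetric] cl_fun_typed)
  then show "m \<le> n \<Longrightarrow> tr m \<le> tr n" by (metis le_add_diff_inverse)
qed

text \<open>In the recursion of \<open>rt\<close>, the truncated difference subtracted from 1
  vanishes exactly when n + 1 has reached the next triangular number. So the root grows by one at
  these points and nowhere else, which preserves both bounds.\<close>

lemma rt_bounds: "tr (rt n) \<le> n \<and> n + 1 \<le> tr (rt n + 1)"
proof (rule n_induct[where \<rho> = \<rho>0 and i = 0 and
      \<phi> = "Conj (EqN (TRI \<cdot> (ROOT \<cdot> vn 0) \<ominus> vn 0) Zero) (EqN (Succ \<cdot> vn 0 \<ominus> TRI \<cdot> (Succ \<cdot> (ROOT \<cdot> vn 0))) Zero)"
      and P = "\<lambda>n. tr (rt n) \<le> n \<and> n + 1 \<le> tr (rt n + 1)"])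
  fix n assume *: "tr (rt n) \<le> n \<and> n + 1 \<le> tr (rt n + 1)"
  show "tr (rt (n + 1)) \<le> n + 1 \<and> n + 1 + 1 \<le> tr (rt (n + 1) + 1)"
  proof (cases "tr (rt n + 1) \<le> n + 1")
    case True
    then have "tr (rt n + 1) - (n + 1) = 0" by (simp del: tr_rec)
    then have rt: "rt (n + 1) = rt n + 1" unfolding rt_rec(2) by (simp del: tr_rec n_le_diff)
    have "n + 1 + 1 \<le> tr (rt n + 1) + (rt n + 1 + 1)"
      using * by (intro add_mono) (simp_all del: tr_rec)
    then show ?thesis using True unfolding rt tr_rec(2)[of "rt n + 1"] by simp
  next
    case False
    then have "n + 1 + 1 \<le> tr (rt n + 1)" by (simp add: n_less_iff[symmetric] not_le del: tr_rec)
    moreover have "1 \<le> tr (rt n + 1) - (n + 1)"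
      using False n_less_iff[of 0 "tr (rt n + 1) - (n + 1)"] n_le_diff[of "tr (rt n + 1)" "n + 1"]
      by (metis add_0 n_ge_0 order_le_less)
    then have "rt (n + 1) = rt n" unfolding rt_rec(2) by (simp del: tr_rec)
    moreover have "tr (rt n) \<le> n + 1" using * by (simp add: add_increasing2)
    ultimately show ?thesis by (simp del: tr_rec rt_rec)
  qed
qed (simp_all add: nu_inject[symmetric] cl_fun_typed Conj_def Neg_def)

definition npair :: "'n \<Rightarrow> 'n \<Rightarrow> 'n" where "npair a b = tr (a + b) + a"
definition nfst :: "'n \<Rightarrow> 'n" where "nfst n = n - tr (rt n)"
definition nsnd :: "'n \<Rightarrow> 'n" where "nsnd n = rt n - nfst n"

text \<open>The code of (a, b) lies in the half-open interval between the triangular numbers of a +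
  b and a + b + 1. These intervals are disjoint by monotonicity, so the root must be a + b.\<close>

lemma rt_npair: "rt (npair a b) = a + b"
proof -
  define r where "r = rt (npair a b)"
  have r: "tr r \<le> npair a b" "npair a b < tr (r + 1)"
    using rt_bounds[of "npair a b"] by (auto simp: r_def n_less_iff simp del: tr_rec)
  have "tr (a + b) \<le> npair a b" by (simp add: npair_def)
  moreover have "tr (a + b) + (a + 1) \<le> tr (a + b) + (a + b + 1)"
    by (intro add_left_mono add_right_mono) simp
  then have "npair a b < tr (a + b + 1)"
    unfolding tr_rec(2)[of "a + b"] by (simp add: npair_def n_less_iff add.assoc)
  ultimately have "\<not> r + 1 \<le> a + b" "\<not> a + b + 1 \<le> r"
    using r tr_mono[of "r + 1" "a + b"] tr_mono[of "a + b + 1" r] by auto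
  then show ?thesis by (simp add: n_less_iff[symmetric] r_def)
qed

lemma nfst_npair [simp]: "nfst (npair a b) = a"
  by (simp add: nfst_def rt_npair) (simp add: npair_def)

lemma nsnd_npair [simp]: "nsnd (npair a b) = b"
  by (simp add: nsnd_def rt_npair)

lemma nv_pair [simp]:
  "env M \<rho> \<Longrightarrow> wt s \<Longrightarrow> ty_of s = Base \<Longrightarrow> wt t \<Longrightarrow> ty_of t = Base \<Longrightarrow>
     nv \<rho> (pair s t) = npair (nv \<rho> s) (nv \<rho> t)"
  "env M \<rho> \<Longrightarrow> wt s \<Longrightarrow> ty_of s = Base \<Longrightarrow> nv \<rho> (pfst s) = nfst (nv \<rho> s)"
  "env M \<rho> \<Longrightarrow> wt s \<Longrightarrow> ty_of s = Base \<Longrightarrow> nv \<rho> (psnd s) = nsnd (nv \<rho> s)"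
  by (simp_all add: pair_def pfst_def psnd_def npair_def nfst_def nsnd_def cl_fun_typed)

section \<open>Values of rational codes in the field of the model\<close>

definition qv :: "'n \<Rightarrow> 'n difference fract" where
  "qv c = (emb (nfst (nfst c)) - emb (nsnd (nfst c))) / (emb (nsnd c) + 1)"

lemma emb_ge_0 [simp]: "0 \<le> emb (n :: 'n)"
  by (metis emb_hom(1) emb_le n_ge_0)

lemma emb_plus_1_pos [simp]: "0 < emb (n :: 'n) + 1" "emb (n :: 'n) + 1 \<noteq> 0"
proof -
  show "0 < emb n + 1" by (simp add: add_nonneg_pos)
  then show "emb n + 1 \<noteq> 0" by simp
qed

lemma qv_code: "qv (npair (npair a b) c) = (emb a - emb b) / (emb c + 1)"
  by (simp add: qv_def)

lemma sat_le0 [simp]: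
  "env M \<rho> \<Longrightarrow> wt s \<Longrightarrow> ty_of s = Base \<Longrightarrow> wt t \<Longrightarrow> ty_of t = Base \<Longrightarrow> sat M \<rho> ((s \<^bold>\<le> t) d) \<longleftrightarrow> nv \<rho> s \<le> nv \<rho> t"
  "env M \<rho> \<Longrightarrow> wt s \<Longrightarrow> ty_of s = Base \<Longrightarrow> wt t \<Longrightarrow> ty_of t = Base \<Longrightarrow> sat M \<rho> ((s \<^bold>< t) d) \<longleftrightarrow> nv \<rho> s < nv \<rho> t"
  by (simp_all add: le0_def less0_def nu_inject[symmetric] n_less_iff)

lemma nv_q [simp]:
  assumes "env M \<rho>" "wt s" "ty_of s = Base"
  shows "nv \<rho> (qpos s) = nfst (nfst (nv \<rho> s))" "nv \<rho> (qneg s) = nsnd (nfst (nv \<rho> s))"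
    "nv \<rho> (qden s) = nsnd (nv \<rho> s) + 1"
  using assms by (simp_all add: qpos_def qneg_def qden_def)

lemma sat_qless [simp]:
  assumes "env M \<rho>" "wt s" "ty_of s = Base" "wt t" "ty_of t = Base"
  shows "sat M \<rho> ((s <\<^sub>Q t) d) \<longleftrightarrow> qv (nv \<rho> s) < qv (nv \<rho> t)"
    and "sat M \<rho> ((s \<le>\<^sub>Q t) d) \<longleftrightarrow> qv (nv \<rho> s) \<le> qv (nv \<rho> t)"
proof -
  have emb: "m < n \<longleftrightarrow> emb m < emb n" "m \<le> n \<longleftrightarrow> emb m \<le> emb n" for m n :: 'n by simp_all
  have "(a - b) / c < (a' - b') / c' \<longleftrightarrow> a * c' + b' * c < a' * c + b * c'"
    "(a - b) / c \<le> (a' - b') / c' \<longleftrightarrow> a * c' + b' * c \<le> a' * c + b * c'"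
    if "0 < c" "0 < c'" for a b c a' b' c' :: "'n difference fract"
    using that by (simp_all add: field_simps)
  then show "sat M \<rho> ((s <\<^sub>Q t) d) \<longleftrightarrow> qv (nv \<rho> s) < qv (nv \<rho> t)"
    "sat M \<rho> ((s \<le>\<^sub>Q t) d) \<longleftrightarrow> qv (nv \<rho> s) \<le> qv (nv \<rho> t)"
    using assms by (simp_all add: qless_def qle_def qv_def emb del: emb_less emb_le)
qed

lemma emb_minus: "b \<le> a \<Longrightarrow> emb (a - b) = emb a - emb (b :: 'n)"
  by (metis add_diff_cancel_right' emb_hom(3) le_add_diff_inverse2)

lemma emb_pred: "0 < n \<Longrightarrow> emb (n - 1) + 1 = emb (n :: 'n)"
  by (simp add: emb_minus n_less_iff)

lemma qv_arith [simp]: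
  assumes "env M \<rho>" "wt s" "ty_of s = Base" "wt t" "ty_of t = Base"
  shows "qv (nv \<rho> (s +\<^sub>Q t)) = qv (nv \<rho> s) + qv (nv \<rho> t)"
    and "qv (nv \<rho> (s -\<^sub>Q t)) = qv (nv \<rho> s) - qv (nv \<rho> t)"
proof -
  define a b d where "a = nfst (nfst (nv \<rho> s))" and "b = nsnd (nfst (nv \<rho> s))" and "d = nsnd (nv \<rho> s) + 1"
  define a' b' d' where "a' = nfst (nfst (nv \<rho> t))" and "b' = nsnd (nfst (nv \<rho> t))" and "d' = nsnd (nv \<rho> t) + 1"
  have d: "0 < emb d" "0 < emb d'" by (simp_all add: d_def d'_def)
  then have "0 < emb (d * d')" by simp
  \<comment> \<open>Codes store the denominator minus one. Positivity of the product ensures that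
    the truncated predecessor really subtracts one.\<close>
  then have pos: "0 < d * d'" by (metis emb_hom(1) emb_less)
  have nv: "nv \<rho> (s +\<^sub>Q t) = npair (npair (a * d' + a' * d) (b * d' + b' * d)) (d * d' - 1)"
    "nv \<rho> (s -\<^sub>Q t) = npair (npair (a * d' + b' * d) (b * d' + a' * d)) (d * d' - 1)"
    using assms by (simp_all only: qplus_def qminus_def qcode_def) (simp_all add: a_def b_def d_def a'_def b'_def d'_def)
  have qv: "qv (nv \<rho> s) = (emb a - emb b) / emb d" "qv (nv \<rho> t) = (emb a' - emb b') / emb d'"
    by (simp_all add: qv_def a_def b_def d_def a'_def b'_def d'_def)
  show "qv (nv \<rho> (s +\<^sub>Q t)) = qv (nv \<rho> s) + qv (nv \<rho> t)"
    "qv (nv \<rho> (s -\<^sub>Q t)) = qv (nv \<rho> s) - qv (nv \<rho> t)"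
    unfolding nv qv qv_code emb_pred[OF pos] using d by (simp_all add: field_simps)
qed

lemma qv_abs [simp]:
  assumes "env M \<rho>" "wt s" "ty_of s = Base"
  shows "qv (nv \<rho> \<bar>s\<bar>\<^sub>Q) = \<bar>qv (nv \<rho> s)\<bar>"
proof -
  define a b where "a = nfst (nfst (nv \<rho> s))" and "b = nsnd (nfst (nv \<rho> s))"
  have "emb ((a - b) + (b - a)) = \<bar>emb a - emb b\<bar>"
  proof (cases "a \<le> b")
    case True
    then show ?thesis by (simp add: emb_minus)
  next
    case False
    then show ?thesis by (simp add: emb_minus)
  qed
  then show ?thesis using assms by (simp add: qabs_def qcode_def qv_code qv_def a_def b_def)
qed

lemma pw_pos [simp]: "0 < pw n"
proof (rule n_induct[where \<rho> = \<rho>0 and i = 0 and \<phi> = "EqN (Succ \<cdot> Zero \<ominus> POW2 \<cdot> vn 0) Zero" and P = "\<lambda>n. 0 < pw n"])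
  show "0 < pw (n + 1)" if "0 < pw n" for n using that by (simp add: add_pos_pos)
qed (simp_all add: nu_inject[symmetric] cl_fun_typed n_less_iff)

definition e :: "'n \<Rightarrow> 'n difference fract" where "e n = 1 / emb (pw n)"

lemma emb_pw_pos [simp]: "0 < emb (pw n)"
  by (metis emb_hom(1) emb_less pw_pos)

lemma e_pos [simp]: "0 < e n" "0 \<le> e n" "e n \<noteq> 0"
proof -
  show "0 < e n" by (simp add: e_def)
  then show "0 \<le> e n" "e n \<noteq> 0" by auto
qed

lemma e_0 [simp]: "e 0 = 1"
  by (simp add: e_def)

lemma e_double: "2 * e (n + 1) = e n"
  by (simp add: e_def)

lemma qv_dyad [simp]:
  assumes "env M \<rho>" "wt s" "ty_of s = Base" "wt t" "ty_of t = Base"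
  shows "qv (nv \<rho> (dyad s t)) = emb (nv \<rho> s) * e (nv \<rho> t)"
  using assms by (simp add: dyad_def qcode_def qv_code emb_pred e_def cl_fun_typed)

end


section \<open>Reals and sets of reals in a model\<close>

lemma real_tm_typed [simp]:
  "ty_of (ratR q) = ty1" "wt (ratR q) \<longleftrightarrow> wt q \<and> ty_of q = Base" "fv_tm (ratR q) = fv_tm q"
  "ty_of DIFF = ty1 \<rightarrow> ty1 \<rightarrow> ty1" "wt DIFF" "fv_tm DIFF = {}"
  "ty_of ABS = ty1 \<rightarrow> ty1" "wt ABS" "fv_tm ABS = {}"
  by (auto simp: ratR_def DIFF_def ABS_def)

lemma below_real [simp]: "below d (ratR q) \<longleftrightarrow> below d q" "below d DIFF" "below d ABS"
  by (auto simp: below_def)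

lemma wff_real [simp]:
  "wt s \<Longrightarrow> ty_of s = Base \<Longrightarrow> wt t \<Longrightarrow> ty_of t = Base \<Longrightarrow> wff ((s \<^bold>\<le> t) d)"
  "wt s \<Longrightarrow> ty_of s = Base \<Longrightarrow> wt t \<Longrightarrow> ty_of t = Base \<Longrightarrow> wff ((s \<^bold>< t) d)"
  "wt s \<Longrightarrow> ty_of s = Base \<Longrightarrow> wt t \<Longrightarrow> ty_of t = Base \<Longrightarrow> wff ((s <\<^sub>Q t) d)"
  "wt s \<Longrightarrow> ty_of s = Base \<Longrightarrow> wt t \<Longrightarrow> ty_of t = Base \<Longrightarrow> wff ((s \<le>\<^sub>Q t) d)"
  "wt x \<Longrightarrow> ty_of x = ty1 \<Longrightarrow> wff (is_real x d)"
  "wff (P (Var d ty1) (Suc d)) \<Longrightarrow> wff (allR P d)" "wff (P (Var d ty1) (Suc d)) \<Longrightarrow> wff (exR P d)"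
  "wt x \<Longrightarrow> ty_of x = ty1 \<Longrightarrow> wt y \<Longrightarrow> ty_of y = ty1 \<Longrightarrow> wff ((x =\<^sub>R y) d)"
  "wt x \<Longrightarrow> ty_of x = ty1 \<Longrightarrow> wt y \<Longrightarrow> ty_of y = ty1 \<Longrightarrow> wff ((x <\<^sub>R y) d)"
  "wt x \<Longrightarrow> ty_of x = ty1 \<Longrightarrow> wt y \<Longrightarrow> ty_of y = ty1 \<Longrightarrow> wff ((x \<le>\<^sub>R y) d)"
  "wt x \<Longrightarrow> ty_of x = ty1 \<Longrightarrow> wt k \<Longrightarrow> ty_of k = Base \<Longrightarrow> wt y \<Longrightarrow> ty_of y = ty1 \<Longrightarrow> wff (in_ball x k y d)"
  "wt x \<Longrightarrow> ty_of x = ty1 \<Longrightarrow> wff (in_unit x d)"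
  by (simp_all add: le0_def less0_def qless_def qle_def is_real_def allR_def exR_def eqR_def lessR_def
      leR_def in_ball_def in_unit_def)

lemma wff_set [simp]:
  "wt A \<Longrightarrow> ty_of A = ty1 \<rightarrow> ty1 \<Longrightarrow> wff (is_set A d)"
  "wt A \<Longrightarrow> ty_of A = ty1 \<rightarrow> ty1 \<Longrightarrow> wt x \<Longrightarrow> ty_of x = ty1 \<Longrightarrow> wff ((x \<in>\<^sub>R A) d)"
  "wt A \<Longrightarrow> ty_of A = ty1 \<rightarrow> ty1 \<Longrightarrow> wff (is_open A d)"
  "wt A \<Longrightarrow> ty_of A = ty1 \<rightarrow> ty1 \<Longrightarrow> wff (is_closed A d)"
  "wt A \<Longrightarrow> ty_of A = ty1 \<rightarrow> ty1 \<Longrightarrow> wff (is_Fsigma A d)"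
  "wt A \<Longrightarrow> ty_of A = ty1 \<rightarrow> ty1 \<Longrightarrow> wff (is_Gdelta A d)"
  "wt A \<Longrightarrow> ty_of A = ty1 \<rightarrow> ty1 \<Longrightarrow> wt x \<Longrightarrow> ty_of x = ty1 \<Longrightarrow> wff (limit_point A x d)"
  "wt A \<Longrightarrow> ty_of A = ty1 \<rightarrow> ty1 \<Longrightarrow> wt C \<Longrightarrow> ty_of C = ty1 \<rightarrow> ty1 \<Longrightarrow> wff (is_closure A C d)"
  "wt A \<Longrightarrow> ty_of A = ty1 \<rightarrow> ty1 \<Longrightarrow> wt C \<Longrightarrow> ty_of C = ty1 \<rightarrow> ty1 \<Longrightarrow> wff (is_interior A C d)"
  "wt Y \<Longrightarrow> ty_of Y = ty2 \<Longrightarrow> wff (is_injection Y d)"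
  by (simp_all add: is_set_def mem_def is_open_def is_closed_def is_Fsigma_def is_Gdelta_def
      limit_point_def is_closure_def is_interior_def is_injection_def)

lemma wff_principles [simp]: "wff Fsigma_closure" "wff Gdelta_interior" "wff NIN"
  by (simp_all add: Fsigma_closure_def Gdelta_interior_def NIN_def)

lemma fv_form [simp]:
  "fv ((s \<^bold>= t) d) = fv_tm s \<union> fv_tm t" "fv ((\<^bold>\<not> A) d) = fv (A d)" "fv ((A \<^bold>\<and> B) d) = fv (A d) \<union> fv (B d)"
  "fv ((A \<^bold>\<or> B) d) = fv (A d) \<union> fv (B d)" "fv ((A \<^bold>\<longrightarrow> B) d) = fv (A d) \<union> fv (B d)"
  "fv ((A \<^bold>\<longleftrightarrow> B) d) = fv (A d) \<union> fv (B d)"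
  "fv (all \<sigma> P d) = fv (P (Var d \<sigma>) (Suc d)) - {(d, \<sigma>)}"
  "fv (ex \<sigma> P d) = fv (P (Var d \<sigma>) (Suc d)) - {(d, \<sigma>)}"
  by (auto simp: eq0_def fnot_def fand_def fdisj_def fimp_def fiff_def all_def ex_def
      Conj_def Disj_def Exists_def)

lemma fv_q [simp]: "fv ((s <\<^sub>Q t) d) = fv_tm s \<union> fv_tm t" "fv ((s \<le>\<^sub>Q t) d) = fv_tm s \<union> fv_tm t"
  by (auto simp: qless_def qle_def less0_def le0_def)

lemma fv_real:
  "fv (is_real x d) \<subseteq> fv_tm x" "fv ((x =\<^sub>R y) d) \<subseteq> fv_tm x \<union> fv_tm y"
  "fv ((x <\<^sub>R y) d) \<subseteq> fv_tm x \<union> fv_tm y" "fv ((x \<le>\<^sub>R y) d) \<subseteq> fv_tm x \<union> fv_tm y"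
  "fv (allR P d) \<subseteq> fv (P (Var d ty1) (Suc d)) - {(d, ty1)}"
  "fv (exR P d) \<subseteq> fv (P (Var d ty1) (Suc d)) - {(d, ty1)}"
  by (auto simp: is_real_def eqR_def lessR_def leR_def allR_def exR_def)

lemma fv_ball: "fv (in_ball x k y d) \<subseteq> fv_tm x \<union> fv_tm k \<union> fv_tm y"
  using fv_real(3)[of "ABS \<cdot> (DIFF \<cdot> x \<cdot> y)" "ratR (dyad one k)" d] by (simp add: in_ball_def) blast

lemma fv_mem: "fv ((x \<in>\<^sub>R A) d) \<subseteq> fv_tm x \<union> fv_tm A"
  using fv_real(3)[of zeroR "A \<cdot> x" d] by (simp add: mem_def) blast

lemma fv_unit: "fv (in_unit x d) \<subseteq> fv_tm x"
  using fv_real(4)[of zeroR x d] fv_real(4)[of x oneR d] by (simp add: in_unit_def)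

lemmas fv_subs = fv_real[THEN subsetD] fv_ball[THEN subsetD] fv_mem[THEN subsetD] fv_unit[THEN subsetD]

lemma fv_set:
  "fv (is_set A d) \<subseteq> fv_tm A" "fv (limit_point A x d) \<subseteq> fv_tm A \<union> fv_tm x"
  by (auto simp: is_set_def limit_point_def dest!: fv_subs)

lemma fv_open: "fv (is_open A d) \<subseteq> fv_tm A"
  by (auto simp: is_open_def dest!: fv_subs fv_set[THEN subsetD])

lemma fv_closed: "fv (is_closed A d) \<subseteq> fv_tm A"
  by (auto simp: is_closed_def dest!: fv_subs fv_set[THEN subsetD] fv_open[THEN subsetD])

lemma fv_Borel:
  "fv (is_Fsigma A d) \<subseteq> fv_tm A" "fv (is_Gdelta A d) \<subseteq> fv_tm A"
  "fv (is_closure A C d) \<subseteq> fv_tm A \<union> fv_tm C" "fv (is_interior A C d) \<subseteq> fv_tm A \<union> fv_tm C"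
  "fv (is_injection Y d) \<subseteq> fv_tm Y"
  by (auto simp: is_Fsigma_def is_Gdelta_def is_closure_def is_interior_def is_injection_def
      dest!: fv_subs fv_set[THEN subsetD] fv_open[THEN subsetD] fv_closed[THEN subsetD])

lemma fv_principles [simp]: "fv Fsigma_closure = {}" "fv Gdelta_interior = {}" "fv NIN = {}"
  by (auto simp: Fsigma_closure_def Gdelta_interior_def NIN_def dest!: fv_Borel[THEN subsetD])

context typed_model
begin

lemma emb_2 [simp]: "emb (2 :: 'n) = 2"
  by (metis one_add_one emb_hom(2,3))

definition rs :: "'u \<Rightarrow> 'n \<Rightarrow> 'n difference fract" where "rs x n = qv (nu (x \<bullet> num n))"

lemma qv_App [simp]: "y \<in> N \<Longrightarrow> qv (nu (x \<bullet> y)) = rs x (nu y)"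
  by (simp add: rs_def)

definition R :: "'u set" where
  "R = {x \<in> Dom M ty1. \<forall>n i. \<bar>rs x n - rs x (n + i)\<bar> < e n}"
definition eqr :: "'u \<Rightarrow> 'u \<Rightarrow> bool" where "eqr x y \<longleftrightarrow> (\<forall>n. \<bar>rs x n - rs y n\<bar> \<le> 2 * e n)"
definition lessr :: "'u \<Rightarrow> 'u \<Rightarrow> bool" where "lessr x y \<longleftrightarrow> (\<exists>n. rs x n + 2 * e n < rs y n)"
text \<open>A literal reading of \<open>in_ball\<close>: the shifted index comes from
  \<open>DIFF\<close>, the summand \<open>2 * e n\<close> from the definition of the strict order on
  reals.\<close>

definition ball :: "'u \<Rightarrow> 'n \<Rightarrow> 'u \<Rightarrow> bool" where
  "ball x k y \<longleftrightarrow> (\<exists>n. \<bar>rs x (n + 1) - rs y (n + 1)\<bar> + 2 * e n < e k)"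
definition unit :: "'u \<Rightarrow> bool" where "unit x \<longleftrightarrow> \<not> lessr x (cl zeroR) \<and> \<not> lessr (cl oneR) x"
definition In :: "'u \<Rightarrow> 'u \<Rightarrow> bool" where "In x a \<longleftrightarrow> lessr (cl zeroR) (a \<bullet> x)"
definition isset :: "'u \<Rightarrow> bool" where
  "isset a \<longleftrightarrow> (\<forall>x \<in> R. a \<bullet> x \<in> R \<and> \<not> lessr (a \<bullet> x) (cl zeroR)) \<and>
     (\<forall>x \<in> R. \<forall>y \<in> R. eqr x y \<longrightarrow> eqr (a \<bullet> x) (a \<bullet> y))"
definition isopen :: "'u \<Rightarrow> bool" where
  "isopen a \<longleftrightarrow> isset a \<and> (\<forall>x \<in> R. In x a \<longrightarrow> (\<exists>k. \<forall>y \<in> R. ball x k y \<longrightarrow> In y a))"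
definition isclosed :: "'u \<Rightarrow> bool" where
  "isclosed a \<longleftrightarrow> isset a \<and> (\<exists>u \<in> Dom M (ty1 \<rightarrow> ty1). isopen u \<and> (\<forall>x \<in> R. In x a \<longleftrightarrow> \<not> In x u))"
definition isFs :: "'u \<Rightarrow> bool" where
  "isFs a \<longleftrightarrow> isset a \<and> (\<exists>f \<in> Dom M (Base \<rightarrow> ty1 \<rightarrow> ty1).
     (\<forall>n. isclosed (f \<bullet> num n)) \<and> (\<forall>x \<in> R. In x a \<longleftrightarrow> (\<exists>n. In x (f \<bullet> num n))))"
definition isGd :: "'u \<Rightarrow> bool" where
  "isGd a \<longleftrightarrow> isset a \<and> (\<exists>f \<in> Dom M (Base \<rightarrow> ty1 \<rightarrow> ty1).
     (\<forall>n. isopen (f \<bullet> num n)) \<and> (\<forall>x \<in> R. In x a \<longleftrightarrow> (\<forall>n. In x (f \<bullet> num n))))"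
definition limpt :: "'u \<Rightarrow> 'u \<Rightarrow> bool" where
  "limpt a x \<longleftrightarrow> (\<forall>k. \<exists>y \<in> R. ball x k y \<and> \<not> eqr y x \<and> In y a)"
definition isinj :: "'u \<Rightarrow> bool" where
  "isinj Y \<longleftrightarrow> (\<forall>x \<in> R. \<forall>y \<in> R. unit x \<and> unit y \<longrightarrow> (Y \<bullet> x = Y \<bullet> y \<longleftrightarrow> eqr x y))"

lemma R_typed [simp]: "x \<in> R \<Longrightarrow> x \<in> Dom M ty1"
  by (simp add: R_def)

context
  fixes \<rho> assumes env [simp]: "env M \<rho>"
begin

lemma sat_is_real [simp]:
  "wt x \<Longrightarrow> ty_of x = ty1 \<Longrightarrow> below d x \<Longrightarrow> sat M \<rho> (is_real x d) \<longleftrightarrow> val M \<rho> x \<in> R"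
  by (simp add: is_real_def R_def del: R_typed)

lemma sat_eqR [simp]:
  "wt x \<Longrightarrow> ty_of x = ty1 \<Longrightarrow> below d x \<Longrightarrow> wt y \<Longrightarrow> ty_of y = ty1 \<Longrightarrow> below d y \<Longrightarrow>
   sat M \<rho> ((x =\<^sub>R y) d) \<longleftrightarrow> eqr (val M \<rho> x) (val M \<rho> y)"
  by (simp add: eqR_def eqr_def)

lemma sat_lessR [simp]:
  "wt x \<Longrightarrow> ty_of x = ty1 \<Longrightarrow> below d x \<Longrightarrow> wt y \<Longrightarrow> ty_of y = ty1 \<Longrightarrow> below d y \<Longrightarrow>
   sat M \<rho> ((x <\<^sub>R y) d) \<longleftrightarrow> lessr (val M \<rho> x) (val M \<rho> y)"
  by (simp add: lessR_def lessr_def)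

lemma sat_leR [simp]:
  "wt x \<Longrightarrow> ty_of x = ty1 \<Longrightarrow> below d x \<Longrightarrow> wt y \<Longrightarrow> ty_of y = ty1 \<Longrightarrow> below d y \<Longrightarrow>
   sat M \<rho> ((x \<le>\<^sub>R y) d) \<longleftrightarrow> \<not> lessr (val M \<rho> y) (val M \<rho> x)"
  by (simp add: leR_def)

lemma rs_ratR [simp]: "wt q \<Longrightarrow> ty_of q = Base \<Longrightarrow> rs (val M \<rho> (ratR q)) n = qv (nv \<rho> q)"
  by (simp add: ratR_def rs_def del: qv_App)

lemma val_DIFF_ABS [simp]: "val M \<rho> DIFF = cl DIFF" "val M \<rho> ABS = cl ABS"
  "val M \<rho> zeroR = cl zeroR" "val M \<rho> oneR = cl oneR"
  by (simp_all add: val_cl)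

end

lemma rs_DIFF [simp]:
  assumes "x \<in> Dom M ty1" "y \<in> Dom M ty1"
  shows "rs (cl DIFF \<bullet> x \<bullet> y) n = rs x (n + 1) - rs y (n + 1)"
  using assms by (simp add: rs_def DIFF_def S_num del: qv_App)

lemma DIFF_typed [simp]: "x \<in> Dom M ty1 \<Longrightarrow> y \<in> Dom M ty1 \<Longrightarrow> cl DIFF \<bullet> x \<bullet> y \<in> Dom M ty1"
  by (rule Ap_typed[of _ ty1], rule Ap_typed[of _ ty1]) simp_all

lemma rs_ABS [simp]:
  assumes "x \<in> Dom M ty1"
  shows "rs (cl ABS \<bullet> x) n = \<bar>rs x n\<bar>"
  using assms by (simp add: rs_def ABS_def del: qv_App)

lemma sat_in_ball [simp]:
  "env M \<rho> \<Longrightarrow> wt x \<Longrightarrow> ty_of x = ty1 \<Longrightarrow> below d x \<Longrightarrow> wt y \<Longrightarrow> ty_of y = ty1 \<Longrightarrow> below d y \<Longrightarrow>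
   wt k \<Longrightarrow> ty_of k = Base \<Longrightarrow> below d k \<Longrightarrow>
   sat M \<rho> (in_ball x k y d) \<longleftrightarrow> ball (val M \<rho> x) (nv \<rho> k) (val M \<rho> y)"
  by (simp add: in_ball_def lessr_def ball_def)

lemma sat_in_unit [simp]:
  "env M \<rho> \<Longrightarrow> wt x \<Longrightarrow> ty_of x = ty1 \<Longrightarrow> below d x \<Longrightarrow> sat M \<rho> (in_unit x d) \<longleftrightarrow> unit (val M \<rho> x)"
  by (simp add: in_unit_def unit_def)

lemma sat_mem [simp]:
  "env M \<rho> \<Longrightarrow> wt x \<Longrightarrow> ty_of x = ty1 \<Longrightarrow> below d x \<Longrightarrow> wt A \<Longrightarrow> ty_of A = ty1 \<rightarrow> ty1 \<Longrightarrow> below d A \<Longrightarrow>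
   sat M \<rho> ((x \<in>\<^sub>R A) d) \<longleftrightarrow> In (val M \<rho> x) (val M \<rho> A)"
  by (simp add: mem_def In_def)

lemma sat_allR [simp]:
  "env M \<rho> \<Longrightarrow> sat M \<rho> (allR P d) \<longleftrightarrow> (\<forall>x \<in> R. sat M (\<rho>((d, ty1) := x)) (P (Var d ty1) (Suc d)))"
  "env M \<rho> \<Longrightarrow> sat M \<rho> (exR P d) \<longleftrightarrow> (\<exists>x \<in> R. sat M (\<rho>((d, ty1) := x)) (P (Var d ty1) (Suc d)))"
  by (auto simp: allR_def exR_def)

text \<open>The two congruence rules hand membership in the quantifier's range to the simplifier
  while it rewrites the body. The typing conditions of the evaluation rules are discharged from
  it.\<close>

context
  fixes \<rho> assumes env' [simp]: "env M \<rho>"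
  notes ball_cong_simp [cong] bex_cong_simp [cong]
begin

lemma sat_is_set [simp]:
  "wt A \<Longrightarrow> ty_of A = ty1 \<rightarrow> ty1 \<Longrightarrow> below d A \<Longrightarrow> sat M \<rho> (is_set A d) \<longleftrightarrow> isset (val M \<rho> A)"
  by (simp add: is_set_def isset_def)

end

context
  notes ball_cong_simp [cong] bex_cong_simp [cong]
begin

lemma sat_is_open [simp]:
  "env M \<rho> \<Longrightarrow> wt A \<Longrightarrow> ty_of A = ty1 \<rightarrow> ty1 \<Longrightarrow> below d A \<Longrightarrow> sat M \<rho> (is_open A d) \<longleftrightarrow> isopen (val M \<rho> A)"
  by (simp add: is_open_def isopen_def)

lemma sat_is_closed [simp]:
  "env M \<rho> \<Longrightarrow> wt A \<Longrightarrow> ty_of A = ty1 \<rightarrow> ty1 \<Longrightarrow> below d A \<Longrightarrow> sat M \<rho> (is_closed A d) \<longleftrightarrow> isclosed (val M \<rho> A)"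
  by (simp add: is_closed_def isclosed_def)

lemma sat_is_Fsigma [simp]:
  "env M \<rho> \<Longrightarrow> wt A \<Longrightarrow> ty_of A = ty1 \<rightarrow> ty1 \<Longrightarrow> below d A \<Longrightarrow> sat M \<rho> (is_Fsigma A d) \<longleftrightarrow> isFs (val M \<rho> A)"
  by (simp add: is_Fsigma_def isFs_def)

lemma sat_is_Gdelta [simp]:
  "env M \<rho> \<Longrightarrow> wt A \<Longrightarrow> ty_of A = ty1 \<rightarrow> ty1 \<Longrightarrow> below d A \<Longrightarrow> sat M \<rho> (is_Gdelta A d) \<longleftrightarrow> isGd (val M \<rho> A)"
  by (simp add: is_Gdelta_def isGd_def)

lemma sat_limit_point [simp]:
  "env M \<rho> \<Longrightarrow> wt A \<Longrightarrow> ty_of A = ty1 \<rightarrow> ty1 \<Longrightarrow> below d A \<Longrightarrow> wt x \<Longrightarrow> ty_of x = ty1 \<Longrightarrow> below d x \<Longrightarrow>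
   sat M \<rho> (limit_point A x d) \<longleftrightarrow> limpt (val M \<rho> A) (val M \<rho> x)"
  by (simp add: limit_point_def limpt_def)

lemma sat_Fsigma_closure:
  "sat M \<rho>0 Fsigma_closure \<longleftrightarrow> (\<forall>a \<in> Dom M (ty1 \<rightarrow> ty1). isFs a \<longrightarrow>
     (\<exists>c \<in> Dom M (ty1 \<rightarrow> ty1). isset c \<and> (\<forall>x \<in> R. In x c \<longleftrightarrow> In x a \<or> limpt a x)))"
  by (simp add: Fsigma_closure_def is_closure_def)

lemma sat_Gdelta_interior:
  "sat M \<rho>0 Gdelta_interior \<longleftrightarrow> (\<forall>a \<in> Dom M (ty1 \<rightarrow> ty1). isGd a \<longrightarrow>
     (\<exists>c \<in> Dom M (ty1 \<rightarrow> ty1). isset c \<and>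
       (\<forall>x \<in> R. In x c \<longleftrightarrow> In x a \<and> (\<exists>k. \<forall>y \<in> R. ball x k y \<longrightarrow> In y a))))"
  by (simp add: Gdelta_interior_def is_interior_def)

lemma sat_NIN: "sat M \<rho>0 NIN \<longleftrightarrow> \<not> (\<exists>Y \<in> Dom M ty2. isinj Y)"
proof -
  have "sat M \<rho>0 NIN \<longleftrightarrow> \<not> (\<exists>Y \<in> Dom M ty2.
    (\<forall>x \<in> R. \<forall>y \<in> R. unit x \<and> unit y \<longrightarrow> eqr x y \<longrightarrow> Y \<bullet> x = Y \<bullet> y) \<and>
    (\<forall>x \<in> R. \<forall>y \<in> R. unit x \<and> unit y \<longrightarrow> Y \<bullet> x = Y \<bullet> y \<longrightarrow> eqr x y))"
    by (simp add: NIN_def is_injection_def)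
  then show ?thesis unfolding isinj_def by blast
qed

end

subsection \<open>Convergence\<close>

text \<open>The field is Archimedean relative to the numbers of the model, which need not be
  standard. A positive denominator is at least 1 by discreteness, and a formal difference is below
  its first component plus 1.\<close>

lemma F_bounded: "\<exists>n :: 'n. q < emb n"
proof -
  have "\<exists>a b. q = Fract a b \<and> 0 < b" by (induction q rule: fract_induct_pos) blast
  then obtain a b :: "'n difference" where q: "q = Fract a b" "0 < b" by blast
  have disc: "1 \<le> b" if "0 < b" for b :: "'n difference"
    using that unfolding less_le_not_le
    by transfer (simp add: not_le n_less_iff add.commute)
  have upper: "\<exists>n :: 'n. a < dif n" for a :: "'n difference"
    unfolding less_le_not_le
  proof transfer
    fix a :: "'n \<times> 'n"
    show "\<exists>n. fst a + snd (n, 0) \<le> fst (n, 0) + snd a \<and> \<not> fst (n, 0) + snd a \<le> fst a + snd (n, 0)"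
      by (rule exI[of _ "fst a + 1"])
        (simp add: not_le add_increasing2 add_strict_increasing add.assoc)
  qed
  then obtain n :: 'n where n: "\<bar>a\<bar> < dif n" by blast
  have "a \<le> \<bar>a\<bar> * b" using disc[OF q(2)] by (smt (verit) abs_ge_self abs_ge_zero dual_order.trans mult_cancel_left1 mult_left_mono)
  also have "\<dots> < dif n * b" using n q(2) by simp
  finally have "a * b < dif n * b * b" using q(2) by (rule mult_strict_right_mono)
  moreover have "b \<noteq> 0" using q(2) by simp
  ultimately have "q < emb n" by (simp add: q emb_def)
  then show ?thesis ..
qed

lemma less_pw: "n < pw n"
proof (rule n_induct[where \<rho> = \<rho>0 and i = 0 and \<phi> = "EqN (Succ \<cdot> vn 0 \<ominus> POW2 \<cdot> vn 0) Zero" and P = "\<lambda>n. n < pw n"])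
  fix n assume "n < pw n"
  then have "n + 1 < pw n + pw n" by (intro add_less_le_mono) (simp_all add: n_less_iff[symmetric] flip: n_less_iff[of 0, simplified])
  then show "n + 1 < pw (n + 1)" by simp
qed (simp_all add: nu_inject[symmetric] cl_fun_typed n_less_iff)

lemma pw_mono: "m \<le> n \<Longrightarrow> pw m \<le> pw n"
proof -
  have "pw m \<le> pw (m + c)" for c
  proof (rule n_induct[where \<rho> = "\<rho>0((1, Base) := num m)" and i = 0 and
        \<phi> = "EqN (POW2 \<cdot> vn 1 \<ominus> POW2 \<cdot> (vn 1 \<oplus> vn 0)) Zero" and P = "\<lambda>c. pw m \<le> pw (m + c)"])
    show "pw m \<le> pw (m + (c + 1))" if "pw m \<le> pw (m + c)" for c
      using that pw_rec(2)[of "m + c"] by (simp add: add.assoc add_increasing2)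
  qed (simp_all add: nu_inject[symmetric] cl_fun_typed)
  then show "m \<le> n \<Longrightarrow> pw m \<le> pw n" by (metis le_add_diff_inverse)
qed

lemma e_mono: "m \<le> n \<Longrightarrow> e n \<le> e m"
  using pw_mono by (simp add: e_def frac_le)

lemma e_small: "0 < \<epsilon> \<Longrightarrow> \<exists>n. e n < \<epsilon>"
proof -
  assume "0 < \<epsilon>"
  obtain n where "1 / \<epsilon> < emb n" using F_bounded by blast
  also have "emb n < emb (pw n)" by (simp add: less_pw)
  finally have "e n < \<epsilon>" using \<open>0 < \<epsilon>\<close> by (simp add: e_def field_simps)
  then show ?thesis ..
qed

lemma ev_e: "0 < \<epsilon> \<Longrightarrow> \<forall>\<^sub>F n in at_top. e n < \<epsilon>"
proof -
  assume "0 < \<epsilon>"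
  then obtain n where "e n < \<epsilon>" using e_small by blast
  then have "\<forall>m\<ge>n. e m < \<epsilon>" using e_mono by (auto intro: le_less_trans)
  then show ?thesis unfolding eventually_at_top_linorder by (rule exI)
qed

lemma ev_shift: "(\<forall>\<^sub>F n in at_top. P (n + c)) \<longleftrightarrow> (\<forall>\<^sub>F n :: 'n in at_top. P n)"
  unfolding eventually_at_top_linorder
proof
  assume "\<exists>m. \<forall>n\<ge>m. P (n + c)"
  then obtain m where m: "\<forall>n\<ge>m. P (n + c)" by blast
  have "P n" if "n \<ge> m + c" for n
  proof -
    have "n - c + c = n" using that by (metis add_increasing le_add_diff_inverse2 n_ge_0 order.trans order_refl)
    moreover have "m \<le> n - c" using that calculation by (metis add_le_cancel_right)
    ultimately show ?thesis using m by metis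
  qed
  then show "\<exists>m. \<forall>n\<ge>m. P n" by blast
next
  assume "\<exists>m. \<forall>n\<ge>m. P n"
  then show "\<exists>m. \<forall>n\<ge>m. P (n + c)" by (meson add_increasing2 n_ge_0)
qed

text \<open>Equality and order of reals are restated by what happens eventually along the numbers of
  the model. This replaces the bookkeeping of precisions; \<open>eqr_iff\<close> and
  \<open>lessr_iff\<close> make the link.\<close>

definition conv :: "('n \<Rightarrow> 'n difference fract) \<Rightarrow> ('n \<Rightarrow> 'n difference fract) \<Rightarrow> bool" (infix \<open>\<approx>\<close> 50) where
  "f \<approx> g \<longleftrightarrow> (\<forall>\<epsilon>>0. \<forall>\<^sub>F n in at_top. \<bar>f n - g n\<bar> < \<epsilon>)"
definition sep :: "('n \<Rightarrow> 'n difference fract) \<Rightarrow> ('n \<Rightarrow> 'n difference fract) \<Rightarrow> bool" (infix \<open>\<prec>\<close> 50) where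
  "f \<prec> g \<longleftrightarrow> (\<exists>\<epsilon>>0. \<forall>\<^sub>F n in at_top. f n + \<epsilon> \<le> g n)"

lemma R_tail: "x \<in> R \<Longrightarrow> n \<le> m \<Longrightarrow> \<bar>rs x n - rs x m\<bar> < e n"
  unfolding R_def by (metis (mono_tags, lifting) le_add_diff_inverse mem_Collect_eq)

text \<open>For the return direction index n is compared with a far index m. Each sequence moves by
  less than \<open>e n\<close> between them, and at m the two differ by less than an arbitrary
  \<delta>.\<close>

lemma eqr_iff:
  assumes "x \<in> R" "y \<in> R"
  shows "eqr x y \<longleftrightarrow> rs x \<approx> rs y"
proof
  assume *: "eqr x y"
  show "rs x \<approx> rs y" unfolding conv_def
  proof (intro allI impI)
    fix \<epsilon> :: "'n difference fract" assume "0 < \<epsilon>"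
    then have "\<forall>\<^sub>F n in at_top. e n < \<epsilon> / 2" by (intro ev_e) simp
    then show "\<forall>\<^sub>F n in at_top. \<bar>rs x n - rs y n\<bar> < \<epsilon>"
    proof (rule eventually_mono)
      fix n assume "e n < \<epsilon> / 2"
      then show "\<bar>rs x n - rs y n\<bar> < \<epsilon>" using *[unfolded eqr_def, rule_format, of n] by simp
    qed
  qed
next
  assume *: "rs x \<approx> rs y"
  show "eqr x y" unfolding eqr_def
  proof (intro allI, rule field_le_epsilon)
    fix n and \<delta> :: "'n difference fract" assume "0 < \<delta>"
    then have "\<forall>\<^sub>F m in at_top. \<bar>rs x m - rs y m\<bar> < \<delta> \<and> n \<le> m"
      using * by (simp add: conv_def eventually_conj eventually_ge_at_top)
    then obtain m where "\<bar>rs x m - rs y m\<bar> < \<delta>" "n \<le> m"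
      using eventually_happens[of _ at_top] by force
    then show "\<bar>rs x n - rs y n\<bar> \<le> 2 * e n + \<delta>"
      using R_tail[OF assms(1), of n m] R_tail[OF assms(2), of n m] by linarith
  qed
qed

text \<open>The excess over \<open>2 * e n\<close> at one index survives at all later ones, because
  each of the two sequences moves by less than \<open>e n\<close>.\<close>

lemma lessr_iff:
  assumes "x \<in> R" "y \<in> R"
  shows "lessr x y \<longleftrightarrow> rs x \<prec> rs y"
proof
  assume "lessr x y"
  then obtain n where n: "rs x n + 2 * e n < rs y n" by (auto simp: lessr_def)
  have "\<forall>\<^sub>F m in at_top. rs x m + (rs y n - rs x n - 2 * e n) \<le> rs y m"
    unfolding eventually_at_top_linorder
  proof (intro exI[of _ n] allI impI)
    fix m assume "n \<le> m"
    then show "rs x m + (rs y n - rs x n - 2 * e n) \<le> rs y m"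
      using R_tail[OF assms(1), of n m] R_tail[OF assms(2), of n m] by linarith
  qed
  then show "rs x \<prec> rs y" using n unfolding sep_def by (intro exI[of _ "rs y n - rs x n - 2 * e n"]) simp
next
  assume "rs x \<prec> rs y"
  then obtain \<epsilon> where \<epsilon>: "0 < \<epsilon>" "\<forall>\<^sub>F n in at_top. rs x n + \<epsilon> \<le> rs y n" by (auto simp: sep_def)
  then have "\<forall>\<^sub>F n in at_top. rs x n + \<epsilon> \<le> rs y n \<and> e n < \<epsilon> / 2"
    by (intro eventually_conj ev_e) simp_all
  then obtain n where "rs x n + \<epsilon> \<le> rs y n" "e n < \<epsilon> / 2"
    using eventually_happens[of _ at_top] by force
  then show "lessr x y" unfolding lessr_def by (intro exI[of _ n]) simp
qed

end


section \<open>Arithmetical comprehension\<close>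

primrec arith_fm :: "fm \<Rightarrow> bool" where
  "arith_fm (EqN s t) = True"
| "arith_fm Falsum = True"
| "arith_fm (Imp \<phi> \<psi>) = (arith_fm \<phi> \<and> arith_fm \<psi>)"
| "arith_fm (Forall n \<sigma> \<phi>) = (\<sigma> = Base \<and> arith_fm \<phi>)"

lemma arith_form [simp]:
  "arith_fm ((s \<^bold>= t) d)" "arith_fm ((\<^bold>\<not> A) d) \<longleftrightarrow> arith_fm (A d)"
  "arith_fm ((A \<^bold>\<and> B) d) \<longleftrightarrow> arith_fm (A d) \<and> arith_fm (B d)"
  "arith_fm ((A \<^bold>\<or> B) d) \<longleftrightarrow> arith_fm (A d) \<and> arith_fm (B d)"
  "arith_fm ((A \<^bold>\<longrightarrow> B) d) \<longleftrightarrow> arith_fm (A d) \<and> arith_fm (B d)"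
  "arith_fm (all \<sigma> P d) \<longleftrightarrow> \<sigma> = Base \<and> arith_fm (P (Var d \<sigma>) (Suc d))"
  "arith_fm (ex \<sigma> P d) \<longleftrightarrow> \<sigma> = Base \<and> arith_fm (P (Var d \<sigma>) (Suc d))"
  "arith_fm ((s <\<^sub>Q t) d)" "arith_fm ((s \<le>\<^sub>Q t) d)"
  by (simp_all add: eq0_def fnot_def fand_def fdisj_def fimp_def all_def ex_def Neg_def
      Conj_def Disj_def Exists_def qless_def qle_def less0_def le0_def)

lemma arith_real [simp]:
  "arith_fm (is_real x d)" "arith_fm ((x <\<^sub>R y) d)" "arith_fm ((x \<le>\<^sub>R y) d)" "arith_fm (in_unit x d)"
  "arith_fm ((x \<in>\<^sub>R A) d)"
  by (simp_all add: is_real_def lessR_def leR_def in_unit_def mem_def)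

text \<open>The variable \<open>(0, ty2)\<close> stands for a functional as in \<open>Exists2\<close>; the term is zero iff the
  formula holds.\<close>
primrec CH :: "fm \<Rightarrow> tm" where
  "CH (EqN s t) = (s \<ominus> t) \<oplus> (t \<ominus> s)"
| "CH Falsum = one"
| "CH (Imp \<phi> \<psi>) = (one \<ominus> CH \<phi>) \<otimes> CH \<psi>"
| "CH (Forall n \<sigma> \<phi>) = one \<ominus> Var 0 ty2 \<cdot> lam n Base (one \<ominus> CH \<phi>)"

lemma CH_typed [simp]: "wff \<phi> \<Longrightarrow> wt (CH \<phi>)" "wff \<phi> \<Longrightarrow> ty_of (CH \<phi>) = Base"
proof -
  have "wff \<phi> \<Longrightarrow> wt (CH \<phi>) \<and> ty_of (CH \<phi>) = Base"
    by (induction \<phi>) auto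
  then show "wff \<phi> \<Longrightarrow> wt (CH \<phi>)" "wff \<phi> \<Longrightarrow> ty_of (CH \<phi>) = Base" by auto
qed

lemma fv_CH: "arith_fm \<phi> \<Longrightarrow> fv_tm (CH \<phi>) \<subseteq> insert (0, ty2) (fv \<phi>)"
  by (induction \<phi>) auto

definition SETOF :: tm where
  "SETOF = lam 0 ty2 (lam 1 ty1 (lam0 2
     (Rc \<cdot> (Var 0 ty2 \<cdot> Var 1 ty1) \<cdot> dyad one Zero \<cdot> lam0 3 (lam0 4 (dyad Zero Zero)))))"

definition COMPL :: tm where
  "COMPL = lam 0 ty2 (lam 1 ty1 (one \<ominus> Var 0 ty2 \<cdot> Var 1 ty1))"

text \<open>\<open>TT n k\<close> maps a real \<open>y\<close> to \<open>2 ^ (k + 2) * (y - n) - 1\<close>, and \<open>UU n k\<close> is the inverse map.\<close>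
definition TT :: tm where
  "TT = (let K = vn 1 \<oplus> two; q = Var 2 ty1 \<cdot> (vn 3 \<oplus> K); P = POW2 \<cdot> K in
     lam0 0 (lam0 1 (lam 2 ty1 (lam0 3
       (qcode (P \<otimes> qpos q) (P \<otimes> (qneg q \<oplus> vn 0 \<otimes> qden q) \<oplus> qden q) (psnd q))))))"

definition UU :: tm where
  "UU = (let q = Var 2 ty1 \<cdot> vn 3; P = POW2 \<cdot> (vn 1 \<oplus> two) in
     lam0 0 (lam0 1 (lam 2 ty1 (lam0 3
       (qcode (vn 0 \<otimes> (P \<otimes> qden q) \<oplus> qpos q \<oplus> qden q) (qneg q) (PRED \<cdot> (P \<otimes> qden q)))))))"

definition RN :: tm where "RN = lam0 0 (ratR (dyad (vn 0) Zero))"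

lemma fun_tm_typed [simp]:
  "wt SETOF" "ty_of SETOF = ty2 \<rightarrow> ty1 \<rightarrow> ty1" "fv_tm SETOF = {}"
  "wt COMPL" "ty_of COMPL = ty2 \<rightarrow> ty2" "fv_tm COMPL = {}"
  "wt TT" "ty_of TT = Base \<rightarrow> Base \<rightarrow> ty1 \<rightarrow> ty1" "fv_tm TT = {}"
  "wt UU" "ty_of UU = Base \<rightarrow> Base \<rightarrow> ty1 \<rightarrow> ty1" "fv_tm UU = {}"
  "wt RN" "ty_of RN = Base \<rightarrow> ty1" "fv_tm RN = {}"
  by (auto simp: SETOF_def COMPL_def TT_def UU_def RN_def Let_def)

lemma below_fun_tm [simp]: "below d SETOF" "below d COMPL" "below d TT" "below d UU" "below d RN"
  by (simp_all add: below_closed)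

locale aca_model = typed_model M num for M :: "'u interp" and num :: "'n::linordered_semidom \<Rightarrow> 'u" +
  assumes ACA: "\<phi> \<in> ACA0\<omega> \<union> QF_AC Base ty1 \<Longrightarrow> wff \<phi> \<Longrightarrow> valid M \<phi>"
begin

lemma val_fun_tm [simp]:
  "val M \<rho> SETOF = cl SETOF" "val M \<rho> COMPL = cl COMPL" "val M \<rho> TT = cl TT" "val M \<rho> UU = cl UU"
  "val M \<rho> RN = cl RN"
  by (simp_all add: val_cl)

definition Ex :: 'u where
  "Ex = (SOME E. E \<in> Dom M ty2 \<and> (\<forall>f \<in> Dom M ty1. (E \<bullet> f = Z \<or> E \<bullet> f = S Z) \<and>
     (E \<bullet> f = Z \<longleftrightarrow> (\<exists>n. f \<bullet> num n = Z))))"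

lemma Ex:
  "Ex \<in> Dom M ty2" "f \<in> Dom M ty1 \<Longrightarrow> nu (Ex \<bullet> f) = (if \<exists>n. nu (f \<bullet> num n) = 0 then 0 else 1)"
proof -
  have "valid M Exists2" by (rule ACA) (simp_all add: ACA0\<omega>_def Exists2_def)
  then have "sat M \<rho>0 Exists2" by (simp add: valid_def)
  then have "\<exists>E. E \<in> Dom M ty2 \<and> (\<forall>f \<in> Dom M ty1. (E \<bullet> f = Z \<or> E \<bullet> f = S Z) \<and>
     (E \<bullet> f = Z \<longleftrightarrow> (\<exists>n. f \<bullet> num n = Z)))"
    by (simp add: Exists2_def) blast
  from someI_ex[OF this, folded Ex_def]
  have Ex: "Ex \<in> Dom M ty2" "\<forall>f \<in> Dom M ty1. (Ex \<bullet> f = Z \<or> Ex \<bullet> f = S Z) \<and>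
     (Ex \<bullet> f = Z \<longleftrightarrow> (\<exists>n. f \<bullet> num n = Z))" by blast+
  then show "Ex \<in> Dom M ty2" by blast
  assume f: "f \<in> Dom M ty1"
  have "f \<bullet> num n = Z \<longleftrightarrow> nu (f \<bullet> num n) = 0" for n
    using nu_inject[of "f \<bullet> num n" Z] f Ap_typed[of f Base Base "num n"] by simp
  then show "nu (Ex \<bullet> f) = (if \<exists>n. nu (f \<bullet> num n) = 0 then 0 else 1)"
    using Ex f by (cases "Ex \<bullet> f = Z") auto
qed

lemma one_minus_eq_0: "1 - n = 0 \<longleftrightarrow> n \<noteq> (0 :: 'n)"
proof -
  have "1 - n = 0 \<longleftrightarrow> 0 < n" unfolding n_le_diff using n_less_iff[of 0 n] by simp
  then show ?thesis using n_ge_0[of n] by (metis less_le)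
qed

text \<open>In the quantifier case \<open>Ex\<close> looks for a zero of one minus the decision
  term, that is, for a counterexample. Finding one gives the answer 0, which the outer subtraction
  turns into 1.\<close>

lemma CH:
  "env M \<rho> \<Longrightarrow> \<rho> (0, ty2) = Ex \<Longrightarrow> wff \<phi> \<Longrightarrow> arith_fm \<phi> \<Longrightarrow> nv \<rho> (CH \<phi>) = 0 \<longleftrightarrow> sat M \<rho> \<phi>"
proof (induction \<phi> arbitrary: \<rho>)
  case (EqN s t)
  then have "nv \<rho> (CH (EqN s t)) = 0 \<longleftrightarrow> nv \<rho> s \<le> nv \<rho> t \<and> nv \<rho> t \<le> nv \<rho> s"
    by (simp add: add_nonneg_eq_0_iff)
  also have "\<dots> \<longleftrightarrow> nv \<rho> s = nv \<rho> t" by auto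
  finally show ?case using EqN by (simp add: nu_inject)
next
  case (Imp \<phi> \<psi>)
  then have "nv \<rho> (CH (Imp \<phi> \<psi>)) = (1 - nv \<rho> (CH \<phi>)) * nv \<rho> (CH \<psi>)" by simp
  then show ?case using Imp by (simp add: one_minus_eq_0 del: n_le_diff)
next
  case (Forall n \<sigma> \<phi>)
  define f where "f = val M \<rho> (lam n Base (one \<ominus> CH \<phi>))"
  have f: "f \<in> Dom M ty1" using Forall.prems by (simp add: f_def)
  have "nu (f \<bullet> num m) = 0 \<longleftrightarrow> \<not> sat M (\<rho>((n, Base) := num m)) \<phi>" for m
  proof -
    have "nu (f \<bullet> num m) = 0 \<longleftrightarrow> nv (\<rho>((n, Base) := num m)) (CH \<phi>) \<noteq> 0"
      using Forall.prems by (simp add: f_def one_minus_eq_0 del: n_le_diff)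
    also have "nv (\<rho>((n, Base) := num m)) (CH \<phi>) = 0 \<longleftrightarrow> sat M (\<rho>((n, Base) := num m)) \<phi>"
      using Forall.prems by (intro Forall.IH env_upd num_N) simp_all
    finally show ?thesis .
  qed
  moreover have "nv \<rho> (CH (Forall n \<sigma> \<phi>)) = 1 - nu (Ex \<bullet> f)"
    using Forall.prems f Ex(1) by (simp add: f_def)
  ultimately show ?case using Forall.prems Ex(2)[OF f] by simp
qed simp

text \<open>Association lists let the simplifier look up variables, the head of the list being the
  latest update. The reserved variable \<open>(0, ty2)\<close> holds \<open>Ex\<close> by
  default.\<close>

definition env_of :: "((nat \<times> ty) \<times> 'u) list \<Rightarrow> nat \<times> ty \<Rightarrow> 'u" where
  "env_of xs = foldr (\<lambda>(x, a) \<rho>. \<rho>(x := a)) xs (\<rho>0((0, ty2) := Ex))"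

lemma env_of [simp]:
  "env M (env_of [])" "env_of [] (0, ty2) = Ex"
  "env_of ((x, a) # xs) y = (if y = x then a else env_of xs y)"
  "env M (env_of xs) \<Longrightarrow> a \<in> Dom M \<sigma> \<Longrightarrow> env M (env_of (((n, \<sigma>), a) # xs))"
  by (simp_all add: env_of_def Ex(1))

lemma env_of_upd [simp]: "(env_of xs)(x := a) = env_of ((x, a) # xs)"
  by (simp add: env_of_def)

text \<open>The functional is the abstraction of the decision term of \<phi>. Parameters of any type
  enter through the environment; the reserved variable may be neither overwritten nor
  abstracted.\<close>

lemma comprehension:
  assumes "env M (env_of xs)" "env_of xs (0, ty2) = Ex" "wff \<phi>" "arith_fm \<phi>" "(i, \<sigma>) \<noteq> (0, ty2)"
  obtains \<chi> where "\<chi> \<in> Dom M (\<sigma> \<rightarrow> Base)"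
    "\<And>a. a \<in> Dom M \<sigma> \<Longrightarrow> \<chi> \<bullet> a = Z \<longleftrightarrow> sat M (env_of (((i, \<sigma>), a) # xs)) \<phi>"
proof
  let ?\<chi> = "val M (env_of xs) (lam i \<sigma> (CH \<phi>))"
  show "?\<chi> \<in> Dom M (\<sigma> \<rightarrow> Base)" using assms by simp
  fix a assume a: "a \<in> Dom M \<sigma>"
  then have "nv (env_of (((i, \<sigma>), a) # xs)) (CH \<phi>) = 0 \<longleftrightarrow> sat M (env_of (((i, \<sigma>), a) # xs)) \<phi>"
    using assms by (intro CH) auto
  then show "?\<chi> \<bullet> a = Z \<longleftrightarrow> sat M (env_of (((i, \<sigma>), a) # xs)) \<phi>"
    using assms a nu_inject[of "val M (env_of (((i, \<sigma>), a) # xs)) (CH \<phi>)" Z] by simp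
qed

lemma comprehension2:
  assumes "env M (env_of xs)" "env_of xs (0, ty2) = Ex" "wff \<phi>" "arith_fm \<phi>"
    "(i, \<sigma>) \<noteq> (0, ty2)" "(j, \<tau>) \<noteq> (0, ty2)"
  obtains \<chi> where "\<chi> \<in> Dom M (\<sigma> \<rightarrow> \<tau> \<rightarrow> Base)"
    "\<And>a b. a \<in> Dom M \<sigma> \<Longrightarrow> b \<in> Dom M \<tau> \<Longrightarrow>
       \<chi> \<bullet> a \<bullet> b = Z \<longleftrightarrow> sat M (env_of (((j, \<tau>), b) # ((i, \<sigma>), a) # xs)) \<phi>"
proof
  let ?\<chi> = "val M (env_of xs) (lam i \<sigma> (lam j \<tau> (CH \<phi>)))"
  show "?\<chi> \<in> Dom M (\<sigma> \<rightarrow> \<tau> \<rightarrow> Base)" using assms by simp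
  fix a b assume ab: "a \<in> Dom M \<sigma>" "b \<in> Dom M \<tau>"
  let ?\<rho> = "env_of (((j, \<tau>), b) # ((i, \<sigma>), a) # xs)"
  have "nv ?\<rho> (CH \<phi>) = 0 \<longleftrightarrow> sat M ?\<rho> \<phi>"
    using assms ab by (intro CH) auto
  then show "?\<chi> \<bullet> a \<bullet> b = Z \<longleftrightarrow> sat M ?\<rho> \<phi>"
    using assms ab nu_inject[of "val M ?\<rho> (CH \<phi>)" Z] by simp
qed

text \<open>Comprehension can pack an arithmetical condition into a single equation with parameter
  P, which brings it within reach of quantifier-free choice.\<close>

lemma choice:
  assumes P: "P \<in> Dom M (Base \<rightarrow> ty2)" and ex: "\<And>n. \<exists>f \<in> Dom M ty1. P \<bullet> num n \<bullet> f = Z"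
  obtains g where "g \<in> Dom M (Base \<rightarrow> ty1)" "\<And>n. P \<bullet> num n \<bullet> (g \<bullet> num n) = Z"
proof -
  let ?A = "EqN (Var 0 (Base \<rightarrow> ty2) \<cdot> vn 0 \<cdot> Var 1 ty1) Zero"
  let ?\<phi> = "Imp (Forall 0 Base (Exists 1 ty1 ?A)) (Exists 2 (Base \<rightarrow> ty1)
      (Forall 0 Base (subst (1, ty1) (Var 2 (Base \<rightarrow> ty1) \<cdot> Var 0 Base) ?A)))"
  have "?\<phi> \<in> QF_AC Base ty1" unfolding QF_AC_def
    by (rule CollectI, intro exI[of _ 0] exI[of _ 1] exI[of _ 2] exI[of _ ?A]) auto
  then have "valid M ?\<phi>" by (intro ACA) simp_all
  moreover have "env M (\<rho>0((0, Base \<rightarrow> ty2) := P))" using P by simp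
  ultimately have "sat M (\<rho>0((0, Base \<rightarrow> ty2) := P)) ?\<phi>" unfolding valid_def by blast
  then show thesis using ex that by auto
qed

section \<open>Sets given by functionals\<close>

text \<open>Since \<open>eqr\<close> is symmetric, this implication makes vanishing of \<chi>
  invariant under equality of reals: the zeros of \<chi> form a set of reals.\<close>

definition resp :: "'u \<Rightarrow> bool" where
  "resp \<chi> \<longleftrightarrow> \<chi> \<in> Dom M ty2 \<and> (\<forall>x \<in> R. \<forall>y \<in> R. eqr x y \<longrightarrow> \<chi> \<bullet> x = Z \<longrightarrow> \<chi> \<bullet> y = Z)"

lemma rs_const [simp]: "rs (cl zeroR) n = 0" "rs (cl oneR) n = 1"
  using rs_ratR[of \<rho>0 "dyad Zero Zero" n] rs_ratR[of \<rho>0 "dyad one Zero" n] by simp_all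

lemma const_R [simp]: "cl zeroR \<in> R" "cl oneR \<in> R"
  by (simp_all add: R_def del: R_typed)

lemma rs_SETOF [simp]:
  assumes "\<chi> \<in> Dom M ty2" "x \<in> Dom M ty1"
  shows "rs (cl SETOF \<bullet> \<chi> \<bullet> x) n = (if \<chi> \<bullet> x = Z then 1 else 0)"
proof -
  have "\<chi> \<bullet> x \<in> N" using assms by simp
  then consider "\<chi> \<bullet> x = Z" | m where "m \<in> N" "\<chi> \<bullet> x = S m" using N_cases by blast
  then show ?thesis
    by cases (use assms in \<open>simp_all add: rs_def SETOF_def del: qv_App\<close>)
qed

lemma SETOF_typed [simp]: "\<chi> \<in> Dom M ty2 \<Longrightarrow> cl SETOF \<bullet> \<chi> \<in> Dom M (ty1 \<rightarrow> ty1)"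
  by (rule Ap_typed[of _ ty2]) simp_all

lemma COMPL_typed [simp]: "\<chi> \<in> Dom M ty2 \<Longrightarrow> cl COMPL \<bullet> \<chi> \<in> Dom M ty2"
  by (rule Ap_typed[of _ ty2]) simp_all

lemma COMPL [simp]: "\<chi> \<in> Dom M ty2 \<Longrightarrow> x \<in> Dom M ty1 \<Longrightarrow> cl COMPL \<bullet> \<chi> \<bullet> x = Z \<longleftrightarrow> \<chi> \<bullet> x \<noteq> Z"
  using nu_inject[of "cl COMPL \<bullet> \<chi> \<bullet> x" Z] nu_inject[of "\<chi> \<bullet> x" Z] Ap_typed[of "cl COMPL \<bullet> \<chi>" ty1 Base x]
  by (simp add: COMPL_def one_minus_eq_0 del: n_le_diff)

lemma e_not_neg [simp]: "\<not> e n < 0"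
  by (simp add: not_less)

lemma In_SETOF [simp]:
  assumes "\<chi> \<in> Dom M ty2" "x \<in> R"
  shows "In x (cl SETOF \<bullet> \<chi>) \<longleftrightarrow> \<chi> \<bullet> x = Z"
proof -
  \<comment> \<open>The real 1 is recognized as positive at any index where \<open>2 * e n\<close>
    is below 1.\<close>
  obtain n where "e n < 1 / 2" using e_small[of "1 / 2"] by auto
  then show ?thesis using assms by (auto simp: In_def lessr_def intro!: exI[of _ n])
qed

lemma isset_SETOF: "resp \<chi> \<Longrightarrow> isset (cl SETOF \<bullet> \<chi>)"
proof -
  assume *: "resp \<chi>"
  then have \<chi>: "\<chi> \<in> Dom M ty2" by (simp add: resp_def)
  have eq: "\<chi> \<bullet> x = Z \<longleftrightarrow> \<chi> \<bullet> y = Z" if "x \<in> R" "y \<in> R" "eqr x y" for x y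
  proof -
    have "eqr y x" using that by (simp add: eqr_def abs_minus_commute)
    then show ?thesis using * that unfolding resp_def by blast
  qed
  have "cl SETOF \<bullet> \<chi> \<bullet> x \<in> R \<and> \<not> lessr (cl SETOF \<bullet> \<chi> \<bullet> x) (cl zeroR)" if "x \<in> R" for x
  proof -
    have "cl SETOF \<bullet> \<chi> \<bullet> x \<in> Dom M ty1" using \<chi> that by (intro Ap_typed[of _ ty1 ty1 x]) simp_all
    then show ?thesis using \<chi> that by (auto simp: R_def[of] lessr_def not_less add_nonneg_nonneg simp del: R_typed dest: R_typed)
  qed
  moreover have "eqr (cl SETOF \<bullet> \<chi> \<bullet> x) (cl SETOF \<bullet> \<chi> \<bullet> y)" if "x \<in> R" "y \<in> R" "eqr x y" for x y
    using eq[OF that] that \<chi> by (simp add: eqr_def)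
  ultimately show ?thesis by (simp add: isset_def)
qed

lemma resp_COMPL: "resp \<chi> \<Longrightarrow> resp (cl COMPL \<bullet> \<chi>)"
proof -
  assume *: "resp \<chi>"
  then have \<chi>: "\<chi> \<in> Dom M ty2" by (simp add: resp_def)
  have "\<chi> \<bullet> y \<noteq> Z" if "x \<in> R" "y \<in> R" "eqr x y" "\<chi> \<bullet> x \<noteq> Z" for x y
  proof -
    have "eqr y x" using that by (simp add: eqr_def abs_minus_commute)
    then show ?thesis using * that unfolding resp_def by blast
  qed
  then show ?thesis using \<chi> unfolding resp_def by (auto dest: R_typed)
qed

lemma ball_less: "x \<in> R \<Longrightarrow> y \<in> R \<Longrightarrow> ball x k y \<Longrightarrow> \<forall>\<^sub>F m in at_top. \<bar>rs x m - rs y m\<bar> < e k"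
proof -
  assume R: "x \<in> R" "y \<in> R" and "ball x k y"
  then obtain n where n: "\<bar>rs x (n + 1) - rs y (n + 1)\<bar> + 2 * e n < e k" by (auto simp: ball_def)
  have "e (n + 1) \<le> e n" by (rule e_mono) simp
  then have "\<bar>rs x m - rs y m\<bar> < e k" if "n + 1 \<le> m" for m
    using R_tail[OF R(1) that] R_tail[OF R(2) that] n by linarith
  then show ?thesis unfolding eventually_at_top_linorder by blast
qed

text \<open>The slack \<epsilon> absorbs the summand \<open>2 * e m\<close> in \<open>ball\<close>,
  and \<open>ev_shift\<close> absorbs its shifted index.\<close>

lemma ballI:
  assumes "0 < \<epsilon>" "\<forall>\<^sub>F m in at_top. \<bar>rs x m - rs y m\<bar> + \<epsilon> \<le> e k"
  shows "ball x k y"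
proof -
  have "\<forall>\<^sub>F m in at_top. \<bar>rs x (m + 1) - rs y (m + 1)\<bar> + \<epsilon> \<le> e k"
    using assms(2) ev_shift[of "\<lambda>m. \<bar>rs x m - rs y m\<bar> + \<epsilon> \<le> e k" 1] by simp
  moreover have "\<forall>\<^sub>F m in at_top. e m < \<epsilon> / 2" using assms(1) by (intro ev_e) simp
  ultimately have "\<forall>\<^sub>F m in at_top. \<bar>rs x (m + 1) - rs y (m + 1)\<bar> + 2 * e m < e k"
    by eventually_elim simp
  then show ?thesis unfolding ball_def using eventually_happens[of _ at_top] by force
qed

lemma ball_refl: "ball x k x"
  by (rule ballI[of "e k"]) simp_all

text \<open>If x and p differ at index n by \<delta> more than allowed, take the radius below
  \<delta> / 2. A point y of the ball equal to p would bring x and p closer together than their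
  approximations at n permit.\<close>

lemma sep_ball:
  assumes "x \<in> R" "p \<in> R" "\<not> eqr x p"
  shows "\<exists>k. \<forall>y \<in> R. ball x k y \<longrightarrow> \<not> eqr y p"
proof -
  obtain n where n: "2 * e n < \<bar>rs x n - rs p n\<bar>" using assms by (auto simp: eqr_def not_le)
  define \<delta> where "\<delta> = \<bar>rs x n - rs p n\<bar> - 2 * e n"
  have "0 < \<delta> / 2" using n by (simp add: \<delta>_def)
  then obtain k where k: "e k < \<delta> / 2" using e_small by blast
  have "\<not> eqr y p" if y: "y \<in> R" "ball x k y" for y
  proof
    assume "eqr y p"
    then have "rs y \<approx> rs p" using y assms eqr_iff by blast
    then have "\<forall>\<^sub>F m in at_top. \<bar>rs y m - rs p m\<bar> < \<delta> / 2"
      using \<open>0 < \<delta> / 2\<close> unfolding conv_def by blast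
    moreover have "\<forall>\<^sub>F m in at_top. \<bar>rs x m - rs y m\<bar> < e k" using y assms by (intro ball_less)
    moreover have "\<forall>\<^sub>F m in at_top. n \<le> m" by (rule eventually_ge_at_top)
    ultimately have "\<forall>\<^sub>F m in at_top. \<bar>rs y m - rs p m\<bar> < \<delta> / 2 \<and> \<bar>rs x m - rs y m\<bar> < e k \<and> n \<le> m"
      by eventually_elim simp
    then obtain m where m: "\<bar>rs y m - rs p m\<bar> < \<delta> / 2" "\<bar>rs x m - rs y m\<bar> < e k" "n \<le> m"
      using eventually_happens[of _ at_top] by force
    define D where "D = \<bar>rs x n - rs p n\<bar>"
    have "D < e n + e k + \<delta> / 2 + e n"
      unfolding D_def using R_tail[OF assms(1) m(3)] R_tail[OF assms(2) m(3)] m by linarith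
    then show False using k unfolding \<delta>_def D_def[symmetric] by (simp add: field_simps)
  qed
  then show ?thesis by blast
qed

text \<open>Either the zeros of \<chi> are all equal to one p, from which \<open>sep_ball\<close>
  separates every other point, or there is no zero and any ball will do. The case split is
  classical, so p never has to be located.\<close>

lemma isopen_COMPL:
  assumes "resp \<chi>" and unique: "\<And>x y. x \<in> R \<Longrightarrow> y \<in> R \<Longrightarrow> \<chi> \<bullet> x = Z \<Longrightarrow> \<chi> \<bullet> y = Z \<Longrightarrow> eqr x y"
  shows "isopen (cl SETOF \<bullet> (cl COMPL \<bullet> \<chi>))"
proof -
  have \<chi>: "\<chi> \<in> Dom M ty2" using assms by (simp add: resp_def)
  have "\<exists>k. \<forall>y \<in> R. ball x k y \<longrightarrow> \<chi> \<bullet> y \<noteq> Z" if x: "x \<in> R" "\<chi> \<bullet> x \<noteq> Z" for x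
  proof (cases "\<exists>p \<in> R. \<chi> \<bullet> p = Z")
    case True
    then obtain p where p: "p \<in> R" "\<chi> \<bullet> p = Z" by blast
    have "\<not> eqr x p"
    proof
      assume "eqr x p"
      then have "eqr p x" by (simp add: eqr_def abs_minus_commute)
      then show False using assms(1) x p unfolding resp_def by blast
    qed
    then show ?thesis using sep_ball[OF x(1) p(1)] unique p by blast
  qed blast
  then show ?thesis using assms \<chi> by (auto simp: isopen_def isset_SETOF resp_COMPL)
qed

lemma isclosed_SETOF:
  assumes "resp \<chi>" "\<And>x y. x \<in> R \<Longrightarrow> y \<in> R \<Longrightarrow> \<chi> \<bullet> x = Z \<Longrightarrow> \<chi> \<bullet> y = Z \<Longrightarrow> eqr x y"
  shows "isclosed (cl SETOF \<bullet> \<chi>)"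
proof -
  have "\<chi> \<in> Dom M ty2" using assms by (simp add: resp_def)
  then show ?thesis unfolding isclosed_def
    by (intro conjI bexI[of _ "cl SETOF \<bullet> (cl COMPL \<bullet> \<chi>)"] ballI isset_SETOF isopen_COMPL assms)
      simp_all
qed

end


section \<open>Rescaled copies of the unit interval\<close>

context aca_model
begin

definition tt :: "'n \<Rightarrow> 'n \<Rightarrow> 'u \<Rightarrow> 'u" where "tt n k y = cl TT \<bullet> num n \<bullet> num k \<bullet> y"
definition uu :: "'n \<Rightarrow> 'n \<Rightarrow> 'u \<Rightarrow> 'u" where "uu n k x = cl UU \<bullet> num n \<bullet> num k \<bullet> x"
definition rn :: "'n \<Rightarrow> 'u" where "rn n = cl RN \<bullet> num n"

lemma tt_typed [simp]:
  "y \<in> Dom M ty1 \<Longrightarrow> tt n k y \<in> Dom M ty1" "x \<in> Dom M ty1 \<Longrightarrow> uu n k x \<in> Dom M ty1" "rn n \<in> Dom M ty1"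
proof -
  have "cl TT \<bullet> num n \<bullet> num k \<in> Dom M (ty1 \<rightarrow> ty1)" "cl UU \<bullet> num n \<bullet> num k \<in> Dom M (ty1 \<rightarrow> ty1)"
    by (rule Ap_typed[of _ Base], rule Ap_typed[of _ Base], simp_all)+
  then show "y \<in> Dom M ty1 \<Longrightarrow> tt n k y \<in> Dom M ty1" "x \<in> Dom M ty1 \<Longrightarrow> uu n k x \<in> Dom M ty1"
    by (simp_all add: tt_def uu_def)
  show "rn n \<in> Dom M ty1" unfolding rn_def by (rule Ap_typed[of _ Base]) simp_all
qed

text \<open>With x + 1 at most 2, the exponent k + 2 keeps copy k within half of 2^-k of its base
  point. The other half is room for approximation errors.\<close>

definition c :: "'n \<Rightarrow> 'n difference fract" where "c k = emb (pw (k + 2))"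

lemma c_pos [simp]: "0 < c k" "c k \<noteq> 0" "0 \<le> c k"
proof -
  show "0 < c k" by (simp add: c_def)
  then show "c k \<noteq> 0" "0 \<le> c k" by auto
qed

lemma emb_pw_add: "emb (pw (a + b)) = emb (pw a) * emb (pw b)"
proof -
  have "pw (a + b) = pw a * pw b"
  proof (rule n_induct[where \<rho> = "\<rho>0((1, Base) := num a)" and i = 0 and
        \<phi> = "EqN (POW2 \<cdot> (vn 1 \<oplus> vn 0)) (POW2 \<cdot> vn 1 \<otimes> POW2 \<cdot> vn 0)" and P = "\<lambda>b. pw (a + b) = pw a * pw b"])
    show "pw (a + (b + 1)) = pw a * pw (b + 1)" if "pw (a + b) = pw a * pw b" for b
      using that pw_rec(2)[of "a + b"] by (simp add: add.assoc distrib_left)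
  qed (simp_all add: nu_inject[symmetric] cl_fun_typed)
  then show ?thesis by simp
qed

lemma e_add: "e (a + b) = e a * e b"
  by (simp add: e_def emb_pw_add)

text \<open>Scaling by \<open>c k\<close> costs k + 2 binary digits of precision; this is where the
  shift of index in \<open>TT\<close> comes from.\<close>

lemma c_e: "c k * e (n + (k + 2)) = e n"
  unfolding e_add[of n "k + 2"] using c_pos(2)[of k] by (simp add: c_def e_def[of "k + 2"])

lemma pw_2: "pw (k + 2) = pw k + pw k + (pw k + pw k)"
  using pw_rec(2)[of "k + 1"] by (simp add: add.assoc)

lemma c_eq: "c k = 4 / e k"
proof -
  have "pw 2 = 4" using pw_rec(2)[of 1] pw_rec(2)[of 0] by simp
  then have "emb (pw 2) = 4"
    by (metis emb_2 emb_hom(3) numeral_Bit0 numeral_One one_add_one)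
  then show ?thesis by (simp add: c_def emb_pw_add) (simp add: e_def)
qed

lemma c_ge_4: "4 \<le> c k"
proof -
  have "e k \<le> 1" using e_mono[of 0 k] by simp
  then show ?thesis by (simp add: c_eq field_simps)
qed

lemma rs_tt [simp]:
  assumes "y \<in> Dom M ty1"
  shows "rs (tt n k y) j = c k * (rs y (j + (k + 2)) - emb n) - 1"
proof -
  define q where "q = nu (y \<bullet> num (j + (k + 2)))"
  have q: "y \<bullet> num (j + (k + 2)) = num q" using assms by (simp add: q_def)
  have "nu (tt n k y \<bullet> num j) = npair (npair (pw (k + 2) * nfst (nfst q))
      (pw (k + 2) * (nsnd (nfst q) + n * (nsnd q + 1)) + (nsnd q + 1))) (nsnd q)"
    using assms q
    by (simp add: tt_def TT_def Let_def qcode_def cl_fun_typed pw_2 S_num add.assoc flip: num_plus num_1)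
  then have "rs (tt n k y) j = (c k * emb (nfst (nfst q)) - (c k * (emb (nsnd (nfst q)) + emb n * (emb (nsnd q) + 1))
      + (emb (nsnd q) + 1))) / (emb (nsnd q) + 1)"
    by (simp add: rs_def qv_code c_def del: qv_App)
  also have "\<dots> = c k * (qv q - emb n) - 1"
  proof -
    have *: "(x * a - (x * (b + m * d) + d)) / d = x * ((a - b) / d - m) - 1" if "0 < d"
      for x a b m d :: "'n difference fract"
      using that by (simp add: field_simps)
    show ?thesis unfolding qv_def by (rule *) simp
  qed
  finally show ?thesis by (simp add: rs_def q_def del: qv_App)
qed

lemma rs_uu [simp]:
  assumes "x \<in> Dom M ty1"
  shows "rs (uu n k x) j = emb n + (rs x j + 1) / c k"
proof -
  define q where "q = nu (x \<bullet> num j)"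
  have q: "x \<bullet> num j = num q" using assms by (simp add: q_def)
  have "0 < emb (pw (k + 2) * (nsnd q + 1))" by simp
  then have pos: "0 < pw (k + 2) * (nsnd q + 1)" by (metis emb_hom(1) emb_less)
  have nu: "nu (uu n k x \<bullet> num j) = npair (npair (n * (pw (k + 2) * (nsnd q + 1)) + nfst (nfst q) + (nsnd q + 1))
      (nsnd (nfst q))) (pw (k + 2) * (nsnd q + 1) - 1)"
    using assms q
    by (simp add: uu_def UU_def Let_def qcode_def cl_fun_typed pw_2 flip: num_plus num_1)
  have "rs (uu n k x) j = (emb n * (c k * (emb (nsnd q) + 1)) + emb (nfst (nfst q)) + (emb (nsnd q) + 1)
      - emb (nsnd (nfst q))) / (c k * (emb (nsnd q) + 1))"
    unfolding rs_def nu qv_code emb_pred[OF pos] by (simp add: c_def)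
  also have "\<dots> = emb n + (qv q + 1) / c k"
  proof -
    have *: "(m * (x * d) + a + d - b) / (x * d) = m + ((a - b) / d + 1) / x" if "0 < d" "0 < x"
      for x a b m d :: "'n difference fract"
      using that by (simp add: field_simps)
    show ?thesis unfolding qv_def by (rule *) simp_all
  qed
  finally show ?thesis by (simp add: rs_def q_def del: qv_App)
qed

lemma rs_rn [simp]: "rs (rn n) j = emb n"
  by (simp add: rn_def RN_def num_Z flip: num_1)

lemma tt_R [simp]: "y \<in> R \<Longrightarrow> tt n k y \<in> R"
proof -
  assume y: "y \<in> R"
  have "\<bar>rs (tt n k y) j - rs (tt n k y) (j + i)\<bar> < e j" for j i
  proof -
    have "\<bar>rs y (j + (k + 2)) - rs y (j + i + (k + 2))\<bar> < e (j + (k + 2))"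
      by (rule R_tail[OF y]) (simp add: add_mono)
    then have "c k * \<bar>rs y (j + (k + 2)) - rs y (j + i + (k + 2))\<bar> < e j"
      unfolding c_e[symmetric, of j k] by (rule mult_strict_left_mono) simp
    moreover have "\<bar>rs (tt n k y) j - rs (tt n k y) (j + i)\<bar> =
        \<bar>c k * (rs y (j + (k + 2)) - rs y (j + i + (k + 2)))\<bar>"
      using y by (simp add: algebra_simps)
    ultimately show ?thesis by (simp add: abs_mult)
  qed
  then show ?thesis using tt_typed(1)[OF R_typed[OF y]] unfolding R_def by blast
qed

text \<open>Dividing by \<open>c k\<close>, which is at least 4, only improves convergence; thus
  \<open>UU\<close> reads its argument at the same index, in contrast to \<open>TT\<close>.\<close>

lemma uu_R [simp]: "x \<in> R \<Longrightarrow> uu n k x \<in> R"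
proof -
  assume x: "x \<in> R"
  have "\<bar>rs (uu n k x) j - rs (uu n k x) (j + i)\<bar> < e j" for j i
  proof -
    have "\<bar>rs x j - rs x (j + i)\<bar> < e j" by (rule R_tail[OF x]) simp
    moreover have "\<bar>rs (uu n k x) j - rs (uu n k x) (j + i)\<bar> = \<bar>rs x j - rs x (j + i)\<bar> / c k"
    proof -
      have "rs (uu n k x) j - rs (uu n k x) (j + i) = (rs x j - rs x (j + i)) / c k"
        using x by (simp add: diff_divide_distrib add_divide_distrib)
      then show ?thesis by simp
    qed
    moreover have "\<bar>rs x j - rs x (j + i)\<bar> / c k \<le> \<bar>rs x j - rs x (j + i)\<bar> / 1"
      using c_ge_4[of k] by (intro divide_left_mono) auto
    ultimately show ?thesis by simp
  qed
  then show ?thesis using tt_typed(2)[OF R_typed[OF x]] unfolding R_def by blast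
qed

lemma rn_R [simp]: "rn n \<in> R"
  unfolding R_def using tt_typed(3) by simp

text \<open>Up to a shift of index the distance of two reals is multiplied by a positive constant,
  and tending to zero is invariant under both changes.\<close>

lemma tt_eqr: "y \<in> R \<Longrightarrow> y' \<in> R \<Longrightarrow> eqr (tt n k y) (tt n k y') \<longleftrightarrow> eqr y y'"
proof -
  assume y: "y \<in> R" "y' \<in> R"
  have "rs (tt n k y) j - rs (tt n k y') j = c k * (rs y (j + (k + 2)) - rs y' (j + (k + 2)))" for j
    using y by (simp add: algebra_simps)
  then have *: "\<bar>rs (tt n k y) j - rs (tt n k y') j\<bar> = c k * \<bar>rs y (j + (k + 2)) - rs y' (j + (k + 2))\<bar>" for j
    by (simp add: abs_mult)
  have "rs (tt n k y) \<approx> rs (tt n k y') \<longleftrightarrow>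
      (\<forall>\<epsilon>>0. \<forall>\<^sub>F j in at_top. c k * \<bar>rs y (j + (k + 2)) - rs y' (j + (k + 2))\<bar> < \<epsilon>)"
    unfolding conv_def * ..
  also have "\<dots> \<longleftrightarrow> (\<forall>\<epsilon>>0. \<forall>\<^sub>F j in at_top. c k * \<bar>rs y j - rs y' j\<bar> < \<epsilon>)"
    using ev_shift[of "\<lambda>j. c k * \<bar>rs y j - rs y' j\<bar> < _" "k + 2"] by simp
  also have "\<dots> \<longleftrightarrow> rs y \<approx> rs y'"
    unfolding conv_def
  proof safe
    fix \<epsilon> :: "'n difference fract"
    assume *: "\<forall>\<epsilon>>0. \<forall>\<^sub>F j in at_top. c k * \<bar>rs y j - rs y' j\<bar> < \<epsilon>" and "0 < \<epsilon>"
    then have "0 < c k * \<epsilon>" by simp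
    with * have "\<forall>\<^sub>F j in at_top. c k * \<bar>rs y j - rs y' j\<bar> < c k * \<epsilon>" by blast
    then show "\<forall>\<^sub>F j in at_top. \<bar>rs y j - rs y' j\<bar> < \<epsilon>" by simp
  next
    fix \<epsilon> :: "'n difference fract"
    assume *: "\<forall>\<epsilon>>0. \<forall>\<^sub>F j in at_top. \<bar>rs y j - rs y' j\<bar> < \<epsilon>" and "0 < \<epsilon>"
    then have "0 < \<epsilon> / c k" by simp
    with * have "\<forall>\<^sub>F j in at_top. \<bar>rs y j - rs y' j\<bar> < \<epsilon> / c k" by blast
    then show "\<forall>\<^sub>F j in at_top. c k * \<bar>rs y j - rs y' j\<bar> < \<epsilon>"
      by (rule eventually_mono) (simp add: field_simps)
  qed
  finally show ?thesis using y by (simp add: eqr_iff)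
qed

text \<open>The composition returns x with the index shift of \<open>TT\<close>: in general another
  sequence, but the same real.\<close>

lemma tt_uu: "x \<in> R \<Longrightarrow> eqr (tt n k (uu n k x)) x"
proof -
  assume x: "x \<in> R"
  have "\<bar>rs (tt n k (uu n k x)) j - rs x j\<bar> \<le> 2 * e j" for j
  proof -
    have "rs (tt n k (uu n k x)) j = rs x (j + (k + 2))" using x by simp
    moreover have "\<bar>rs x j - rs x (j + (k + 2))\<bar> < e j" by (rule R_tail[OF x]) simp
    ultimately show ?thesis using e_pos(1)[of j] by linarith
  qed
  then show ?thesis by (simp add: eqr_def)
qed

lemma eqr_sym: "eqr x y \<Longrightarrow> eqr y x"
  by (simp add: eqr_def abs_minus_commute)

lemma unit_iff: "unit x \<longleftrightarrow> (\<forall>n. - (2 * e n) \<le> rs x n \<and> rs x n \<le> 1 + 2 * e n)"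
proof -
  have "- (2 * e n) \<le> rs x n \<longleftrightarrow> \<not> rs x n + 2 * e n < 0" for n by linarith
  then show ?thesis by (auto simp: unit_def lessr_def not_less)
qed

lemma lessr_cong:
  assumes "x \<in> R" "y \<in> R" "x' \<in> R" "y' \<in> R" "eqr x x'" "eqr y y'" "lessr x y"
  shows "lessr x' y'"
proof -
  obtain \<epsilon> where \<epsilon>: "0 < \<epsilon>" "\<forall>\<^sub>F n in at_top. rs x n + \<epsilon> \<le> rs y n"
    using assms by (auto simp: lessr_iff sep_def)
  have "rs x \<approx> rs x'" "rs y \<approx> rs y'" using assms eqr_iff by blast+
  moreover have "0 < \<epsilon> / 4" using \<epsilon> by simp
  ultimately have "\<forall>\<^sub>F n in at_top. \<bar>rs x n - rs x' n\<bar> < \<epsilon> / 4" "\<forall>\<^sub>F n in at_top. \<bar>rs y n - rs y' n\<bar> < \<epsilon> / 4"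
    unfolding conv_def by blast+
  with \<epsilon>(2) have "\<forall>\<^sub>F n in at_top. rs x' n + \<epsilon> / 2 \<le> rs y' n"
  proof eventually_elim
    case (elim n)
    then have "rs x' n < rs x n + \<epsilon> / 4" "rs y n - \<epsilon> / 4 < rs y' n" by linarith+
    then show ?case using elim(1) by (simp add: field_simps)
  qed
  moreover have "0 < \<epsilon> / 2" using \<epsilon> by simp
  ultimately have "rs x' \<prec> rs y'" unfolding sep_def by blast
  then show ?thesis using assms lessr_iff by blast
qed

lemma eqr_refl: "eqr x x"
  by (simp add: eqr_def)

lemma unit_cong: "x \<in> R \<Longrightarrow> y \<in> R \<Longrightarrow> eqr x y \<Longrightarrow> unit x \<Longrightarrow> unit y"
  unfolding unit_def using lessr_cong[of y "cl zeroR" x "cl zeroR"] lessr_cong[of "cl oneR" y "cl oneR" x]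
  by (auto simp: eqr_refl eqr_sym)

lemma emb_gap: "\<bar>emb a - emb b\<bar> < 1 \<Longrightarrow> a = (b :: 'n)"
proof (rule ccontr)
  assume *: "\<bar>emb a - emb b\<bar> < 1" "a \<noteq> b"
  then consider "a + 1 \<le> b" | "b + 1 \<le> a" using n_less_iff by (metis linorder_less_linear)
  then show False
  proof cases
    case 1
    then have "emb (a + 1) \<le> emb b" by (simp only: emb_le)
    then show False using * by simp
  next
    case 2
    then have "emb (b + 1) \<le> emb a" by (simp only: emb_le)
    then show False using * by simp
  qed
qed

section \<open>Deciding the range of an injection\<close>

context
  fixes Y assumes Y [simp]: "Y \<in> Dom M ty2" and inj: "isinj Y"
begin

text \<open>Instead of asking for a preimage x whose copy is y, y is scaled back and Y is evaluated
  there. This keeps the condition free of quantifiers over functions.\<close>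

definition piece :: "'n \<Rightarrow> 'n \<Rightarrow> 'u \<Rightarrow> bool" where
  "piece n k y \<longleftrightarrow> unit (tt n k y) \<and> Y \<bullet> tt n k y = num n"

definition rng :: "'n \<Rightarrow> bool" where "rng n \<longleftrightarrow> (\<exists>x \<in> R. unit x \<and> Y \<bullet> x = num n)"

lemma Y_eq: "x \<in> R \<Longrightarrow> y \<in> R \<Longrightarrow> unit x \<Longrightarrow> unit y \<Longrightarrow> Y \<bullet> x = Y \<bullet> y \<longleftrightarrow> eqr x y"
  using inj by (simp add: isinj_def)

lemma piece_cong: "y \<in> R \<Longrightarrow> y' \<in> R \<Longrightarrow> eqr y y' \<Longrightarrow> piece n k y \<Longrightarrow> piece n k y'"
  unfolding piece_def using tt_eqr unit_cong Y_eq tt_R by metis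

text \<open>Injectivity of Y enters here. It leaves each piece at most one point, and this is what
  makes the piece closed.\<close>

lemma piece_unique: "y \<in> R \<Longrightarrow> y' \<in> R \<Longrightarrow> piece n k y \<Longrightarrow> piece n k y' \<Longrightarrow> eqr y y'"
  unfolding piece_def using tt_eqr Y_eq tt_R by metis

lemma pieces_comprehension:
  obtains \<chi> where "\<chi> \<in> Dom M (Base \<rightarrow> ty2)"
    "\<And>m y. y \<in> Dom M ty1 \<Longrightarrow> \<chi> \<bullet> num m \<bullet> y = Z \<longleftrightarrow> piece (nfst m) (nsnd m) y"
proof -
  let ?t = "TT \<cdot> pfst (vn 0) \<cdot> psnd (vn 0) \<cdot> Var 1 ty1"
  \<comment> \<open>Y is stored at \<open>(1, ty2)\<close> because \<open>(0, ty2)\<close> is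
    reserved for \<open>Ex\<close>; level 2 lies above every index occurring in the terms.\<close>
  let ?\<phi> = "(in_unit ?t \<^bold>\<and> Var 1 ty2 \<cdot> ?t \<^bold>= pfst (vn 0)) 2"
  obtain \<chi> where \<chi>: "\<chi> \<in> Dom M (Base \<rightarrow> ty2)" "\<And>a b. a \<in> N \<Longrightarrow> b \<in> Dom M ty1 \<Longrightarrow>
      \<chi> \<bullet> a \<bullet> b = Z \<longleftrightarrow> sat M (env_of [((1, ty1), b), ((0, Base), a), ((1, ty2), Y)]) ?\<phi>"
    by (rule comprehension2[of "[((1, ty2), Y)]" ?\<phi> 0 Base 1 ty1]) simp_all
  have val: "val M (env_of [((1, ty1), y), ((0, Base), num m), ((1, ty2), Y)]) ?t = tt (nfst m) (nsnd m) y"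
    if "y \<in> Dom M ty1" for m y
  proof -
    let ?\<rho> = "env_of [((1, ty1), y), ((0, Base), num m), ((1, ty2), Y)]"
    have "val M ?\<rho> (pfst (vn 0)) \<in> N" "val M ?\<rho> (psnd (vn 0)) \<in> N"
      "nv ?\<rho> (pfst (vn 0)) = nfst m" "nv ?\<rho> (psnd (vn 0)) = nsnd m"
      using that by simp_all
    then have "val M ?\<rho> (pfst (vn 0)) = num (nfst m)" "val M ?\<rho> (psnd (vn 0)) = num (nsnd m)"
      by (metis num_nu)+
    then show ?thesis using that by (simp add: tt_def)
  qed
  show thesis
  proof (rule that[OF \<chi>(1)])
    fix m y assume y: "y \<in> Dom M ty1"
    have "Y \<bullet> tt (nfst m) (nsnd m) y \<in> N" using y by (intro Ap_typed[of Y ty1]) simp_all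
    then show "\<chi> \<bullet> num m \<bullet> y = Z \<longleftrightarrow> piece (nfst m) (nsnd m) y"
      using \<chi>(2)[of "num m" y] y val[OF y, of m]
      by (simp add: piece_def nu_inject[symmetric] val.simps(7)[where s = "Var (Suc 0) ty2"] del: val.simps(7))
  qed
qed

definition inX :: "'u \<Rightarrow> bool" where "inX y \<longleftrightarrow> (\<exists>n k. piece n k y)"

lemma inX_iff: "inX y \<longleftrightarrow> (\<exists>m. piece (nfst m) (nsnd m) y)"
  unfolding inX_def by (metis nfst_npair nsnd_npair)

text \<open>One functional \<chi> describes all pieces uniformly, so the sequence of closed sets and
  that of their open complements are closed expressions in \<chi>. The union costs one further
  number quantifier, over the paired index.\<close>

lemma X_exists:
  obtains a b where "a \<in> Dom M (ty1 \<rightarrow> ty1)" "isFs a" "\<And>x. x \<in> R \<Longrightarrow> In x a \<longleftrightarrow> inX x"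
    "b \<in> Dom M (ty1 \<rightarrow> ty1)" "isGd b" "\<And>x. x \<in> R \<Longrightarrow> In x b \<longleftrightarrow> \<not> inX x"
proof -
  obtain \<chi> where \<chi>: "\<chi> \<in> Dom M (Base \<rightarrow> ty2)"
    "\<And>m y. y \<in> Dom M ty1 \<Longrightarrow> \<chi> \<bullet> num m \<bullet> y = Z \<longleftrightarrow> piece (nfst m) (nsnd m) y"
    using pieces_comprehension by blast
  let ?xs = "[((0, Base \<rightarrow> ty2), \<chi>)]"
  let ?\<phi> = "(\<exists>\<^sub>0 m. Var 0 (Base \<rightarrow> ty2) \<cdot> m \<cdot> Var 1 ty1 \<^bold>= Zero) 2"
  obtain \<xi> where \<xi>: "\<xi> \<in> Dom M ty2"
    "\<And>y. y \<in> Dom M ty1 \<Longrightarrow> \<xi> \<bullet> y = Z \<longleftrightarrow> sat M (env_of (((1, ty1), y) # ?xs)) ?\<phi>"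
    by (rule comprehension[of ?xs ?\<phi> 1 ty1]) (use \<chi> in simp_all)
  then have \<xi>_iff: "\<xi> \<bullet> y = Z \<longleftrightarrow> inX y" if "y \<in> Dom M ty1" for y
    using that \<chi>(2) by (simp add: inX_iff)
  have \<chi>m: "\<chi> \<bullet> num m \<in> Dom M ty2" for m
    using \<chi>(1) by (intro Ap_typed[of _ Base]) simp_all
  have resp_m: "resp (\<chi> \<bullet> num m)" for m
    unfolding resp_def using \<chi>m \<chi>(2) piece_cong R_typed by blast
  have unique: "eqr x y" if "x \<in> R" "y \<in> R" "\<chi> \<bullet> num m \<bullet> x = Z" "\<chi> \<bullet> num m \<bullet> y = Z" for x y m
    using that \<chi>(2) piece_unique R_typed by blast
  have resp_\<xi>: "resp \<xi>"
    unfolding resp_def using \<xi>(1) \<xi>_iff piece_cong R_typed inX_def by metis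
  let ?F = "val M (env_of ?xs) (lam0 0 (SETOF \<cdot> (Var 0 (Base \<rightarrow> ty2) \<cdot> vn 0)))"
  let ?G = "val M (env_of ?xs) (lam0 0 (SETOF \<cdot> (COMPL \<cdot> (Var 0 (Base \<rightarrow> ty2) \<cdot> vn 0))))"
  have F: "?F \<in> Dom M (Base \<rightarrow> ty1 \<rightarrow> ty1)" "?F \<bullet> num m = cl SETOF \<bullet> (\<chi> \<bullet> num m)" for m
    using \<chi>(1) by simp_all
  have G: "?G \<in> Dom M (Base \<rightarrow> ty1 \<rightarrow> ty1)" "?G \<bullet> num m = cl SETOF \<bullet> (cl COMPL \<bullet> (\<chi> \<bullet> num m))" for m
    using \<chi>(1) by simp_all
  have "isclosed (?F \<bullet> num n)" for n
    unfolding F(2) by (rule isclosed_SETOF[OF resp_m unique])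
  moreover have "In x (cl SETOF \<bullet> \<xi>) \<longleftrightarrow> (\<exists>n. In x (?F \<bullet> num n))" if "x \<in> R" for x
    unfolding F(2) using that \<xi>(1) \<chi>m \<chi>(2) \<xi>_iff by (simp add: inX_iff)
  ultimately have Fs: "isFs (cl SETOF \<bullet> \<xi>)"
    unfolding isFs_def using F(1) isset_SETOF[OF resp_\<xi>] by blast
  have "isopen (?G \<bullet> num n)" for n
    unfolding G(2) by (rule isopen_COMPL[OF resp_m unique])
  moreover have "In x (cl SETOF \<bullet> (cl COMPL \<bullet> \<xi>)) \<longleftrightarrow> (\<forall>n. In x (?G \<bullet> num n))" if "x \<in> R" for x
    unfolding G(2) using that \<xi>(1) \<chi>m \<chi>(2) \<xi>_iff by (simp add: inX_iff)
  ultimately have "isGd (cl SETOF \<bullet> (cl COMPL \<bullet> \<xi>))"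
    unfolding isGd_def using G(1) isset_SETOF[OF resp_COMPL[OF resp_\<xi>]] by blast
  with Fs show thesis
    using \<xi>(1) \<xi>_iff by (intro that[of "cl SETOF \<bullet> \<xi>" "cl SETOF \<bullet> (cl COMPL \<bullet> \<xi>)"]) simp_all
qed

text \<open>The point is copy k of the preimage x. Its approximations exceed n by more than 1 / (2 c
  k), which keeps it different from n, and by less than 2^-k - 1 / c k, which leaves the slack for
  \<open>ballI\<close>.\<close>

lemma rng_approx:
  assumes "rng n"
  shows "\<exists>y \<in> R. ball (rn n) k y \<and> \<not> eqr y (rn n) \<and> inX y"
proof -
  obtain x where x: "x \<in> R" "unit x" "Y \<bullet> x = num n" using assms by (auto simp: rng_def)
  let ?y = "uu n k x"
  have eq: "eqr x (tt n k ?y)" using x tt_uu eqr_sym by blast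
  then have "unit (tt n k ?y)" using unit_cong x by simp
  then have "Y \<bullet> tt n k ?y = num n" using Y_eq[of x "tt n k ?y"] x eq by simp
  then have "inX ?y" using \<open>unit (tt n k ?y)\<close> by (auto simp: inX_def piece_def)
  \<comment> \<open>The bound 1 / 4 turns the tolerance \<open>2 * e m\<close> of
    \<open>unit_iff\<close> into less than 1 / 2; then x + 1 stays above 1 / 2 and x + 2 below 4,
    the numerator in \<open>c_eq\<close>.\<close>
  moreover have small: "\<forall>\<^sub>F m in at_top. e m < 1 / 4" by (rule ev_e) simp
  have bounds: "1 / (2 * c k) < rs ?y m - emb n \<and> rs ?y m - emb n + 1 / c k < e k" if "e m < 1 / 4" for m
  proof -
    have "1 / 2 < rs x m + 1" "rs x m + 1 + 1 < 4"
      using x(2)[unfolded unit_iff, rule_format, of m] that by linarith+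
    then have "1 / 2 / c k < (rs x m + 1) / c k" "(rs x m + 1 + 1) / c k < 4 / c k"
      by (intro divide_strict_right_mono; simp)+
    moreover have "4 / c k = e k" by (simp add: c_eq)
    ultimately show ?thesis using x by (simp add: add_divide_distrib)
  qed
  have "ball (rn n) k ?y"
  proof (rule ballI[of "1 / c k"])
    show "\<forall>\<^sub>F m in at_top. \<bar>rs (rn n) m - rs ?y m\<bar> + 1 / c k \<le> e k"
      using small
    proof eventually_elim
      case (elim m)
      have "0 < 1 / (2 * c k)" by simp
      then have "0 < rs ?y m - emb n" using bounds[OF elim] by linarith
      then show ?case using bounds[OF elim] unfolding rs_rn by linarith
    qed
  qed simp
  moreover have "\<not> eqr ?y (rn n)"
  proof
    assume "eqr ?y (rn n)"
    then have "rs ?y \<approx> rs (rn n)" using eqr_iff x(1) by simp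
    moreover have "0 < 1 / (2 * c k)" by simp
    ultimately have "\<forall>\<^sub>F m in at_top. \<bar>rs ?y m - rs (rn n) m\<bar> < 1 / (2 * c k)"
      unfolding conv_def by blast
    with small have "\<forall>\<^sub>F m :: 'n in at_top. False"
    proof eventually_elim
      case (elim m)
      then show ?case using bounds[of m] unfolding rs_rn by linarith
    qed
    then show False by simp
  qed
  ultimately show ?thesis using x(1) by (intro bexI[of _ ?y]) simp_all
qed

text \<open>The radius 2^-2 is small enough to identify the base point. A piece with base n' has
  approximations strictly between n' and n' + 3 / 4, so n and n' differ by less than 1 / 4 + 3 / 4
  and must be equal.\<close>

lemma approx_rng:
  assumes "y \<in> R" "ball (rn n) 2 y" "inX y"
  shows "rng n"
proof -
  obtain n' k where p: "unit (tt n' k y)" "Y \<bullet> tt n' k y = num n'"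
    using assms by (auto simp: inX_def piece_def)
  have e_2: "e 2 = 1 / 4"
  proof -
    have "4 * e 2 = 1" using e_double[of 1] e_double[of 0] by simp
    then show ?thesis by simp
  qed
  have "\<forall>\<^sub>F m in at_top. \<bar>rs (rn n) m - rs y m\<bar> < e 2"
    using assms by (intro ball_less) simp_all
  then have "\<forall>\<^sub>F m in at_top. \<bar>emb n - rs y m\<bar> < 1 / 4" by (simp only: e_2 rs_rn)
  then have "\<forall>\<^sub>F m in at_top. \<bar>emb n - rs y (m + (k + 2))\<bar> < 1 / 4"
    by (simp only: ev_shift[of "\<lambda>m. \<bar>emb n - rs y m\<bar> < 1 / 4" "k + 2"])
  moreover have "\<forall>\<^sub>F m in at_top. e m < 1 / 4" by (rule ev_e) simp
  ultimately have "\<forall>\<^sub>F m in at_top. \<bar>emb n - rs y (m + (k + 2))\<bar> < 1 / 4 \<and> e m < 1 / 4"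
    by (rule eventually_conj)
  then obtain m where m: "\<bar>emb n - rs y (m + (k + 2))\<bar> < 1 / 4" "e m < 1 / 4"
    using eventually_happens[of _ at_top] by force
  define v where "v = rs y (m + (k + 2)) - emb n'"
  have "- (2 * e m) \<le> c k * v - 1" "c k * v - 1 \<le> 1 + 2 * e m"
    using p(1) assms(1) unfolding unit_iff v_def by (metis R_typed rs_tt)+
  then have cv: "0 < c k * v" "c k * v < 3" using m(2) by (simp_all add: field_simps)
  then have "0 < v" using zero_less_mult_pos c_pos(1) by blast
  then have "4 * v \<le> c k * v" using c_ge_4 by (intro mult_right_mono) simp_all
  then have "v < 3 / 4" using cv(2) by simp
  then have "\<bar>emb n - emb n'\<bar> < 1"
    using \<open>0 < v\<close> m(1) unfolding v_def abs_less_iff by linarith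
  then have "n = n'" by (rule emb_gap)
  then show ?thesis using p assms(1) by (auto simp: rng_def intro!: bexI[of _ "tt n' k y"])
qed

text \<open>The points just outside n belong to X for arbitrarily small distances if n is a value of
  Y, and for no distance up to 1 / 4 otherwise. The closure of X therefore contains n in the first
  case only, the interior of the complement in the second only.\<close>

lemma rng_decidable:
  assumes "sat M \<rho>0 Fsigma_closure \<or> sat M \<rho>0 Gdelta_interior"
  obtains r where "r \<in> Dom M ty1" "\<And>n. r \<bullet> num n = Z \<longleftrightarrow> rng n"
proof -
  obtain a b where X: "a \<in> Dom M (ty1 \<rightarrow> ty1)" "isFs a" "\<And>x. x \<in> R \<Longrightarrow> In x a \<longleftrightarrow> inX x"
    "b \<in> Dom M (ty1 \<rightarrow> ty1)" "isGd b" "\<And>x. x \<in> R \<Longrightarrow> In x b \<longleftrightarrow> \<not> inX x"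
    using X_exists by blast
  note result = that
  \<comment> \<open>The gain over the definition of \<open>rng\<close>: membership of the real n in
    a given set c is arithmetical in c, so comprehension yields the function.\<close>
  have decide: thesis if c: "c \<in> Dom M (ty1 \<rightarrow> ty1)"
    and A: "wff (A 1)" "arith_fm (A 1)"
      "\<And>n. sat M (env_of [((0, Base), num n), ((0, ty1 \<rightarrow> ty1), c)]) (A 1) \<longleftrightarrow> rng n" for c A
  proof -
    obtain r where r: "r \<in> Dom M ty1"
      "\<And>x. x \<in> N \<Longrightarrow> r \<bullet> x = Z \<longleftrightarrow> sat M (env_of [((0, Base), x), ((0, ty1 \<rightarrow> ty1), c)]) (A 1)"
      by (rule comprehension[of "[((0, ty1 \<rightarrow> ty1), c)]" "A 1" 0 Base]) (use c A in simp_all)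
    show thesis
    proof (rule result[OF r(1)])
      show "r \<bullet> num n = Z \<longleftrightarrow> rng n" for n
        using r(2)[OF num_N, of n] A(3)[of n] by (rule trans)
    qed
  qed
  let ?A = "RN \<cdot> vn 0 \<in>\<^sub>R Var 0 (ty1 \<rightarrow> ty1)"
  have sat_A: "sat M (env_of [((0, Base), num n), ((0, ty1 \<rightarrow> ty1), c)]) (?A 1) \<longleftrightarrow> In (rn n) c"
    if "c \<in> Dom M (ty1 \<rightarrow> ty1)" for n c
    using that by (simp add: rn_def)
  from assms show thesis
  proof
    assume "sat M \<rho>0 Fsigma_closure"
    then obtain c where c: "c \<in> Dom M (ty1 \<rightarrow> ty1)" "\<forall>x \<in> R. In x c \<longleftrightarrow> In x a \<or> limpt a x"
      using X sat_Fsigma_closure by blast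
    have "In (rn n) c \<longleftrightarrow> rng n" for n
    proof
      assume "In (rn n) c"
      then consider "inX (rn n)" | "limpt a (rn n)" using c(2) X(3) rn_R by blast
      then show "rng n"
      proof cases
        case 1
        then show ?thesis using approx_rng ball_refl rn_R by blast
      next
        case 2
        then show ?thesis unfolding limpt_def using approx_rng X(3) by blast
      qed
    next
      assume "rng n"
      then have "limpt a (rn n)" unfolding limpt_def using rng_approx X(3) by blast
      then show "In (rn n) c" using c(2) rn_R by blast
    qed
    then show thesis using c(1) sat_A by (intro decide[of c ?A]) simp_all
  next
    assume "sat M \<rho>0 Gdelta_interior"
    then obtain c where c: "c \<in> Dom M (ty1 \<rightarrow> ty1)"
      "\<forall>x \<in> R. In x c \<longleftrightarrow> In x b \<and> (\<exists>k. \<forall>y \<in> R. ball x k y \<longrightarrow> In y b)"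
      using X sat_Gdelta_interior by blast
    have "In (rn n) c \<longleftrightarrow> \<not> rng n" for n
    proof
      assume "In (rn n) c"
      then obtain k where "\<forall>y \<in> R. ball (rn n) k y \<longrightarrow> \<not> inX y" using c(2) X(6) rn_R by blast
      then show "\<not> rng n" using rng_approx by blast
    next
      assume "\<not> rng n"
      then have "\<forall>y \<in> R. ball (rn n) 2 y \<longrightarrow> In y b" using approx_rng X(6) by blast
      then show "In (rn n) c" using c(2) rn_R ball_refl by blast
    qed
    then show thesis using c(1) sat_A by (intro decide[of c "\<^bold>\<not> ?A"]) simp_all
  qed
qed

text \<open>Choice demands a real for every n, hence the condition is made conditional on n being a
  value. Its premise is expressible by an arithmetical formula because r decides the range.\<close>

lemma enumeration:
  assumes "r \<in> Dom M ty1" "\<And>n. r \<bullet> num n = Z \<longleftrightarrow> rng n"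
  obtains g where "g \<in> Dom M (Base \<rightarrow> ty1)"
    "\<And>n. rng n \<Longrightarrow> g \<bullet> num n \<in> R \<and> unit (g \<bullet> num n) \<and> Y \<bullet> (g \<bullet> num n) = num n"
proof -
  let ?xs = "[((1, ty2), Y), ((2, ty1), r)]"
  let ?\<phi> = "(Var 2 ty1 \<cdot> vn 0 \<^bold>= Zero \<^bold>\<longrightarrow> is_real (Var 1 ty1) \<^bold>\<and> in_unit (Var 1 ty1) \<^bold>\<and> Var 1 ty2 \<cdot> Var 1 ty1 \<^bold>= vn 0) 3"
  obtain P where P: "P \<in> Dom M (Base \<rightarrow> ty2)" "\<And>n x. n \<in> N \<Longrightarrow> x \<in> Dom M ty1 \<Longrightarrow>
      P \<bullet> n \<bullet> x = Z \<longleftrightarrow> sat M (env_of (((1, ty1), x) # ((0, Base), n) # ?xs)) ?\<phi>"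
    by (rule comprehension2[of ?xs ?\<phi> 0 Base 1 ty1]) (use assms in simp_all)
  have P_iff: "P \<bullet> num n \<bullet> x = Z \<longleftrightarrow> (rng n \<longrightarrow> x \<in> R \<and> unit x \<and> Y \<bullet> x = num n)"
    if "x \<in> Dom M ty1" for n x
    using P(2)[OF num_N that, of n] assms that by simp
  have "\<exists>x \<in> Dom M ty1. P \<bullet> num n \<bullet> x = Z" for n
  proof (cases "rng n")
    case True
    then show ?thesis using P_iff unfolding rng_def by (meson R_typed)
  next
    case False
    \<comment> \<open>Outside the range the condition is void, and the real n serves as a
      default.\<close>
    then show ?thesis using P_iff rn_R R_typed by blast
  qed
  then obtain g where g: "g \<in> Dom M (Base \<rightarrow> ty1)" "\<And>n. P \<bullet> num n \<bullet> (g \<bullet> num n) = Z"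
    using choice[OF P(1)] by blast
  moreover have "g \<bullet> num n \<in> Dom M ty1" for n using g(1) by (intro Ap_typed[of g Base]) simp_all
  ultimately show thesis using P_iff that by blast
qed

end

section \<open>Diagonalization\<close>

lemma qfree_form [simp]:
  "qfree ((s \<le>\<^sub>Q t) d)" "qfree ((A \<^bold>\<and> B) d) \<longleftrightarrow> qfree (A d) \<and> qfree (B d)"
  by (simp_all add: qle_def le0_def eq0_def fand_def Conj_def Neg_def)

lemma add_numerals: "x + 1 + 1 = x + (2 :: 'n)" "x + 2 + 1 = x + (3 :: 'n)" "x + 3 + 1 = x + (4 :: 'n)"
  by (simp_all add: add.assoc)

abbreviation three :: tm where "three \<equiv> Succ \<cdot> two"
abbreviation four :: tm where "four \<equiv> Succ \<cdot> three"

lemma emb_3 [simp]: "emb (3 :: 'n) = 3"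
  using emb_hom(3)[of 2 "1 :: 'n"] by (simp del: emb_hom(3))

text \<open>In step \<open>n\<close> the current interval \<open>[z n, z n + 4 ^ -n]\<close> is replaced by its first or last quarter,
  whichever is far from the \<open>n\<close>-th real.\<close>
lemma diagonal_sequence:
  assumes g: "g \<in> Dom M (Base \<rightarrow> ty1)"
  obtains z where "z \<in> Dom M ty1" "rs z 0 = 0"
    "\<And>n. rs z (n + 1) = (if rs (g \<bullet> num n) (n + n + 4) < rs z n + 2 * e (n + n + 2)
       then rs z n + 3 * e (n + n + 2) else rs z n)"
proof -
  \<comment> \<open>Variable 5 is the previous left endpoint and variable 6 the step number, in the
    order in which \<open>Rc\<close> supplies them. The threshold is the midpoint of the current
    interval, and the n-th real is read with an error below a quarter of the next interval's
    length.\<close>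
  define test where "test = (Var 2 (Base \<rightarrow> ty1) \<cdot> vn 6 \<cdot> (vn 6 \<oplus> vn 6 \<oplus> four) <\<^sub>Q
      vn 5 +\<^sub>Q dyad two (vn 6 \<oplus> vn 6 \<oplus> two)) 7"
  \<comment> \<open>A recursion whose step ignores its arguments is a case distinction: value 0 of
    the test selects the shifted endpoint, a successor keeps the old one.\<close>
  define step where "step = Rc \<cdot> CH test \<cdot> (vn 5 +\<^sub>Q dyad three (vn 6 \<oplus> vn 6 \<oplus> two)) \<cdot> lam0 7 (lam0 8 (vn 5))"
  let ?\<rho> = "env_of [((2, Base \<rightarrow> ty1), g)]"
  define z where "z = val M ?\<rho> (lam0 4 (Rc \<cdot> vn 4 \<cdot> dyad Zero Zero \<cdot> lam0 5 (lam0 6 step)))"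
  have test: "wff test" "arith_fm test" by (simp_all add: test_def)
  then have step: "wt step" "ty_of step = Base" by (simp_all add: step_def)
  have z: "z \<in> Dom M ty1" using step g by (simp add: z_def)
  have z_0: "rs z 0 = 0" using step g by (simp add: z_def rs_def num_Z del: qv_App)
  have z_Suc: "z \<bullet> num (n + 1) =
      val M (env_of [((6, Base), num n), ((5, Base), z \<bullet> num n), ((2, Base \<rightarrow> ty1), g)]) step" for n
  proof -
    have fv: "fv_tm step \<subseteq> {(2, Base \<rightarrow> ty1), (5, Base), (6, Base), (0, ty2)}"
      using fv_CH[OF test(2)] by (auto simp: step_def test_def)
    define L where "L = val M ?\<rho> (lam0 5 (lam0 6 step))"
    have L: "L \<in> Dom M (Base \<rightarrow> ty1)" using step g by (simp add: L_def)
    \<comment> \<open>The step term is free of variable 4, which carries the recursion argument, so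
      its abstraction has one value L at all stages.\<close>
    have "val M (env_of [((4, Base), a), ((2, Base \<rightarrow> ty1), g)]) (lam0 5 (lam0 6 step)) = L" for a
      unfolding L_def by (rule val_cong) (use fv in auto)
    then have z_rec: "z \<bullet> num m = Cn M Rc \<bullet> num m \<bullet> cl (dyad Zero Zero) \<bullet> L" for m
      using step g by (simp add: z_def val_cl)
    then have "z \<bullet> num (n + 1) = L \<bullet> (z \<bullet> num n) \<bullet> num n"
      unfolding z_rec unfolding S_num[symmetric] using L by simp
    moreover have "z \<bullet> num n \<in> N" using z by simp
    ultimately show ?thesis using step g by (simp add: L_def)
  qed
  have "rs z (n + 1) = (if rs (g \<bullet> num n) (n + n + 4) < rs z n + 2 * e (n + n + 2)
       then rs z n + 3 * e (n + n + 2) else rs z n)" for n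
  proof -
    let ?\<rho>' = "env_of [((6, Base), num n), ((5, Base), z \<bullet> num n), ((2, Base \<rightarrow> ty1), g)]"
    have env: "env M ?\<rho>'" using g z by simp
    have gn: "g \<bullet> num n \<in> Dom M ty1" using g by (intro Ap_typed[of g Base]) simp_all
    have sat: "nv ?\<rho>' (CH test) = 0 \<longleftrightarrow> rs (g \<bullet> num n) (n + n + 4) < rs z n + 2 * e (n + n + 2)"
      using env test g z gn by (subst CH) (simp_all add: test_def add_numerals)
    have "val M ?\<rho>' (CH test) \<in> N" using env test by simp
    then consider "val M ?\<rho>' (CH test) = Z" | x where "x \<in> N" "val M ?\<rho>' (CH test) = S x"
      using N_cases by blast
    then show ?thesis
    proof cases
      case 1
      then have "rs (g \<bullet> num n) (n + n + 4) < rs z n + 2 * e (n + n + 2)" using sat by simp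
      moreover have "z \<bullet> num (n + 1) = val M ?\<rho>' (vn 5 +\<^sub>Q dyad three (vn 6 \<oplus> vn 6 \<oplus> two))"
        unfolding z_Suc step_def using 1 env z by simp
      then have "rs z (n + 1) = rs z n + 3 * e (n + n + 2)"
        unfolding rs_def using env z by (simp add: add_numerals)
      ultimately show ?thesis by simp
    next
      case 2
      then have "\<not> rs (g \<bullet> num n) (n + n + 4) < rs z n + 2 * e (n + n + 2)"
        using sat by (simp add: add_nonneg_eq_0_iff)
      moreover have "z \<bullet> num (n + 1) = z \<bullet> num n"
        unfolding z_Suc step_def using 2 env z by simp
      then have "rs z (n + 1) = rs z n" by (simp add: rs_def del: qv_App)
      ultimately show ?thesis by simp
    qed
  qed
  with z z_0 show thesis by (rule that)
qed

text \<open>Since a real is known only up to its precision, comparison with the midpoint may err.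
  Moving to an outer quarter leaves a gap wide enough to survive the error.\<close>

lemma diagonal:
  assumes g: "g \<in> Dom M (Base \<rightarrow> ty1)"
  obtains z where "z \<in> R" "unit z" "\<And>n. g \<bullet> num n \<in> R \<Longrightarrow> \<not> eqr (g \<bullet> num n) z"
proof -
  obtain z where z: "z \<in> Dom M ty1" "rs z 0 = 0" and
    z_Suc: "\<And>n. rs z (n + 1) = (if rs (g \<bullet> num n) (n + n + 4) < rs z n + 2 * e (n + n + 2)
       then rs z n + 3 * e (n + n + 2) else rs z n)"
    using diagonal_sequence[OF g] by blast
  have e_2: "e (n + n) = 4 * e (n + n + 2)" for n
    using e_double[of "n + n + 1"] e_double[of "n + n"] by (simp add: add.assoc)
  \<comment> \<open>The intervals of length 4^-n are nested. Fixing n and letting the distance i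
    vary keeps the induction formula quantifier-free.\<close>
  have nest: "rs z n \<le> rs z (n + i) \<and> rs z (n + i) + e (n + i + (n + i)) \<le> rs z n + e (n + n)" for n i
  proof (rule n_induct[where \<rho> = "env_of [((1, Base), num n), ((0, ty1), z)]" and i = 0 and
        \<phi> = "(Var 0 ty1 \<cdot> vn 1 \<le>\<^sub>Q Var 0 ty1 \<cdot> (vn 1 \<oplus> vn 0) \<^bold>\<and>
          Var 0 ty1 \<cdot> (vn 1 \<oplus> vn 0) +\<^sub>Q dyad one (vn 1 \<oplus> vn 0 \<oplus> (vn 1 \<oplus> vn 0)) \<le>\<^sub>Q
          Var 0 ty1 \<cdot> vn 1 +\<^sub>Q dyad one (vn 1 \<oplus> vn 1)) 2" and
        P = "\<lambda>i. rs z n \<le> rs z (n + i) \<and> rs z (n + i) + e (n + i + (n + i)) \<le> rs z n + e (n + n)"])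
    fix i assume IH: "rs z n \<le> rs z (n + i) \<and> rs z (n + i) + e (n + i + (n + i)) \<le> rs z n + e (n + n)"
    define m where "m = n + i"
    have "n + (i + 1) = m + 1" "n + (i + 1) + (n + (i + 1)) = m + m + 2"
      by (simp_all only: m_def one_add_one[symmetric] add_ac)
    then show "rs z n \<le> rs z (n + (i + 1)) \<and>
        rs z (n + (i + 1)) + e (n + (i + 1) + (n + (i + 1))) \<le> rs z n + e (n + n)"
      using IH e_2[of m] z_Suc[of m] unfolding m_def[symmetric]
      by (simp split: if_splits; insert e_pos(1)[of "m + m + 2"]; linarith)
  qed (use z in simp_all)
  have zR: "z \<in> R"
  proof -
    have "\<bar>rs z n - rs z (n + i)\<bar> < e n" for n i
    proof -
      have "e (n + n) \<le> e n" by (rule e_mono) simp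
      then show ?thesis using nest[of n i] e_pos(1)[of "n + i + (n + i)"] by linarith
    qed
    then show ?thesis using z unfolding R_def by blast
  qed
  moreover have "unit z" unfolding unit_iff
  proof
    fix n
    have "0 \<le> rs z n" "rs z n + e (n + n) \<le> 1" using nest[of 0 n] z(2) by simp_all
    then show "- (2 * e n) \<le> rs z n \<and> rs z n \<le> 1 + 2 * e n"
      using e_pos(1)[of n] e_pos(1)[of "n + n"] by linarith
  qed
  moreover have "\<not> eqr (g \<bullet> num n) z" if gn: "g \<bullet> num n \<in> R" for n
  proof
    define d where "d = e (n + n + 2)"
    have "0 < d" by (simp add: d_def)
    have e4: "e (n + n + 4) = d / 4"
    proof -
      have "4 * e (n + n + 4) = d"
        using e_double[of "n + n + 2"] e_double[of "n + n + 3"] by (simp add: d_def add.assoc)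
      then show ?thesis by simp
    qed
    assume "eqr (g \<bullet> num n) z"
    then have "rs (g \<bullet> num n) \<approx> rs z" using gn zR eqr_iff by blast
    moreover have "0 < d / 2" using \<open>0 < d\<close> by simp
    ultimately have "\<forall>\<^sub>F m in at_top. \<bar>rs (g \<bullet> num n) m - rs z m\<bar> < d / 2"
      unfolding conv_def by blast
    moreover have "\<forall>\<^sub>F m in at_top. n + n + 4 \<le> m" by (rule eventually_ge_at_top)
    ultimately have "\<forall>\<^sub>F m in at_top. \<bar>rs (g \<bullet> num n) m - rs z m\<bar> < d / 2 \<and> n + n + 4 \<le> m"
      by (rule eventually_conj)
    then obtain m where m: "\<bar>rs (g \<bullet> num n) m - rs z m\<bar> < d / 2" "n + n + 4 \<le> m"
      using eventually_happens[of _ at_top] by force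
    have gm: "\<bar>rs (g \<bullet> num n) (n + n + 4) - rs (g \<bullet> num n) m\<bar> < d / 4"
      using R_tail[OF gn m(2)] e4 by simp
    have "n + 1 \<le> n + n + 4"
      using add_mono[of 0 n 1 4] by (simp add: add.assoc)
    then obtain i where i: "m = n + 1 + i" using m(2) by (metis le_add_diff_inverse order_trans)
    have "rs z (n + 1) \<le> rs z m" "rs z m < rs z (n + 1) + d"
    proof -
      have "n + 1 + (n + 1) = n + n + 2" by (simp only: one_add_one[symmetric] add_ac)
      then show "rs z (n + 1) \<le> rs z m" "rs z m < rs z (n + 1) + d"
        using nest[of "n + 1" i] unfolding i d_def
        by (simp_all, insert e_pos(1)[of "n + 1 + i + (n + 1 + i)"], linarith)
    qed
    \<comment> \<open>Reading at index m moves the n-th real by less than d / 4 from its tested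
      value. In both cases z stays at least d on the other side of the midpoint, so the two are more
      than 3 d / 4 apart, against the assumed d / 2.\<close>
    then show False
      using m(1) gm \<open>0 < d\<close> z_Suc[of n] unfolding d_def[symmetric] by (cases "rs (g \<bullet> num n) (n + n + 4) < rs z n + 2 * d"; simp; linarith)
  qed
  ultimately show thesis by (rule that)
qed

text \<open>The diagonal real z betrays itself through n = Y z: this n is a value of Y, so entry n
  of the enumeration is a real with the same value, and injectivity makes it equal to z.\<close>

theorem NIN_of_principles:
  assumes "sat M \<rho>0 Fsigma_closure \<or> sat M \<rho>0 Gdelta_interior"
  shows "sat M \<rho>0 NIN"
proof -
  have False if Y: "Y \<in> Dom M ty2" "isinj Y" for Y
  proof -
    obtain r where "r \<in> Dom M ty1" "\<And>n. r \<bullet> num n = Z \<longleftrightarrow> rng Y n"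
      using rng_decidable[OF Y assms] by blast
    then obtain g where g: "g \<in> Dom M (Base \<rightarrow> ty1)"
      "\<And>n. rng Y n \<Longrightarrow> g \<bullet> num n \<in> R \<and> unit (g \<bullet> num n) \<and> Y \<bullet> (g \<bullet> num n) = num n"
      using enumeration[OF Y] by blast
    obtain z where z: "z \<in> R" "unit z" "\<And>n. g \<bullet> num n \<in> R \<Longrightarrow> \<not> eqr (g \<bullet> num n) z"
      using diagonal[OF g(1)] by blast
    define n where "n = nu (Y \<bullet> z)"
    have "Y \<bullet> z \<in> N" using Y z by (intro Ap_typed[of Y ty1]) simp_all
    then have n: "Y \<bullet> z = num n" by (simp add: n_def)
    then have "rng Y n" using z by (auto simp: rng_def[OF Y])
    then have "g \<bullet> num n \<in> R" "unit (g \<bullet> num n)" "Y \<bullet> (g \<bullet> num n) = Y \<bullet> z" using g(2) n by auto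
    then have "eqr (g \<bullet> num n) z" using Y_eq[OF Y] z by blast
    then show False using z \<open>g \<bullet> num n \<in> R\<close> by blast
  qed
  then show ?thesis unfolding sat_NIN by blast
qed

end

text \<open>The existence of M ensures that the global choice \<open>CM\<close> is a countermodel
  too and that \<open>mnum\<close> consists of its numbers. The contradiction is then obtained in
  \<open>CM\<close> in place of M.\<close>

lemma no_countermodel: "\<not> countermodel M"
proof
  assume "countermodel M"
  then have ex: "\<exists>M. countermodel M" by blast
  have CM: "countermodel CM" unfolding CM_def by (rule someI_ex[OF ex])
  interpret pra_model CM by (rule pra_model_CM[OF ex])
  interpret aca_model CM Rep_mnum
  proof
    show "range Rep_mnum = N"
      using ex type_definition.Rep_range[OF type_definition_mnum] by (simp add: carr_def)
    show "inj Rep_mnum" by (simp add: inj_def Rep_mnum_inject)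
    show "\<phi> \<in> ACA0\<omega> \<union> QF_AC Base ty1 \<Longrightarrow> wff \<phi> \<Longrightarrow> valid CM \<phi>" for \<phi>
      using CM by (auto simp: countermodel_def)
  qed (simp_all add: Rep_mnum_hom carr_z_def carr_s_def carr_p_def carr_t_def carr_m_def ex)
  have "(sat CM \<rho>0 Fsigma_closure \<or> sat CM \<rho>0 Gdelta_interior) \<and> \<not> sat CM \<rho>0 NIN"
    using CM env_\<rho>0 unfolding countermodel_def by blast
  then show False using NIN_of_principles by blast
qed

theorem theorem2p4:
  shows "(ACA0\<omega> \<union> QF_AC Base ty1 \<turnstile> Imp Fsigma_closure NIN) \<and>
         (ACA0\<omega> \<union> QF_AC Base ty1 \<turnstile> Imp Gdelta_interior NIN)"
proof -
  have "ACA0\<omega> \<union> QF_AC Base ty1 \<turnstile> Imp \<phi> NIN" if "\<phi> = Fsigma_closure \<or> \<phi> = Gdelta_interior" for \<phi>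
  proof (rule ccontr)
    assume *: "\<not> (ACA0\<omega> \<union> QF_AC Base ty1 \<turnstile> Imp \<phi> NIN)"
    have "wff (Imp \<phi> NIN)" "fv (Imp \<phi> NIN) = {}" using that by auto
    moreover have "eq_axioms \<union> ext_axioms \<subseteq> ACA0\<omega> \<union> QF_AC Base ty1"
      by (auto simp: ACA0\<omega>_def RCA0\<omega>_def E_PRA_def)
    ultimately obtain M :: "tm set interp" where "ext_model M"
      "\<And>\<psi>. \<psi> \<in> ACA0\<omega> \<union> QF_AC Base ty1 \<Longrightarrow> wff \<psi> \<Longrightarrow> valid M \<psi>"
      "\<And>\<rho>. env M \<rho> \<Longrightarrow> \<not> sat M \<rho> (Imp \<phi> NIN)"
      using ext_completeness[OF *] by blast
    then have "countermodel M" using that by (auto simp: countermodel_def)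
    then show False using no_countermodel by blast
  qed
  then show ?thesis by blast
qed

end
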